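(* Let $f:S^n\to S^m$ be an LOMSE of $(n,p,k)$-type, and let $M_{f,\theta}$ and $C_{f,\theta}$ be the corresponding LOS and LOC. Let $Q_0:=\{x_1=\cdots=x_{n+1}=0\}\subset\mathbb R^{n+m+2}$. Then: (A) All normal planes of $M_{f,\theta}$ in $S^{n+m+1}$ (regarded as $(m+1)$-dimensional linear subspaces of $\mathbb R^{n+m+2}$) make a constant acute angle $\alpha_{n,p,k}$ with $Q_0$, where $$\cos\alpha_{n,p,k}=\sqrt{\frac{1-\frac pn}{1-\frac{p}{k(k+n-1)}}}\cdot\left(\frac{n-p}{k(k+n-1)-p}\right)^{p/2}.$$ (B) The volume of $M_{f,\theta}$ is $$V_{n,p,k}=\left(\frac{k(k+n-1)}{n}\right)^{p/2}\left(\frac{1-\frac pn}{1-\frac p{k(k+n-1)}}\right)^{\frac{n-p}{2}}\omega_n,$$ where $\omega_n$ is the volume of the $n$-dimensional unit Euclidean sphere. (C) $C_{f,\theta}$ is an entire minimal graph (over $Q_0^\perp=\mathbb R^{n+1}$) with constant Jordan angles relative to $Q_0^\perp$. The Jordan angles of $C_{f,\theta}$ are $$\arccos\sqrt{\frac{n-p}{k(k+n-1)-p}},\qquad \arccos\sqrt{\frac{1-\frac pn}{1-\frac{p}{k(k+n-1)}}},\qquad 0,$$ of multiplicities $p$, $1$, $n-p$ respectively. The slope function of $C_{f,\theta}$ is identically equal to $W_{n,p,k}:=\sec\alpha_{n,p,k}$.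
   Context: $S^d\subset\mathbb R^{d+1}$ is the unit sphere with canonical metric $g_d$. Singular values of $(f_* )_x:(T_xS^n,g_n)\to(T_{f(x)}S^m,g_m)$ are counted with multiplicity. For smooth $f:S^n\to S^m$ and $\theta\in(0,\pi/2)$ put $M_{f,\theta}:=\{(\cos\theta\cdot x,\sin\theta\cdot f(x)):x\in S^n\}\subset S^{n+m+1}\subset\mathbb R^{n+m+2}=\mathbb R^{n+1}\times\mathbb R^{m+1}$. The map $f$ is a Lawson-Osserman map (LOM) if $M_{f,\theta}$ is a minimal submanifold of $S^{n+m+1}$ for some $\theta\in(0,\pi/2)$; then $M_{f,\theta}$ is called a Lawson-Osserman sphere (LOS) and the cone $C_{f,\theta}$ over $M_{f,\theta}$ a Lawson-Osserman cone (LOC). An LOMSE is an LOM that is not totally geodesic (as a map $(S^n,g_n)\to(S^m,g_m)$) and such that, for each $x$, all nonzero singular values of $(f_* )_x$ are equal. It is of $(n,p,k)$-type if its nonzero singular value $\lambda$ is constant with constant multiplicity $p$ and all components $f_1,\dots,f_{m+1}$ of $f$ are spherical harmonics of degree $k\ge2$ (every LOMSE is of such a type). For an LOMSE of $(n,p,k)$-type, $\lambda=\sqrt{k(k+n-1)/p}$ and the only $\theta\in(0,\pi/2)$ for which $M_{f,\theta}$ is minimal is $\theta=\arccos\sqrt{\frac{1-p/n}{1-p/(k(k+n-1))}}$; this is the $\theta$ of the corresponding LOS and LOC. The cone $C_{f,\theta}$ is the graph of $F_{f,\theta}:\mathbb R^{n+1}\to\mathbb R^{m+1}$, $F_{f,\theta}(y)=\tan\theta\,|y|\,f(y/|y|)$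 for $y\ne0$, $F_{f,\theta}(0)=0$; minimality, tangent planes, Jordan angles and slope function are considered away from the origin. The acute angle $\alpha$ between two $(m+1)$-dimensional subspaces with orthonormal bases $\{\nu_j\}$ and $\{\varepsilon_j\}$ is given by $\cos\alpha=|\langle\nu_1\wedge\cdots\wedge\nu_{m+1},\varepsilon_1\wedge\cdots\wedge\varepsilon_{m+1}\rangle|$. The Jordan angles of the graph relative to $Q_0^\perp$ at a point are the principal angles $\theta_0,\dots,\theta_n$ between its $(n+1)$-dimensional tangent plane and $Q_0^\perp=\mathbb R^{n+1}\times\{0\}$; the slope function is $W=\prod_{j=0}^n\sec\theta_j$ (equivalently $\sqrt{\det(\delta_{ij}+\sum_\alpha \partial_iF^\alpha\partial_jF^\alpha)}$). *)

theory Defs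
  imports "HOL-Analysis.Analysis"
begin

section \<open>Smooth maps, smooth curves, submanifolds\<close>

fun Ck_on :: "nat \<Rightarrow> 'v::real_normed_vector set \<Rightarrow> ('v \<Rightarrow> 'w::real_normed_vector) \<Rightarrow> bool" where
  "Ck_on 0 U g \<longleftrightarrow> continuous_on U g"
| "Ck_on (Suc r) U g \<longleftrightarrow>
     (\<forall>x\<in>U. g differentiable (at x)) \<and> (\<forall>v. Ck_on r U (\<lambda>x. frechet_derivative g (at x) v))"

text \<open>Only meaningful for open \<open>U\<close>.\<close>

definition smooth_on :: "'v::real_normed_vector set \<Rightarrow> ('v \<Rightarrow> 'w::real_normed_vector) \<Rightarrow> bool" where
  "smooth_on U g \<longleftrightarrow> (\<forall>r. Ck_on r U g)"

text \<open>Smoothness of a map on an embedded submanifold \<open>M\<close>: near every point of \<open>M\<close> it is the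
  restriction of a smooth map on an open set of the ambient space.\<close>

definition smooth_map_on :: "'v::real_normed_vector set \<Rightarrow> ('v \<Rightarrow> 'w::real_normed_vector) \<Rightarrow> bool" where
  "smooth_map_on M f \<longleftrightarrow>
     (\<forall>x\<in>M. \<exists>U g. open U \<and> x \<in> U \<and> smooth_on U g \<and> (\<forall>y\<in>U \<inter> M. f y = g y))"

text \<open>\<open>d\<close>-dimensional embedded smooth submanifold (without boundary), via slice charts.\<close>

definition smooth_submanifold :: "nat \<Rightarrow> 'v::euclidean_space set \<Rightarrow> bool" where
  "smooth_submanifold d M \<longleftrightarrow>
     (\<forall>x\<in>M. \<exists>U V \<psi> \<psi>' L. open U \<and> x \<in> U \<and> open V \<and>
        homeomorphism U V \<psi> \<psi>' \<and> smooth_on U \<psi> \<and> smooth_on V \<psi>' \<and>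
        subspace (L :: 'v set) \<and> dim L = d \<and> \<psi> ` (M \<inter> U) = L \<inter> V)"

definition curve_at :: "'v::euclidean_space set \<Rightarrow> 'v \<Rightarrow> (real \<Rightarrow> 'v) \<Rightarrow> bool" where
  "curve_at M x \<gamma> \<longleftrightarrow>
     \<gamma> 0 = x \<and> (\<exists>\<epsilon>>0. smooth_on {-\<epsilon><..<\<epsilon>} \<gamma> \<and> \<gamma> ` {-\<epsilon><..<\<epsilon>} \<subseteq> M)"

definition velocity :: "(real \<Rightarrow> 'v::real_normed_vector) \<Rightarrow> 'v" where
  "velocity \<gamma> = vector_derivative \<gamma> (at 0)"

definition acceleration :: "(real \<Rightarrow> 'v::real_normed_vector) \<Rightarrow> 'v" where
  "acceleration \<gamma> = vector_derivative (\<lambda>t. vector_derivative \<gamma> (at t)) (at 0)"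

definition tangent_space :: "'v::euclidean_space set \<Rightarrow> 'v \<Rightarrow> 'v set" where
  "tangent_space M x = {velocity \<gamma> | \<gamma>. curve_at M x \<gamma>}"

text \<open>Normal space at \<open>x\<close> of \<open>M\<close> inside the ambient submanifold \<open>S\<close>; for \<open>S = UNIV\<close> this is the
  normal space in the Euclidean space.\<close>

definition normal_plane :: "'v::euclidean_space set \<Rightarrow> 'v set \<Rightarrow> 'v \<Rightarrow> 'v set" where
  "normal_plane M S x = {\<nu> \<in> tangent_space S x. \<forall>v\<in>tangent_space M x. \<nu> \<bullet> v = 0}"


section \<open>Second fundamental form and minimality\<close>

definition orth_proj :: "'v::euclidean_space set \<Rightarrow> 'v \<Rightarrow> 'v" where
  "orth_proj P x = (THE y. y \<in> P \<and> (\<forall>z\<in>P. (x - y) \<bullet> z = 0))"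

text \<open>The value \<open>B(v,v)\<close> on the diagonal of the second fundamental form of \<open>M\<close> in \<open>S\<close>. By the Gauss
  formula it is the component normal to \<open>M\<close> and tangent to \<open>S\<close> of the acceleration of any curve
  in \<open>M\<close> with velocity \<open>v\<close>, independently of the curve.\<close>

definition second_fundamental_form ::
    "'v::euclidean_space set \<Rightarrow> 'v set \<Rightarrow> 'v \<Rightarrow> 'v \<Rightarrow> 'v" where
  "second_fundamental_form M S x v =
     orth_proj (normal_plane M S x)
       (acceleration (SOME \<gamma>. curve_at M x \<gamma> \<and> velocity \<gamma> = v))"

definition orthonormal_basis :: "'v::euclidean_space set \<Rightarrow> 'v set \<Rightarrow> bool" where
  "orthonormal_basis E P \<longleftrightarrow> pairwise orthogonal E \<and> (\<forall>e\<in>E. norm e = 1) \<and> span E = P"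

text \<open>Minimal: the mean curvature vector, i.e. the trace of the second fundamental form over an
  orthonormal basis of the tangent space, vanishes.\<close>

definition minimal_submanifold :: "nat \<Rightarrow> 'v::euclidean_space set \<Rightarrow> 'v set \<Rightarrow> bool" where
  "minimal_submanifold d M S \<longleftrightarrow>
     smooth_submanifold d M \<and> M \<subseteq> S \<and>
     (\<forall>x\<in>M. \<forall>E. orthonormal_basis E (tangent_space M x) \<longrightarrow>
        (\<Sum>e\<in>E. second_fundamental_form M S x e) = 0)"


section \<open>Volume of a submanifold\<close>

definition gram_jacobian :: "(real^'n::finite \<Rightarrow> 'v::euclidean_space) \<Rightarrow> real^'n \<Rightarrow> real" where
  "gram_jacobian \<phi> u =
     sqrt (det (\<chi> i j. frechet_derivative \<phi> (at u) (axis i 1)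
                     \<bullet> frechet_derivative \<phi> (at u) (axis j 1) :: real^'n^'n))"

definition local_parametrization ::
    "'v::euclidean_space set \<Rightarrow> (real^'n::finite) set \<Rightarrow> (real^'n \<Rightarrow> 'v) \<Rightarrow> bool" where
  "local_parametrization M U \<phi> \<longleftrightarrow>
     open U \<and> smooth_on U \<phi> \<and> inj_on \<phi> U \<and> \<phi> ` U \<subseteq> M \<and>
     (\<forall>u\<in>U. inj (frechet_derivative \<phi> (at u)))"

text \<open>\<open>submanifold_volume TYPE('n) M\<close> is the Riemannian volume of a \<open>CARD('n)\<close>-dimensional submanifold \<open>M\<close> in the
  metric induced from the ambient Euclidean space. A Borel piece \<open>\<phi> ` B\<close> of a parametrized patch
  has volume \<open>\<integral>\<^sub>B sqrt (det g)\<close>; the total volume is the supremum of the volumes of finite disjoint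
  families of such pieces.\<close>

definition submanifold_volume :: "'n::finite itself \<Rightarrow> 'v::euclidean_space set \<Rightarrow> ennreal" where
  "submanifold_volume _ M =
     (SUP C \<in> {C :: ((real^'n) set \<times> (real^'n \<Rightarrow> 'v) \<times> (real^'n) set) set.
         finite C \<and>
         (\<forall>(U, \<phi>, B)\<in>C. local_parametrization M U \<phi> \<and> B \<in> sets borel \<and> B \<subseteq> U) \<and>
         disjoint_family_on (\<lambda>(U, \<phi>, B). \<phi> ` B) C}.
       \<Sum>(U, \<phi>, B)\<in>C. \<integral>\<^sup>+ u \<in> B. ennreal (gram_jacobian \<phi> u) \<partial>lborel)"


section \<open>Singular values, Jordan angles, angle between planes\<close>

text \<open>For a linear map \<open>L\<close> on the inner product space \<open>P\<close>, the multiplicity of \<open>\<sigma> \<ge> 0\<close> as a singular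
  value of \<open>L\<close> is the dimension of the eigenspace of \<open>L\<^sup>* L : P \<rightarrow> P\<close> for the eigenvalue \<open>\<sigma>\<^sup>2\<close>;
  the equation \<open>L\<^sup>* L v = \<sigma>\<^sup>2 v\<close> is tested against \<open>w \<in> P\<close>. \<open>\<sigma>\<close> is a singular value iff this is
  nonzero.\<close>

definition singular_value_mult ::
    "'v::euclidean_space set \<Rightarrow> ('v \<Rightarrow> 'w::euclidean_space) \<Rightarrow> real \<Rightarrow> nat" where
  "singular_value_mult P L \<sigma> = dim {v \<in> P. \<forall>w\<in>P. L v \<bullet> L w = \<sigma>\<^sup>2 * (v \<bullet> w)}"

text \<open>Jordan (principal) angles between subspaces \<open>P\<close>, \<open>Q\<close> of equal dimension, with multiplicity:
  their cosines are the singular values of the orthogonal projection \<open>P \<rightarrow> Q\<close>.\<close>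

definition jordan_angles :: "'v::euclidean_space set \<Rightarrow> 'v set \<Rightarrow> real multiset" where
  "jordan_angles P Q =
     Abs_multiset (\<lambda>\<phi>. if 0 \<le> \<phi> \<and> \<phi> \<le> pi / 2
                       then singular_value_mult P (orth_proj Q) (cos \<phi>) else 0)"

text \<open>Slope function of a graph over \<open>Q\<close> at a point with tangent plane \<open>P\<close>.\<close>

definition slope :: "'v::euclidean_space set \<Rightarrow> 'v set \<Rightarrow> real" where
  "slope P Q = prod_mset (image_mset (\<lambda>\<phi>. 1 / cos \<phi>) (jordan_angles P Q))"

definition orthonormal_frame :: "('i::finite \<Rightarrow> 'v::euclidean_space) \<Rightarrow> 'v set \<Rightarrow> bool" where
  "orthonormal_frame \<nu> P \<longleftrightarrow>
     (\<forall>i j. \<nu> i \<bullet> \<nu> j = (if i = j then 1 else 0)) \<and> span (range \<nu>) = P"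

text \<open>Acute angle between two subspaces of dimension \<open>CARD('i)\<close>; the determinant is the inner product
  of the two wedge products of the frame vectors.\<close>

definition acute_angle ::
    "'i::finite itself \<Rightarrow> 'v::euclidean_space set \<Rightarrow> 'v set \<Rightarrow> real" where
  "acute_angle _ P Q =
     arccos (THE c. \<exists>\<nu> \<epsilon>. orthonormal_frame \<nu> P \<and> orthonormal_frame \<epsilon> Q \<and>
                        c = \<bar>det (\<chi> i j. \<nu> i \<bullet> \<epsilon> j :: real^'i^'i)\<bar>)"


section \<open>Maps between spheres\<close>

text \<open>Differential at a point \<open>x\<close> of the unit sphere, via the extension of \<open>f\<close> that is constant along
  rays; restricted to the tangent space at \<open>x\<close> it is the intrinsic differential.\<close>

definition sphere_differential ::
    "('v::euclidean_space \<Rightarrow> 'w::euclidean_space) \<Rightarrow> 'v \<Rightarrow> 'v \<Rightarrow> 'w" where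
  "sphere_differential f x = frechet_derivative (\<lambda>y. f (y /\<^sub>R norm y)) (at x)"

text \<open>Multiplicity of \<open>\<sigma>\<close> as a singular value of the differential at \<open>x\<close>.\<close>

definition sphere_singular_mult ::
    "('v::euclidean_space \<Rightarrow> 'w::euclidean_space) \<Rightarrow> 'v \<Rightarrow> real \<Rightarrow> nat" where
  "sphere_singular_mult f x \<sigma> =
     singular_value_mult (tangent_space (sphere 0 1) x) (sphere_differential f x) \<sigma>"

text \<open>Totally geodesic: the Hessian \<open>\<nabla>df\<close> vanishes. On a unit vector \<open>v\<close> its value \<open>\<nabla>df(v,v)\<close> is the
  covariant acceleration in the target sphere of the image of the great circle through \<open>x\<close> with
  velocity \<open>v\<close>; being symmetric and bilinear, \<open>\<nabla>df\<close> is determined by these values.\<close>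

definition totally_geodesic_map :: "('v::euclidean_space \<Rightarrow> 'w::euclidean_space) \<Rightarrow> bool" where
  "totally_geodesic_map f \<longleftrightarrow>
     (\<forall>x\<in>sphere 0 1. \<forall>v\<in>tangent_space (sphere 0 1) x. norm v = 1 \<longrightarrow>
        orth_proj (tangent_space (sphere 0 1) (f x))
          (acceleration (\<lambda>t. f (cos t *\<^sub>R x + sin t *\<^sub>R v))) = 0)"

definition laplacian :: "('v::euclidean_space \<Rightarrow> real) \<Rightarrow> 'v \<Rightarrow> real" where
  "laplacian h x =
     (\<Sum>b\<in>Basis. frechet_derivative (\<lambda>y. frechet_derivative h (at y) b) (at x) b)"

text \<open>Restriction to the unit sphere of a homogeneous harmonic polynomial of degree \<open>k\<close> (as usual, the
  zero function belongs to this space).\<close>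

definition spherical_harmonic :: "nat \<Rightarrow> ('v::euclidean_space \<Rightarrow> real) \<Rightarrow> bool" where
  "spherical_harmonic k h \<longleftrightarrow>
     (\<exists>P. real_polynomial_function P \<and> (\<forall>c x. P (c *\<^sub>R x) = c ^ k * P x) \<and>
          (\<forall>x. laplacian P x = 0) \<and> (\<forall>x\<in>sphere 0 1. h x = P x))"


section \<open>Lawson-Osserman maps, spheres and cones\<close>

definition LO_sphere ::
    "('v::euclidean_space \<Rightarrow> 'w::euclidean_space) \<Rightarrow> real \<Rightarrow> ('v \<times> 'w) set" where
  "LO_sphere f \<theta> = (\<lambda>x. (cos \<theta> *\<^sub>R x, sin \<theta> *\<^sub>R f x)) ` sphere 0 1"

definition LO_cone ::
    "('v::euclidean_space \<Rightarrow> 'w::euclidean_space) \<Rightarrow> real \<Rightarrow> ('v \<times> 'w) set" where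
  "LO_cone f \<theta> = cone hull (LO_sphere f \<theta>)"

definition LO_fun ::
    "('v::euclidean_space \<Rightarrow> 'w::euclidean_space) \<Rightarrow> real \<Rightarrow> 'v \<Rightarrow> 'w" where
  "LO_fun f \<theta> y = (if y = 0 then 0 else (tan \<theta> * norm y) *\<^sub>R f (y /\<^sub>R norm y))"

text \<open>In the following \<open>n\<close> is the dimension of the source sphere, so \<open>DIM('v) = n + 1\<close>.\<close>

definition LOM :: "nat \<Rightarrow> ('v::euclidean_space \<Rightarrow> 'w::euclidean_space) \<Rightarrow> bool" where
  "LOM n f \<longleftrightarrow>
     DIM('v) = n + 1 \<and> smooth_map_on (sphere 0 1) f \<and> f ` sphere 0 1 \<subseteq> sphere 0 1 \<and>
     (\<exists>\<theta>. 0 < \<theta> \<and> \<theta> < pi / 2 \<and> minimal_submanifold n (LO_sphere f \<theta>) (sphere 0 1))"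

definition LOMSE :: "nat \<Rightarrow> ('v::euclidean_space \<Rightarrow> 'w::euclidean_space) \<Rightarrow> bool" where
  "LOMSE n f \<longleftrightarrow>
     LOM n f \<and> \<not> totally_geodesic_map f \<and>
     (\<forall>x\<in>sphere 0 1. \<forall>\<sigma>>0. \<forall>\<tau>>0.
        sphere_singular_mult f x \<sigma> > 0 \<longrightarrow> sphere_singular_mult f x \<tau> > 0 \<longrightarrow> \<sigma> = \<tau>)"

definition LOMSE_of_type ::
    "nat \<Rightarrow> nat \<Rightarrow> nat \<Rightarrow> ('v::euclidean_space \<Rightarrow> 'w::euclidean_space) \<Rightarrow> bool" where
  "LOMSE_of_type n p k f \<longleftrightarrow>
     LOMSE n f \<and>
     (\<exists>s>0. \<forall>x\<in>sphere 0 1. \<forall>\<sigma>>0.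
        sphere_singular_mult f x \<sigma> = (if \<sigma> = s then p else 0)) \<and> p \<ge> 1 \<and>
     k \<ge> 2 \<and> (\<forall>b\<in>Basis. spherical_harmonic k (\<lambda>x. f x \<bullet> b))"

text \<open>The angle \<open>\<alpha>\<^sub>n\<^sub>,\<^sub>p\<^sub>,\<^sub>k\<close>; \<open>n\<close>, \<open>p\<close>, \<open>k\<close> are passed as real numbers, so that the differences are not
  truncated.\<close>

definition alpha_angle :: "real \<Rightarrow> real \<Rightarrow> real \<Rightarrow> real" where
  "alpha_angle n p k =
     arccos (sqrt ((1 - p / n) / (1 - p / (k * (k + n - 1)))) *
             ((n - p) / (k * (k + n - 1) - p)) powr (p / 2))"

end

theory Submission
  imports Defs
begin

text \<open>
  The cone is the graph of the 1-homogeneous map \<open>F = LO_fun f \<theta>\<close> and the sphere is the part of this graph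
  over \<open>|y| = cos \<theta>\<close>, so both have the same normal spaces. A curve in the graph through
  \<open>q = (y, F y)\<close> with velocity \<open>(w, DF w)\<close> has, up to tangent vectors, the acceleration
  \<open>(0, D\<^sup>2F(w, w))\<close>. Since \<open>D\<^sup>2F(y, y) = 0\<close> and \<open>D\<^sup>2F\<close> is homogeneous of degree \<open>-1\<close>, the mean curvature of
  the cone is a multiple of that of the sphere, and minimality passes to the cone.

  At a unit vector \<open>x\<close> the differential \<open>DF\<close> is diagonal in an orthonormal basis formed by \<open>x\<close> and the
  singular vectors of \<open>f\<^sub>*\<close>, with squared singular values \<open>tan\<^sup>2\<theta>\<close> (once), \<open>\<lambda>\<^sup>2 tan\<^sup>2\<theta>\<close> (\<open>p\<close> times) and
  \<open>0\<close> (\<open>n - p\<close> times). The Laplacian of \<open>|P|\<^sup>2 = |x|\<^sup>2\<^sup>k\<close> for the harmonic extension \<open>P\<close> of \<open>f\<close> gives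
  \<open>p \<lambda>\<^sup>2 = k (k + n - 1)\<close>, and one component of the mean curvature vector determines \<open>\<theta>\<close>.
  All angles and the slope can then be read off from \<open>DF\<close>, and the parametrization
  \<open>x \<mapsto> (cos \<theta> x, sin \<theta> f x)\<close> multiplies volumes by
  \<open>(cos\<^sup>2\<theta> + \<lambda>\<^sup>2 sin\<^sup>2\<theta>)\<^sup>p\<^sup>/\<^sup>2 (cos\<^sup>2\<theta>)\<^sup>(\<^sup>n\<^sup>-\<^sup>p\<^sup>)\<^sup>/\<^sup>2\<close>.
\<close>

section \<open>Calculus of smooth maps\<close>

text \<open>The angle \<theta> is any angle whose sphere is minimal, so its closed form has to be
  derived before a constant can be evaluated. The single normal component used for this gives an
  equation linear in tan^2 \<theta>. The hypothesis on f counts positive singular values only; that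
  its differential vanishes on the rest of the tangent space must be extracted from these
  multiplicities. The curve in \<open>second_fundamental_form\<close>, the point in
  \<open>orth_proj\<close> and the number in \<open>acute_angle\<close> are given by SOME or THE, so
  independence of the choice has to be shown each time. Normal spaces are graphs of -(DF)^T over the
  second factor. DF and its transpose have the same nonzero singular values, so the cosine of
  \<alpha> is the product of the cosines of the Jordan angles; this is why the slope is sec
  \<alpha>. Volume is a supremum over finite families of patches, so its scaling law splits into two
  inequalities, one for the parametrization and one for its inverse. Smoothness comes from P: off
  the origin F y = tan \<theta> |y|^(1-k) P y.\<close>

lemma Ck_on_cong:
  assumes "open U" "\<And>x. x \<in> U \<Longrightarrow> f x = g x" "Ck_on r U f"
  shows "Ck_on r U g"
  using assms(2,3)
proof (induction r arbitrary: f g)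
  case 0
  then show ?case by (simp cong: continuous_on_cong)
next
  case (Suc r)
  have der: "(g has_derivative frechet_derivative f (at x)) (at x)" if "x \<in> U" for x
  proof -
    have "(f has_derivative frechet_derivative f (at x)) (at x)"
      using Suc.prems that by (simp add: frechet_derivative_works)
    then show ?thesis
      by (rule has_derivative_transform_within_open[OF _ \<open>open U\<close> that Suc.prems(1)])
  qed
  have eq: "frechet_derivative f (at x) = frechet_derivative g (at x)" if "x \<in> U" for x
    by (rule frechet_derivative_at[OF der[OF that]])
  have "Ck_on r U (\<lambda>x. frechet_derivative g (at x) v)" for v
    by (rule Suc.IH[of "\<lambda>x. frechet_derivative f (at x) v"]) (use eq Suc.prems in auto)
  then show ?case using der by (auto simp: differentiable_def)
qed

text \<open>Lets a closure proof name the derivative explicitly instead of working with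
  \<open>frechet_derivative\<close>, which is a choice term.\<close>

lemma Ck_on_Suc_I:
  assumes "open U" "\<And>x. x \<in> U \<Longrightarrow> (g has_derivative g' x) (at x)"
    and "\<And>v. Ck_on r U (\<lambda>x. g' x v)"
  shows "Ck_on (Suc r) U g"
proof -
  have "Ck_on r U (\<lambda>x. frechet_derivative g (at x) v)" for v
    by (rule Ck_on_cong[OF \<open>open U\<close> _ assms(3)[of v]])
      (use frechet_derivative_at[OF assms(2)] in metis)
  then show ?thesis using assms(2) by (auto simp: differentiable_def)
qed

lemma Ck_on_has_derivative:
  assumes "Ck_on (Suc r) U g" "x \<in> U"
  shows "(g has_derivative frechet_derivative g (at x)) (at x)"
  using assms by (simp add: frechet_derivative_works)

lemma Ck_on_SucD: "Ck_on (Suc r) U g \<Longrightarrow> Ck_on r U g"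
proof (induction r arbitrary: g)
  case 0
  then have "\<And>x. x \<in> U \<Longrightarrow> g differentiable (at x)" by simp
  then show ?case
    by (auto intro!: continuous_at_imp_continuous_on differentiable_imp_continuous_within)
next
  case (Suc r)
  then show ?case by (metis Ck_on.simps(2))
qed

lemma Ck_on_subset: "Ck_on r U g \<Longrightarrow> V \<subseteq> U \<Longrightarrow> Ck_on r V g"
  by (induction r arbitrary: g) (auto intro: continuous_on_subset)

lemma Ck_on_const: "open U \<Longrightarrow> Ck_on r U (\<lambda>x. c)"
proof (induction r arbitrary: c)
  case (Suc r)
  show ?case by (rule Ck_on_Suc_I[OF Suc.prems, of _ "\<lambda>x v. 0"]) (use Suc in auto)
qed simp

lemma Ck_on_add:
  assumes "open U" "Ck_on r U f" "Ck_on r U g"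
  shows "Ck_on r U (\<lambda>x. f x + g x)"
  using assms(2,3)
proof (induction r arbitrary: f g)
  case 0
  then show ?case by (auto intro: continuous_on_add)
next
  case (Suc r)
  show ?case
    by (rule Ck_on_Suc_I[OF \<open>open U\<close>
          has_derivative_add[OF Ck_on_has_derivative[OF Suc.prems(1)] Ck_on_has_derivative[OF Suc.prems(2)]]])
      (use Suc in auto)
qed

lemma Ck_on_sum:
  assumes "open U" "\<And>i. i \<in> I \<Longrightarrow> Ck_on r U (f i)"
  shows "Ck_on r U (\<lambda>x. \<Sum>i\<in>I. f i x)"
  using assms(2)
  by (induction I rule: infinite_finite_induct) (auto intro: Ck_on_const Ck_on_add \<open>open U\<close>)

text \<open>One product rule covers scalar multiples, products and inner products. After
  differentiation one factor of each summand is undifferentiated and has one order more than the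
  induction hypothesis expects; \<open>Ck_on_SucD\<close> lowers it.\<close>

lemma Ck_on_bilinear:
  assumes "bounded_bilinear bop" "open U" "Ck_on r U f" "Ck_on r U g"
  shows "Ck_on r U (\<lambda>x. bop (f x) (g x))"
  using assms(3,4)
proof (induction r arbitrary: f g)
  case 0
  then show ?case by (auto intro: bounded_bilinear.continuous_on[OF assms(1)])
next
  case (Suc r)
  show ?case
    by (rule Ck_on_Suc_I[OF \<open>open U\<close>
          bounded_bilinear.FDERIV[OF assms(1) Ck_on_has_derivative[OF Suc.prems(1)] Ck_on_has_derivative[OF Suc.prems(2)]]])
      (use Suc.prems in \<open>auto intro!: Ck_on_add Suc.IH \<open>open U\<close> intro: Ck_on_SucD\<close>)
qed

lemma Ck_on_linear:
  assumes "bounded_linear T" "open U" "Ck_on r U f"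
  shows "Ck_on r U (\<lambda>x. T (f x))"
  using assms(3)
proof (induction r arbitrary: f)
  case 0
  then show ?case by (auto intro: bounded_linear.continuous_on[OF assms(1)])
next
  case (Suc r)
  show ?case
    by (rule Ck_on_Suc_I[OF \<open>open U\<close>
          bounded_linear.has_derivative[OF assms(1) Ck_on_has_derivative[OF Suc.prems(1)]]])
      (use Suc in auto)
qed

lemma Ck_on_ident: "open U \<Longrightarrow> Ck_on r U (\<lambda>x. x)"
proof (induction r)
  case (Suc r)
  show ?case by (rule Ck_on_Suc_I[OF Suc.prems has_derivative_ident]) (auto intro: Ck_on_const Suc)
qed simp

lemma Ck_on_Pair:
  assumes "open U" "Ck_on r U f" "Ck_on r U g"
  shows "Ck_on r U (\<lambda>x. (f x, g x))"
proof -
  have "Ck_on r U (\<lambda>x. (f x, 0) + (0, g x))"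
    by (intro Ck_on_add assms Ck_on_linear[where T = "\<lambda>y. (y, 0)"] Ck_on_linear[where T = "\<lambda>y. (0, y)"]
        bounded_linear_Pair bounded_linear_ident bounded_linear_zero)
  then show ?thesis by simp
qed

text \<open>In the derivative \<open>?g (h x) (?h x v)\<close> the direction moves with the point,
  while the induction hypothesis speaks of fixed directions. Expanding the direction in
  \<open>Basis\<close> leaves finitely many fixed ones with regular coefficients; hence the
  Euclidean type in the middle.\<close>

lemma Ck_on_compose:
  fixes h :: "'u::real_normed_vector \<Rightarrow> 'v::euclidean_space"
  assumes "open U" "open V" "h ` U \<subseteq> V" "Ck_on r U h" "Ck_on r V g"
  shows "Ck_on r U (\<lambda>x. g (h x))"
  using assms(4,5)
proof (induction r arbitrary: g)
  case 0
  then show ?case using assms(3) by (auto intro: continuous_on_compose2)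
next
  case (Suc r)
  let ?h = "\<lambda>x. frechet_derivative h (at x)" and ?g = "\<lambda>y. frechet_derivative g (at y)"
  have lin: "linear (?g y)" if "y \<in> V" for y
    using Ck_on_has_derivative[OF Suc.prems(2) that] by (rule has_derivative_linear)
  show ?case
  proof (rule Ck_on_Suc_I[OF \<open>open U\<close>])
    fix x assume "x \<in> U"
    then show "((\<lambda>x. g (h x)) has_derivative (\<lambda>v. ?g (h x) (?h x v))) (at x)"
      using has_derivative_compose[OF Ck_on_has_derivative[OF Suc.prems(1)] Ck_on_has_derivative[OF Suc.prems(2)]]
        assms(3) by blast
  next
    fix v
    have "Ck_on r U (\<lambda>x. \<Sum>b\<in>Basis. (?h x v \<bullet> b) *\<^sub>R ?g (h x) b)"
      using Suc.prems
      by (intro Ck_on_sum Ck_on_bilinear[OF bounded_bilinear_scaleR] Ck_on_bilinear[OF bounded_bilinear_inner]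
          Ck_on_const \<open>open U\<close> Suc.IH) (auto intro: Ck_on_SucD)
    moreover have "(\<Sum>b\<in>Basis. (?h x v \<bullet> b) *\<^sub>R ?g (h x) b) = ?g (h x) (?h x v)" if "x \<in> U" for x
    proof -
      have "linear (?g (h x))" using lin assms(3) that by blast
      then have "(\<Sum>b\<in>Basis. (?h x v \<bullet> b) *\<^sub>R ?g (h x) b) = ?g (h x) (\<Sum>b\<in>Basis. (?h x v \<bullet> b) *\<^sub>R b)"
        by (simp add: linear_sum linear_cmul)
      then show ?thesis by (simp only: euclidean_representation)
    qed
    ultimately show "Ck_on r U (\<lambda>x. ?g (h x) (?h x v))"
      by (rule Ck_on_cong[OF \<open>open U\<close>, rotated]) auto
  qed
qed

lemma smooth_on_subset: "smooth_on U g \<Longrightarrow> V \<subseteq> U \<Longrightarrow> smooth_on V g"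
  by (auto simp: smooth_on_def intro: Ck_on_subset)

lemma smooth_on_cong:
  assumes "open U" "\<And>x. x \<in> U \<Longrightarrow> f x = g x" "smooth_on U f"
  shows "smooth_on U g"
  using Ck_on_cong[of U f g] assms by (auto simp: smooth_on_def)

lemma smooth_on_has_derivative:
  "smooth_on U g \<Longrightarrow> x \<in> U \<Longrightarrow> (g has_derivative frechet_derivative g (at x)) (at x)"
  unfolding smooth_on_def using Ck_on_has_derivative by blast

lemma smooth_on_frechet_derivative:
  "smooth_on U g \<Longrightarrow> smooth_on U (\<lambda>x. frechet_derivative g (at x) v)"
  unfolding smooth_on_def by (metis Ck_on.simps(2))

lemma smooth_on_continuous: "smooth_on U g \<Longrightarrow> continuous_on U g"
  unfolding smooth_on_def by (metis Ck_on.simps(1))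

lemma smooth_on_const: "open U \<Longrightarrow> smooth_on U (\<lambda>x. c)"
  and smooth_on_ident: "open U \<Longrightarrow> smooth_on U (\<lambda>x. x)"
  by (auto simp: smooth_on_def intro: Ck_on_const Ck_on_ident)

lemma smooth_on_add:
  "open U \<Longrightarrow> smooth_on U f \<Longrightarrow> smooth_on U g \<Longrightarrow> smooth_on U (\<lambda>x. f x + g x)"
  by (auto simp: smooth_on_def intro: Ck_on_add)

lemma smooth_on_linear:
  "bounded_linear T \<Longrightarrow> open U \<Longrightarrow> smooth_on U f \<Longrightarrow> smooth_on U (\<lambda>x. T (f x))"
  by (auto simp: smooth_on_def intro: Ck_on_linear)

lemma smooth_on_diff:
  assumes "open U" "smooth_on U f" "smooth_on U g"
  shows "smooth_on U (\<lambda>x. f x - g x)"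
  using smooth_on_add[OF assms(1,2) smooth_on_linear[OF bounded_linear_minus[OF bounded_linear_ident] assms(1,3)]]
  by simp

lemma smooth_on_sum:
  "open U \<Longrightarrow> (\<And>i. i \<in> I \<Longrightarrow> smooth_on U (f i)) \<Longrightarrow> smooth_on U (\<lambda>x. \<Sum>i\<in>I. f i x)"
  by (auto simp: smooth_on_def intro: Ck_on_sum)

lemma smooth_on_scaleR:
  "open U \<Longrightarrow> smooth_on U f \<Longrightarrow> smooth_on U g \<Longrightarrow> smooth_on U (\<lambda>x. f x *\<^sub>R g x)"
  by (auto simp: smooth_on_def intro: Ck_on_bilinear[OF bounded_bilinear_scaleR])

lemma smooth_on_mult:
  fixes f g :: "_ \<Rightarrow> real"
  shows "open U \<Longrightarrow> smooth_on U f \<Longrightarrow> smooth_on U g \<Longrightarrow> smooth_on U (\<lambda>x. f x * g x)"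
  by (auto simp: smooth_on_def intro: Ck_on_bilinear[OF bounded_bilinear_mult])

lemma smooth_on_inner:
  "open U \<Longrightarrow> smooth_on U f \<Longrightarrow> smooth_on U g \<Longrightarrow> smooth_on U (\<lambda>x. f x \<bullet> g x)"
  by (auto simp: smooth_on_def intro: Ck_on_bilinear[OF bounded_bilinear_inner])

lemma smooth_on_power:
  fixes f :: "_ \<Rightarrow> real"
  assumes "open U" "smooth_on U f"
  shows "smooth_on U (\<lambda>x. f x ^ j)"
  by (induction j) (auto intro: smooth_on_mult smooth_on_const assms)

lemma smooth_on_Pair:
  "open U \<Longrightarrow> smooth_on U f \<Longrightarrow> smooth_on U g \<Longrightarrow> smooth_on U (\<lambda>x. (f x, g x))"
  by (auto simp: smooth_on_def intro: Ck_on_Pair)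

lemma smooth_on_compose:
  fixes h :: "'u::real_normed_vector \<Rightarrow> 'v::euclidean_space"
  shows "open U \<Longrightarrow> open V \<Longrightarrow> h ` U \<subseteq> V \<Longrightarrow> smooth_on U h \<Longrightarrow> smooth_on V g \<Longrightarrow> smooth_on U (\<lambda>x. g (h x))"
  by (auto simp: smooth_on_def intro: Ck_on_compose)

lemma smooth_on_real_polynomial_function:
  assumes "open U" "real_polynomial_function q"
  shows "smooth_on U q"
  using assms(2)
  by (induction q rule: real_polynomial_function.induct)
    (auto intro: smooth_on_add smooth_on_mult smooth_on_const smooth_on_linear[OF _ _ smooth_on_ident] assms(1))

text \<open>With g = 1/|y| the derivative is -(y . v) g^3, again built from g and polynomials, so
  the induction on the order closes.\<close>

lemma smooth_on_inverse_norm: "smooth_on (- {0 :: 'v::euclidean_space}) (\<lambda>y. inverse (norm y))"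
proof -
  have "Ck_on r (- {0 :: 'v}) (\<lambda>y. inverse (norm y))" for r
  proof (induction r)
    case 0
    then show ?case by (auto intro!: continuous_intros)
  next
    case (Suc r)
    let ?g = "\<lambda>y::'v. inverse (norm y)"
    show ?case
    proof (rule Ck_on_Suc_I)
      show "(?g has_derivative (\<lambda>v. (- (y \<bullet> v)) * (?g y * (?g y * ?g y)))) (at y)" if "y \<in> - {0}" for y
      proof -
        have "((\<lambda>y. inverse (norm y)) has_derivative (\<lambda>v. - (?g y * (v \<bullet> sgn y) * ?g y))) (at y)"
          using that by (intro Deriv.has_derivative_inverse has_derivative_norm) auto
        then show ?thesis by (simp add: sgn_div_norm inner_commute mult_ac)
      qed
      show "Ck_on r (- {0}) (\<lambda>y. (- (y \<bullet> v)) * (?g y * (?g y * ?g y)))" for v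
        by (intro Ck_on_bilinear[OF bounded_bilinear_mult] Suc Ck_on_linear[OF bounded_linear_minus[OF bounded_linear_ident]]
            Ck_on_bilinear[OF bounded_bilinear_inner] Ck_on_ident Ck_on_const) auto
    qed auto
  qed
  then show ?thesis by (simp add: smooth_on_def)
qed

section \<open>Orthonormal bases and singular values\<close>

lemma orthonormal_basis_inner:
  assumes "orthonormal_basis E P" "e \<in> E" "e' \<in> E"
  shows "e \<bullet> e' = (if e = e' then 1 else 0)"
  using assms by (auto simp: orthonormal_basis_def pairwise_def orthogonal_def norm_eq_1)

lemma orthonormal_basis_independent:
  assumes "orthonormal_basis E P" shows "independent E"
  using assms by (intro pairwise_orthogonal_independent) (auto simp: orthonormal_basis_def)

lemma orthonormal_basis_finite: "orthonormal_basis E P \<Longrightarrow> finite E"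
  using independent_imp_finite orthonormal_basis_independent by blast

lemma orthonormal_basis_card: "orthonormal_basis E P \<Longrightarrow> card E = dim P"
  by (metis dim_eq_card_independent dim_span orthonormal_basis_def orthonormal_basis_independent)

lemma orthonormal_basis_mem: "orthonormal_basis E P \<Longrightarrow> e \<in> E \<Longrightarrow> e \<in> P"
  unfolding orthonormal_basis_def using span_base by blast

lemma orthonormal_basis_exists:
  assumes "subspace P" obtains E where "orthonormal_basis E P"
  using orthonormal_basis_subspace[OF assms] unfolding orthonormal_basis_def by metis

lemma orthonormal_basis_expand:
  assumes "orthonormal_basis E P" "x \<in> P"
  shows "(\<Sum>e\<in>E. (x \<bullet> e) *\<^sub>R e) = x"
proof -
  note fin = orthonormal_basis_finite[OF assms(1)]
  have "x \<in> span E" using assms by (auto simp: orthonormal_basis_def)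
  then obtain c where c: "x = (\<Sum>e\<in>E. c e *\<^sub>R e)" using span_finite[OF fin] by auto
  have "x \<bullet> e = c e" if "e \<in> E" for e
  proof -
    have "x \<bullet> e = (\<Sum>e'\<in>E. if e' = e then c e' else 0)"
      unfolding c inner_sum_left using that by (intro sum.cong) (auto simp: orthonormal_basis_inner[OF assms(1)])
    then show ?thesis using that fin by simp
  qed
  then show ?thesis using c by simp
qed

lemma orthonormal_basis_inner_expand:
  assumes "orthonormal_basis E P" "x \<in> P"
  shows "(\<Sum>e\<in>E. (x \<bullet> e) * (y \<bullet> e)) = x \<bullet> y"
proof -
  have "x \<bullet> y = (\<Sum>e\<in>E. (x \<bullet> e) *\<^sub>R e) \<bullet> y" by (simp add: orthonormal_basis_expand[OF assms])
  also have "\<dots> = (\<Sum>e\<in>E. (x \<bullet> e) * (e \<bullet> y))" by (simp add: inner_sum_left)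
  finally show ?thesis by (simp add: inner_commute)
qed

lemma orthonormal_basis_linear_expand:
  assumes "orthonormal_basis E P" "x \<in> P" "linear L"
  shows "L x = (\<Sum>e\<in>E. (x \<bullet> e) *\<^sub>R L e)"
proof -
  have "L x = L (\<Sum>e\<in>E. (x \<bullet> e) *\<^sub>R e)" by (simp add: orthonormal_basis_expand[OF assms(1,2)])
  also have "\<dots> = (\<Sum>e\<in>E. (x \<bullet> e) *\<^sub>R L e)" using assms(3) by (simp add: linear_sum linear_cmul)
  finally show ?thesis .
qed

text \<open>Expand e twice in E' and sum over E first: Parseval turns the coefficient of
  \<open>\<beta> a b\<close> into a . b. This allows a change to bases adapted to the radial
  direction.\<close>

lemma trace_orthonormal_basis:
  assumes E: "orthonormal_basis E P" and E': "orthonormal_basis E' P" and "bilinear \<beta>"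
  shows "(\<Sum>e\<in>E. \<beta> e e) = (\<Sum>e\<in>E'. \<beta> e e)"
proof -
  have l1: "linear (\<lambda>x. \<beta> x y)" and l2: "linear (\<beta> x)" for x y
    using \<open>bilinear \<beta>\<close> by (auto simp: bilinear_def)
  have "(\<Sum>e\<in>E. \<beta> e e) = (\<Sum>e\<in>E. \<Sum>a\<in>E'. \<Sum>b\<in>E'. ((e \<bullet> a) * (e \<bullet> b)) *\<^sub>R \<beta> a b)"
  proof (rule sum.cong)
    fix e assume "e \<in> E"
    then have e: "e \<in> P" using E orthonormal_basis_mem by blast
    have "\<beta> e e = (\<Sum>a\<in>E'. (e \<bullet> a) *\<^sub>R \<beta> a e)"
      by (rule orthonormal_basis_linear_expand[OF E' e l1])
    also have "\<dots> = (\<Sum>a\<in>E'. (e \<bullet> a) *\<^sub>R (\<Sum>b\<in>E'. (e \<bullet> b) *\<^sub>R \<beta> a b))"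
      by (intro sum.cong refl arg_cong2[where f = scaleR] orthonormal_basis_linear_expand[OF E' e l2])
    finally show "\<beta> e e = (\<Sum>a\<in>E'. \<Sum>b\<in>E'. ((e \<bullet> a) * (e \<bullet> b)) *\<^sub>R \<beta> a b)"
      by (simp add: scaleR_sum_right)
  qed simp
  also have "\<dots> = (\<Sum>a\<in>E'. \<Sum>b\<in>E'. \<Sum>e\<in>E. ((e \<bullet> a) * (e \<bullet> b)) *\<^sub>R \<beta> a b)"
    by (simp add: sum.swap[of _ E'  E] )
  also have "\<dots> = (\<Sum>a\<in>E'. \<Sum>b\<in>E'. (a \<bullet> b) *\<^sub>R \<beta> a b)"
  proof (intro sum.cong refl)
    fix a b assume "a \<in> E'" "b \<in> E'"
    then have "a \<in> P" using E' orthonormal_basis_mem by blast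
    then show "(\<Sum>e\<in>E. ((e \<bullet> a) * (e \<bullet> b)) *\<^sub>R \<beta> a b) = (a \<bullet> b) *\<^sub>R \<beta> a b"
      using orthonormal_basis_inner_expand[OF E, of a b]
      by (simp add: scaleR_sum_left[symmetric] inner_commute)
  qed
  also have "\<dots> = (\<Sum>a\<in>E'. \<Sum>b\<in>E'. if a = b then \<beta> a b else 0)"
    by (intro sum.cong refl) (simp add: orthonormal_basis_inner[OF E'])
  also have "\<dots> = (\<Sum>a\<in>E'. \<beta> a a)"
    using orthonormal_basis_finite[OF E'] by simp
  finally show ?thesis .
qed

text \<open>Glues bases of orthogonal pieces, such as eigenspace and kernel, or radial line and
  tangent space.\<close>

lemma orthonormal_basis_Un:
  assumes "orthonormal_basis A P" "orthonormal_basis B Q"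
    and perp: "\<And>x y. x \<in> P \<Longrightarrow> y \<in> Q \<Longrightarrow> x \<bullet> y = 0"
    and R: "R = {x + y | x y. x \<in> P \<and> y \<in> Q}"
  shows "orthonormal_basis (A \<union> B) R" "A \<inter> B = {}"
proof -
  have "a \<bullet> b = 0" if "a \<in> A" "b \<in> B" for a b
    using that perp orthonormal_basis_mem assms(1,2) by blast
  moreover from this have "b \<bullet> a = 0" if "a \<in> A" "b \<in> B" for a b
    using that by (simp add: inner_commute)
  moreover have "span (A \<union> B) = R"
    using assms by (auto simp: span_Un orthonormal_basis_def)
  ultimately show "orthonormal_basis (A \<union> B) R"
    using assms(1,2) unfolding orthonormal_basis_def pairwise_def orthogonal_def by blast
  have "False" if "a \<in> A" "a \<in> B" for a
    using that perp[of a a] orthonormal_basis_mem[OF assms(1)] orthonormal_basis_mem[OF assms(2)]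
      orthonormal_basis_inner[OF assms(1), of a a] by auto
  then show "A \<inter> B = {}" by blast
qed

text \<open>By \<open>diag\<close> the images are already pairwise orthogonal with squared lengths
  \<kappa> b, so only rescaling remains. Applied to J on its nonzero singular directions and to the
  graph map w -> (w, DF w).\<close>

lemma orthonormal_basis_normalized_image:
  assumes B: "orthonormal_basis B Q" and G: "linear G" and pos: "\<And>b. b \<in> B \<Longrightarrow> \<kappa> b > 0"
    and diag: "\<And>b c. b \<in> B \<Longrightarrow> c \<in> B \<Longrightarrow> G b \<bullet> G c = \<kappa> b * (b \<bullet> c)"
  defines "h \<equiv> \<lambda>b. G b /\<^sub>R sqrt (\<kappa> b)"
  shows "orthonormal_basis (h ` B) (G ` Q)" "inj_on h B"
proof -
  have inv: "inverse (sqrt x) * (inverse (sqrt x) * x) = 1" if "0 < x" for x :: real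
    using that by (simp add: field_simps)
  have hh: "h b \<bullet> h c = (if b = c then 1 else 0)" if "b \<in> B" "c \<in> B" for b c
    using that diag[of b c] orthonormal_basis_inner[OF B, of b c] pos[of b]
    by (auto simp: h_def inv)
  show "inj_on h B" using hh by (metis inj_onI zero_neq_one)
  have "span (h ` B) = span (G ` B)"
  proof (rule span_eq[THEN iffD2], intro conjI subsetI)
    fix v assume "v \<in> h ` B"
    then show "v \<in> span (G ` B)" by (auto simp: h_def intro: span_scale span_base)
  next
    fix v assume "v \<in> G ` B"
    then obtain b where b: "b \<in> B" "v = G b" by blast
    then have "v = sqrt (\<kappa> b) *\<^sub>R h b" using pos[of b] by (simp add: h_def)
    then show "v \<in> span (h ` B)" using b by (simp add: span_scale span_base)
  qed
  also have "\<dots> = G ` Q" using B G by (simp add: linear_span_image orthonormal_basis_def)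
  finally show "orthonormal_basis (h ` B) (G ` Q)"
    using hh by (auto simp: orthonormal_basis_def pairwise_def orthogonal_def norm_eq_1)
qed

section \<open>Orthogonal projection onto a subspace\<close>

lemma orth_decompose:
  fixes P :: "'v::euclidean_space set"
  assumes "subspace P"
  obtains y where "y \<in> P" "\<And>z. z \<in> P \<Longrightarrow> (x - y) \<bullet> z = 0"
proof -
  obtain y z where "y \<in> span P" "\<And>w. w \<in> span P \<Longrightarrow> orthogonal z w" "x = y + z"
    by (rule orthogonal_subspace_decomp_exists[of P x]) auto
  moreover have "span P = P" using assms by simp
  ultimately show ?thesis using that[of y] by (auto simp: orthogonal_def)
qed

lemma orth_proj_unique:
  fixes P :: "'v::euclidean_space set"
  assumes "subspace P" "y \<in> P" "\<And>z. z \<in> P \<Longrightarrow> (x - y) \<bullet> z = 0"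
  shows "orth_proj P x = y"
  unfolding orth_proj_def
proof (rule the_equality)
  fix y' assume y': "y' \<in> P \<and> (\<forall>z\<in>P. (x - y') \<bullet> z = 0)"
  then have d: "y' - y \<in> P" using assms subspace_diff by blast
  have "(y' - y) \<bullet> (y' - y) = (x - y) \<bullet> (y' - y) - (x - y') \<bullet> (y' - y)"
    by (simp add: algebra_simps)
  then have "(y' - y) \<bullet> (y' - y) = 0" using assms(3)[OF d] y' d by auto
  then show "y' = y" by simp
qed (use assms in auto)

lemma
  fixes P :: "'v::euclidean_space set"
  assumes P: "subspace P"
  shows orth_proj_mem: "orth_proj P x \<in> P"
    and orth_proj_inner: "z \<in> P \<Longrightarrow> orth_proj P x \<bullet> z = x \<bullet> z"
proof -
  obtain y where y: "y \<in> P" "\<And>z. z \<in> P \<Longrightarrow> (x - y) \<bullet> z = 0"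
    using orth_decompose[OF P] by blast
  have eq: "orth_proj P x = y" by (rule orth_proj_unique[OF P y])
  show "orth_proj P x \<in> P" using eq y by simp
  show "orth_proj P x \<bullet> z = x \<bullet> z" if "z \<in> P" using eq y(2)[OF that] by (simp add: inner_diff_left)
qed

section \<open>Singular vectors from the multiplicities of the positive singular values\<close>

lemma quadratic_nonneg_imp:
  fixes b c :: real
  assumes "\<And>t. 0 \<le> 2 * t * b + t\<^sup>2 * c"
  shows "b = 0"
proof (rule ccontr)
  assume "b \<noteq> 0"
  \<comment> \<open>At t = - b / d the linear term is -2 b^2 / d, while d \<ge> c bounds the
    quadratic one by b^2 / d. The summand 1 keeps d positive when c = 0.\<close>
  define d where "d = \<bar>c\<bar> + 1"
  have "d > 0" by (simp add: d_def)
  have "0 \<le> 2 * (- b / d) * b + (- b / d)\<^sup>2 * c" by (rule assms)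
  also have "\<dots> \<le> 2 * (- b / d) * b + (- b / d)\<^sup>2 * d"
    by (intro add_left_mono mult_left_mono) (auto simp: d_def)
  also have "\<dots> = - b\<^sup>2 / d" using \<open>d > 0\<close> by (simp add: power2_eq_square field_simps)
  also have "\<dots> < 0" using \<open>b \<noteq> 0\<close> \<open>d > 0\<close> by simp
  finally show False by simp
qed

lemma singular_space_subspace:
  assumes "subspace P" "linear L"
  shows "subspace {v \<in> P. \<forall>w\<in>P. L v \<bullet> L w = c * (v \<bullet> w)}"
  using assms by (auto simp: subspace_def linear_0 linear_add linear_cmul inner_add_left algebra_simps)

text \<open>E is the s-eigenspace of L^T L and K its complement in P. The point is that L kills K,
  since the hypothesis says nothing directly about the singular value 0.\<close>

lemma singular_value_decomposition:
  fixes L :: "'v::euclidean_space \<Rightarrow> 'w::euclidean_space"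
  assumes P: "subspace P" and L: "linear L" and "s > 0"
    and mult: "\<And>\<sigma>. \<sigma> > 0 \<Longrightarrow> singular_value_mult P L \<sigma> = (if \<sigma> = s then p else 0)"
  obtains A B where "orthonormal_basis (A \<union> B) P" "A \<inter> B = {}" "card A = p"
    "\<And>a w. a \<in> A \<Longrightarrow> w \<in> P \<Longrightarrow> L a \<bullet> L w = s\<^sup>2 * (a \<bullet> w)" "\<And>b. b \<in> B \<Longrightarrow> L b = 0"
proof -
  define E where "E = {v \<in> P. \<forall>w\<in>P. L v \<bullet> L w = s\<^sup>2 * (v \<bullet> w)}"
  define K where "K = {v \<in> P. \<forall>w\<in>E. v \<bullet> w = 0}"
  have E: "subspace E" unfolding E_def by (rule singular_space_subspace[OF P L])
  have K: "subspace K" using P unfolding K_def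
    by (auto simp: subspace_def inner_add_left)
  have decomp: "\<exists>e k. e \<in> E \<and> k \<in> K \<and> v = e + k" if "v \<in> P" for v
  proof -
    obtain y where y: "y \<in> E" "\<And>z. z \<in> E \<Longrightarrow> (v - y) \<bullet> z = 0" using orth_decompose[OF E] by blast
    moreover have "v - y \<in> P" using that y P by (auto simp: E_def subspace_diff)
    ultimately show ?thesis by (intro exI[of _ y] exI[of _ "v - y"]) (auto simp: K_def)
  qed
  \<comment> \<open>Otherwise a unit vector of \<open>K\<close> maximizing \<open>|L v|\<close> would be one more singular vector.\<close>
  have zero: "L v = 0" if v: "v \<in> K" for v
  proof (rule ccontr)
    assume nz: "L v \<noteq> 0"
    then have "v \<noteq> 0" using L linear_0 by blast
    let ?C = "K \<inter> sphere 0 1"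
    have "compact ?C" using closed_subspace[OF K] by (simp add: closed_Int_compact)
    moreover have u: "v /\<^sub>R norm v \<in> ?C" using v K \<open>v \<noteq> 0\<close> by (auto simp: subspace_scale)
    moreover have "continuous_on ?C (\<lambda>x. L x \<bullet> L x)"
      using L by (intro continuous_intros linear_continuous_on linear_conv_bounded_linear[THEN iffD1])
    ultimately obtain v0 where v0: "v0 \<in> ?C" and max: "\<And>x. x \<in> ?C \<Longrightarrow> L x \<bullet> L x \<le> L v0 \<bullet> L v0"
      using continuous_attains_sup[of ?C "\<lambda>x. L x \<bullet> L x"] by blast
    define \<mu> where "\<mu> = L v0 \<bullet> L v0"
    have v0': "v0 \<in> K" "v0 \<bullet> v0 = 1" using v0 by (auto simp: norm_eq_1)
    have bound: "L w \<bullet> L w \<le> \<mu> * (w \<bullet> w)" if "w \<in> K" for w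
    proof (cases "w = 0")
      case False
      have "L (w /\<^sub>R norm w) \<bullet> L (w /\<^sub>R norm w) \<le> \<mu>" unfolding \<mu>_def
        using that K False by (intro max) (auto simp: subspace_scale)
      then have "(L w \<bullet> L w) / (norm w)\<^sup>2 \<le> \<mu>"
        using L by (simp add: linear_cmul power2_eq_square divide_inverse mult_ac)
      then show ?thesis using False by (simp add: pos_divide_le_eq power2_norm_eq_inner)
    qed (use L in \<open>simp add: linear_0\<close>)
    have "0 < \<mu>"
    proof -
      have "0 < L v \<bullet> L v" using nz by simp
      also have "\<dots> \<le> \<mu> * (v \<bullet> v)" by (rule bound[OF v])
      finally show ?thesis by (rule zero_less_mult_pos2) (use \<open>v \<noteq> 0\<close> in simp)
    qed
    \<comment> \<open>First-order condition at the maximizer: along v0 + t w the defect in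
      \<open>bound\<close> is a nonnegative quadratic in t without constant term.\<close>
    have eigK: "L v0 \<bullet> L w = \<mu> * (v0 \<bullet> w)" if "w \<in> K" for w
    proof -
      have "0 \<le> 2 * t * (\<mu> * (v0 \<bullet> w) - L v0 \<bullet> L w) + t\<^sup>2 * (\<mu> * (w \<bullet> w) - L w \<bullet> L w)" for t
      proof -
        have "L (v0 + t *\<^sub>R w) \<bullet> L (v0 + t *\<^sub>R w) \<le> \<mu> * ((v0 + t *\<^sub>R w) \<bullet> (v0 + t *\<^sub>R w))"
          using v0' that K by (intro bound) (auto simp: subspace_def)
        then show ?thesis using L v0'(2)
          by (simp add: linear_add linear_cmul inner_add_left inner_add_right inner_commute
              algebra_simps power2_eq_square \<mu>_def)
      qed
      from quadratic_nonneg_imp[OF this] show ?thesis by simp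
    qed
    \<comment> \<open>A test vector splits along E and K. Its part in E contributes nothing to
      either side, because it is itself an eigenvector and v0 is orthogonal to it.\<close>
    have eig: "L v0 \<bullet> L w = \<mu> * (v0 \<bullet> w)" if w: "w \<in> P" for w
    proof -
      obtain e k where ek: "e \<in> E" "k \<in> K" "w = e + k" using decomp[OF w] by blast
      have "L e \<bullet> L v0 = s\<^sup>2 * (e \<bullet> v0)" using ek(1) v0' by (auto simp: E_def K_def)
      moreover have "v0 \<bullet> e = 0" using ek v0' by (auto simp: K_def)
      ultimately show ?thesis using eigK[OF ek(2)] ek(3) L
        by (simp add: linear_add inner_add_right inner_commute)
    qed
    let ?S = "{v \<in> P. \<forall>w\<in>P. L v \<bullet> L w = (sqrt \<mu>)\<^sup>2 * (v \<bullet> w)}"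
    have mem: "v0 \<in> ?S" using eig v0' \<open>0 < \<mu>\<close> by (auto simp: K_def)
    \<comment> \<open>If sqrt \<mu> = s, then v0 lies both in E and in its complement; otherwise the
      eigenspace containing v0 has dimension 0 by \<open>mult\<close>.\<close>
    show False
    proof (cases "sqrt \<mu> = s")
      case True
      then have "v0 \<in> E" using mem by (auto simp: E_def)
      then show False using v0' by (auto simp: K_def)
    next
      case False
      then have "dim ?S = 0" using mult[of "sqrt \<mu>"] \<open>0 < \<mu>\<close> by (simp add: singular_value_mult_def)
      then have "v0 = 0" using mem by (simp only: dim_eq_0) blast
      then show False using v0' by simp
    qed
  qed
  obtain A where A: "orthonormal_basis A E" using orthonormal_basis_exists[OF E] by blast
  obtain B where B: "orthonormal_basis B K" using orthonormal_basis_exists[OF K] by blast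
  have sum: "P = {x + y | x y. x \<in> E \<and> y \<in> K}"
  proof -
    have "x + y \<in> P" if "x \<in> E" "y \<in> K" for x y
      using that P by (simp add: E_def K_def subspace_add)
    then show ?thesis using decomp by blast
  qed
  have perp: "x \<bullet> y = 0" if "x \<in> E" "y \<in> K" for x y
    using that by (auto simp: K_def inner_commute)
  show ?thesis
  proof
    show "orthonormal_basis (A \<union> B) P" "A \<inter> B = {}" using orthonormal_basis_Un[OF A B perp sum] by auto
    show "card A = p" using orthonormal_basis_card[OF A] mult[OF \<open>s > 0\<close>]
      by (simp add: singular_value_mult_def E_def)
    show "L a \<bullet> L w = s\<^sup>2 * (a \<bullet> w)" if "a \<in> A" "w \<in> P" for a w
      using orthonormal_basis_mem[OF A that(1)] that(2) by (auto simp: E_def)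
    show "L b = 0" if "b \<in> B" for b
      using zero orthonormal_basis_mem[OF B that] by blast
  qed
qed

section \<open>Indexed frames and Gram determinants\<close>

lemma orthonormal_basis_imp_frame:
  fixes P :: "'v::euclidean_space set"
  assumes "orthonormal_basis E P" "dim P = CARD('i::finite)"
  obtains \<eta> :: "'i::finite \<Rightarrow> 'v" where "orthonormal_frame \<eta> P" "bij_betw \<eta> UNIV E"
proof -
  have "card E = card (UNIV :: 'i set)" using assms orthonormal_basis_card by metis
  then obtain \<eta> where b: "bij_betw \<eta> (UNIV :: 'i set) E"
    using finite_same_card_bij[of "UNIV :: 'i set" E] orthonormal_basis_finite[OF assms(1)] by auto
  have "\<eta> i \<bullet> \<eta> j = (if i = j then 1 else 0)" for i j
    using orthonormal_basis_inner[OF assms(1), of "\<eta> i" "\<eta> j"] b bij_betwE[OF b]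
    by (auto simp: bij_betw_def inj_eq)
  moreover have "span (range \<eta>) = P"
    using b assms(1) by (simp add: bij_betw_def orthonormal_basis_def)
  ultimately have "orthonormal_frame \<eta> P" by (simp add: orthonormal_frame_def)
  then show ?thesis using that b by blast
qed

lemma orthonormal_frame_basis:
  assumes "orthonormal_frame \<eta> P"
  shows "orthonormal_basis (range \<eta>) P" "inj \<eta>"
proof -
  show "inj \<eta>" using assms unfolding orthonormal_frame_def inj_def by (metis zero_neq_one)
  show "orthonormal_basis (range \<eta>) P"
    using assms by (auto simp: orthonormal_frame_def orthonormal_basis_def pairwise_def orthogonal_def norm_eq_1)
qed

text \<open>If A holds the coefficients of the a_i in the frame, the Gram matrix of the G a_i is A D
  A^T with D diagonal. The case G = id, \<kappa> = 1 identifies (det A)^2 with the Gram determinant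
  of the a_i, which removes the frame from the result.\<close>

lemma det_gram:
  fixes G :: "'v::euclidean_space \<Rightarrow> 'w::euclidean_space" and a \<eta> :: "'i::finite \<Rightarrow> 'v"
  assumes frame: "orthonormal_frame \<eta> P" and "linear G" and a: "\<And>i. a i \<in> P"
    and G: "\<And>i j. G (\<eta> i) \<bullet> G (\<eta> j) = \<kappa> i * (\<eta> i \<bullet> \<eta> j)"
  shows "det (\<chi> i j. G (a i) \<bullet> G (a j) :: real^'i^'i) = (\<Prod>i\<in>UNIV. \<kappa> i) * (det (\<chi> i j. a i \<bullet> \<eta> j :: real^'i^'i))\<^sup>2"
proof -
  let ?A = "\<chi> i j. a i \<bullet> \<eta> j :: real^'i^'i"
  let ?D = "\<chi> i j. if i = j then \<kappa> i else 0 :: real^'i^'i"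
  note on = orthonormal_frame_basis[OF frame]
  have exp: "G (a i) = (\<Sum>l\<in>UNIV. (a i \<bullet> \<eta> l) *\<^sub>R G (\<eta> l))" for i
    using orthonormal_basis_linear_expand[OF on(1) a \<open>linear G\<close>]
    by (simp add: sum.reindex[OF on(2)])
  have "G (a i) \<bullet> G (a j) = (?A ** (?D ** transpose ?A)) $ i $ j" for i j
  proof -
    have "G (a i) \<bullet> G (a j) = (\<Sum>l\<in>UNIV. \<Sum>l'\<in>UNIV. (a i \<bullet> \<eta> l) * (a j \<bullet> \<eta> l') * (\<kappa> l * (\<eta> l \<bullet> \<eta> l')))"
      unfolding exp[of i] exp[of j]
      by (simp only: inner_sum_left, simp only: inner_sum_right, simp add: G mult_ac)
    also have "\<dots> = (\<Sum>l\<in>UNIV. \<Sum>l'\<in>UNIV. if l = l' then (a i \<bullet> \<eta> l) * (a j \<bullet> \<eta> l') * \<kappa> l else 0)"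
      using frame by (intro sum.cong refl) (simp add: orthonormal_frame_def)
    also have "\<dots> = (\<Sum>l\<in>UNIV. (a i \<bullet> \<eta> l) * (\<kappa> l * (a j \<bullet> \<eta> l)))" by (simp add: mult_ac)
    finally show ?thesis
      by (simp add: matrix_matrix_mult_def transpose_def if_distrib[where f = "\<lambda>x. x * _"] cong: if_cong)
  qed
  then have "(\<chi> i j. G (a i) \<bullet> G (a j) :: real^'i^'i) = ?A ** (?D ** transpose ?A)"
    by (simp add: vec_eq_iff)
  moreover have "det ?D = (\<Prod>i\<in>UNIV. \<kappa> i)"
    by (subst det_diagonal) auto
  ultimately show ?thesis by (simp add: det_mul power2_eq_square)
qed

section \<open>Angles between graphs and coordinate planes\<close>

text \<open>Diagonality on the basis makes each c an eigenvector of J^T J, here tested against every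
  a.\<close>

lemma orthonormal_basis_diag:
  assumes B: "orthonormal_basis B UNIV" and J: "linear J"
    and diag: "\<And>b c. b \<in> B \<Longrightarrow> c \<in> B \<Longrightarrow> J b \<bullet> J c = \<mu> b * (b \<bullet> c)" and "c \<in> B"
  shows "J a \<bullet> J c = \<mu> c * (a \<bullet> c)"
proof -
  have "J a \<bullet> J c = (\<Sum>b\<in>B. (a \<bullet> b) * (J b \<bullet> J c))"
    by (simp add: orthonormal_basis_linear_expand[OF B UNIV_I J, of a] inner_sum_left)
  also have "\<dots> = (\<Sum>b\<in>B. if b = c then \<mu> c * (a \<bullet> c) else 0)"
    using \<open>c \<in> B\<close> by (intro sum.cong refl) (simp add: diag orthonormal_basis_inner[OF B])
  finally show ?thesis using \<open>c \<in> B\<close> orthonormal_basis_finite[OF B] by simp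
qed

text \<open>Pulled back by w -> (w, J w), the singular vector condition becomes a = \<sigma>^2 (1 +
  J^T J) a, whose solutions are spanned by the basis vectors with \<sigma>^2 (1 + \<mu> b) =
  1.\<close>

lemma graph_singular_value_mult:
  fixes J :: "'v::euclidean_space \<Rightarrow> 'w::euclidean_space"
  assumes B: "orthonormal_basis B UNIV" and J: "linear J"
    and diag: "\<And>b c. b \<in> B \<Longrightarrow> c \<in> B \<Longrightarrow> J b \<bullet> J c = \<mu> b * (b \<bullet> c)"
  shows "singular_value_mult (range (\<lambda>w. (w, J w))) (orth_proj {(x, y). y = 0}) \<sigma>
    = card {b \<in> B. \<sigma>\<^sup>2 * (1 + \<mu> b) = 1}"
proof -
  let ?G = "\<lambda>w. (w, J w)" and ?B = "{b \<in> B. \<sigma>\<^sup>2 * (1 + \<mu> b) = 1}"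
  let ?Q = "{(x, y). y = 0} :: ('v \<times> 'w) set"
  have proj: "orth_proj ?Q (a, b) = (a, 0)" for a b
    by (rule orth_proj_unique) (auto simp: subspace_def zero_prod_def)
  have linG: "linear ?G" using J by (auto intro!: linearI simp: linear_add linear_cmul)
  have key: "(\<forall>b. a \<bullet> b = \<sigma>\<^sup>2 * (a \<bullet> b + J a \<bullet> J b)) \<longleftrightarrow> a \<in> span ?B" for a
  proof
    assume eq: "\<forall>b. a \<bullet> b = \<sigma>\<^sup>2 * (a \<bullet> b + J a \<bullet> J b)"
    have "a \<bullet> c = 0" if "c \<in> B" "c \<notin> ?B" for c
    proof -
      have "(a \<bullet> c) * (\<sigma>\<^sup>2 * (1 + \<mu> c) - 1) = 0"
        using eq[rule_format, of c] orthonormal_basis_diag[OF B J diag that(1), of a]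
        by (simp add: algebra_simps)
      then show ?thesis using that by auto
    qed
    then have "(\<Sum>e\<in>B. (a \<bullet> e) *\<^sub>R e) \<in> span ?B"
      by (intro span_sum) (metis (no_types, lifting) scaleR_zero_left span_base span_scale span_zero)
    then show "a \<in> span ?B" by (simp add: orthonormal_basis_expand[OF B])
  next
    assume "a \<in> span ?B"
    then show "\<forall>b. a \<bullet> b = \<sigma>\<^sup>2 * (a \<bullet> b + J a \<bullet> J b)"
    proof (induction a rule: span_induct_alt)
      case base
      then show ?case using J by (simp add: linear_0)
    next
      case (step c x y)
      show ?case
      proof
        fix b
        have "x \<bullet> b = (\<sigma>\<^sup>2 * (1 + \<mu> x)) * (x \<bullet> b)" using step(1) by simp
        then have "x \<bullet> b = \<sigma>\<^sup>2 * (x \<bullet> b + J x \<bullet> J b)"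
          using orthonormal_basis_diag[OF B J diag, of x b] step(1)
          by (simp add: inner_commute algebra_simps)
        moreover have "y \<bullet> b = \<sigma>\<^sup>2 * (y \<bullet> b + J y \<bullet> J b)" using step(2) by blast
        moreover have "J (c *\<^sub>R x + y) \<bullet> J b = c * (J x \<bullet> J b) + J y \<bullet> J b"
          using J by (simp add: linear_add linear_cmul inner_add_left)
        moreover have "(c *\<^sub>R x + y) \<bullet> b = c * (x \<bullet> b) + y \<bullet> b"
          by (simp add: inner_add_left)
        ultimately show "(c *\<^sub>R x + y) \<bullet> b = \<sigma>\<^sup>2 * ((c *\<^sub>R x + y) \<bullet> b + J (c *\<^sub>R x + y) \<bullet> J b)"
          by algebra
      qed
    qed
  qed
  have "{v \<in> range ?G. \<forall>w\<in>range ?G. orth_proj ?Q v \<bullet> orth_proj ?Q w = \<sigma>\<^sup>2 * (v \<bullet> w)} = ?G ` span ?B"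
    by (auto simp: proj key[symmetric])
  then have "singular_value_mult (range ?G) (orth_proj ?Q) \<sigma> = dim (?G ` span ?B)"
    by (simp add: singular_value_mult_def)
  also have "\<dots> = dim (span ?B)"
    by (intro dim_image_eq) (auto simp: linG inj_on_def)
  also have "\<dots> = card ?B"
    using orthonormal_basis_independent[OF B]
    by (simp add: dim_span dim_eq_card_independent independent_mono)
  finally show ?thesis .
qed

text \<open>\<open>Abs_multiset\<close> is evaluated by recognizing its argument as the
  \<open>count\<close> of a multiset. On [0, pi/2] the cosine is nonnegative and injective, so cos^2
  \<phi> = 1 / (1 + \<mu> b) determines \<phi>; outside this interval both counts are 0.\<close>

lemma graph_jordan_angles:
  fixes J :: "'v::euclidean_space \<Rightarrow> 'w::euclidean_space"
  assumes B: "orthonormal_basis B UNIV" and J: "linear J"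
    and diag: "\<And>b c. b \<in> B \<Longrightarrow> c \<in> B \<Longrightarrow> J b \<bullet> J c = \<mu> b * (b \<bullet> c)"
    and \<mu>: "\<And>b. b \<in> B \<Longrightarrow> 0 \<le> \<mu> b"
  shows "jordan_angles (range (\<lambda>w. (w, J w))) {(x, y). y = 0}
    = image_mset (\<lambda>b. arccos (1 / sqrt (1 + \<mu> b))) (mset_set B)" (is "_ = ?M")
proof -
  have fin: "finite B" using orthonormal_basis_finite[OF B] .
  have bnd: "0 < 1 / sqrt (1 + \<mu> b)" "1 / sqrt (1 + \<mu> b) \<le> 1" "- 1 \<le> 1 / sqrt (1 + \<mu> b)"
    if "b \<in> B" for b
  proof -
    show pos: "0 < 1 / sqrt (1 + \<mu> b)" and "1 / sqrt (1 + \<mu> b) \<le> 1" using \<mu>[OF that] by auto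
    show "- 1 \<le> 1 / sqrt (1 + \<mu> b)" using pos by linarith
  qed
  have "(if 0 \<le> \<phi> \<and> \<phi> \<le> pi / 2
      then singular_value_mult (range (\<lambda>w. (w, J w))) (orth_proj {(x, y). y = 0}) (cos \<phi>) else 0)
    = count ?M \<phi>" for \<phi>
  proof -
    have cnt: "count ?M \<phi> = card {b \<in> B. arccos (1 / sqrt (1 + \<mu> b)) = \<phi>}"
      using fin by (simp add: count_image_mset vimage_def Int_def conj_commute)
    show ?thesis
    proof (cases "0 \<le> \<phi> \<and> \<phi> \<le> pi / 2")
      case True
      then have c: "0 \<le> cos \<phi>" by (intro cos_ge_zero) auto
      have "(cos \<phi>)\<^sup>2 * (1 + \<mu> b) = 1 \<longleftrightarrow> arccos (1 / sqrt (1 + \<mu> b)) = \<phi>" if "b \<in> B" for b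
      proof -
        have pos: "0 < 1 + \<mu> b" using \<mu>[OF that] by simp
        have "(cos \<phi>)\<^sup>2 * (1 + \<mu> b) = 1 \<longleftrightarrow> (cos \<phi>)\<^sup>2 = (1 / sqrt (1 + \<mu> b))\<^sup>2"
          using pos by (auto simp: field_simps)
        also have "\<dots> \<longleftrightarrow> cos \<phi> = 1 / sqrt (1 + \<mu> b)"
          using c bnd(1)[OF that] by (metis less_eq_real_def power2_eq_iff_nonneg)
        also have "\<dots> \<longleftrightarrow> arccos (1 / sqrt (1 + \<mu> b)) = \<phi>"
        proof
          assume "cos \<phi> = 1 / sqrt (1 + \<mu> b)"
          moreover have "\<phi> \<le> pi" using True pi_gt_zero by linarith
          ultimately show "arccos (1 / sqrt (1 + \<mu> b)) = \<phi>" using True arccos_cos[of \<phi>] by simp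
        next
          assume "arccos (1 / sqrt (1 + \<mu> b)) = \<phi>"
          then show "cos \<phi> = 1 / sqrt (1 + \<mu> b)"
            using bnd[OF that] cos_arccos by blast
        qed
        finally show ?thesis .
      qed
      then have "{b \<in> B. (cos \<phi>)\<^sup>2 * (1 + \<mu> b) = 1} = {b \<in> B. arccos (1 / sqrt (1 + \<mu> b)) = \<phi>}" by blast
      then show ?thesis using True cnt graph_singular_value_mult[OF B J diag, of "cos \<phi>"] by simp
    next
      case False
      have "arccos (1 / sqrt (1 + \<mu> b)) \<noteq> \<phi>" if "b \<in> B" for b
        using False bnd[OF that] arccos_lbound[of "1 / sqrt (1 + \<mu> b)"] arccos_le_pi2[of "1 / sqrt (1 + \<mu> b)"] by linarith
      then have e: "{b \<in> B. arccos (1 / sqrt (1 + \<mu> b)) = \<phi>} = {}" by blast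
      show ?thesis unfolding cnt e using False by (simp only: if_False card.empty)
    qed
  qed
  then show ?thesis unfolding jordan_angles_def by (simp add: count_inverse)
qed

lemma graph_slope:
  fixes J :: "'v::euclidean_space \<Rightarrow> 'w::euclidean_space"
  assumes B: "orthonormal_basis B UNIV" and J: "linear J"
    and diag: "\<And>b c. b \<in> B \<Longrightarrow> c \<in> B \<Longrightarrow> J b \<bullet> J c = \<mu> b * (b \<bullet> c)"
    and \<mu>: "\<And>b. b \<in> B \<Longrightarrow> 0 \<le> \<mu> b"
  shows "slope (range (\<lambda>w. (w, J w))) {(x, y). y = 0} = (\<Prod>b\<in>B. sqrt (1 + \<mu> b))"
proof -
  have "slope (range (\<lambda>w. (w, J w))) {(x, y). y = 0} = (\<Prod>b\<in>B. 1 / cos (arccos (1 / sqrt (1 + \<mu> b))))"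
    unfolding slope_def by (subst graph_jordan_angles[OF B J diag \<mu>])
      (simp_all add: image_mset.compositionality comp_def prod_unfold_prod_mset)
  also have "\<dots> = (\<Prod>b\<in>B. sqrt (1 + \<mu> b))"
  proof (intro prod.cong refl)
    fix b assume "b \<in> B"
    then have "0 < 1 / sqrt (1 + \<mu> b)" "1 / sqrt (1 + \<mu> b) \<le> 1" using \<mu>[of b] by auto
    then have "cos (arccos (1 / sqrt (1 + \<mu> b))) = 1 / sqrt (1 + \<mu> b)" by (intro cos_arccos) linarith+
    then show "1 / cos (arccos (1 / sqrt (1 + \<mu> b))) = sqrt (1 + \<mu> b)" by simp
  qed
  finally show ?thesis .
qed

text \<open>The vectors J b / sqrt (\<mu> b) are eigenvectors of J J^T with the same eigenvalues
  \<mu> b, and J^T vanishes on their orthogonal complement. The two spaces may differ in dimension,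
  but zero singular values contribute only factors 1, so the products agree.\<close>

lemma adjoint_orthonormal_basis:
  fixes J :: "'v::euclidean_space \<Rightarrow> 'w::euclidean_space"
  assumes B: "orthonormal_basis B UNIV" and J: "linear J"
    and diag: "\<And>b c. b \<in> B \<Longrightarrow> c \<in> B \<Longrightarrow> J b \<bullet> J c = \<mu> b * (b \<bullet> c)"
    and \<mu>: "\<And>b. b \<in> B \<Longrightarrow> 0 \<le> \<mu> b"
  obtains E \<kappa> where "orthonormal_basis E UNIV"
    "\<And>e e'. e \<in> E \<Longrightarrow> e' \<in> E \<Longrightarrow> adjoint J e \<bullet> adjoint J e' = \<kappa> e * (e \<bullet> e')"
    "(\<Prod>e\<in>E. 1 + \<kappa> e) = (\<Prod>b\<in>B. 1 + \<mu> b)"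
proof -
  have fin: "finite B" using orthonormal_basis_finite[OF B] .
  have adj: "adjoint J z \<bullet> w = z \<bullet> J w" for z w by (rule adjoint_clauses(2)[OF J])
  define B1 where "B1 = {b \<in> B. \<mu> b \<noteq> 0}"
  have pos: "0 < \<mu> b" if "b \<in> B1" for b using that \<mu>[of b] by (auto simp: B1_def)
  define h where "h = (\<lambda>b. J b /\<^sub>R sqrt (\<mu> b))"
  define E1 where "E1 = h ` B1"
  have B1: "orthonormal_basis B1 (span B1)"
    using B by (auto simp: orthonormal_basis_def B1_def pairwise_def)
  have diag1: "J b \<bullet> J c = \<mu> b * (b \<bullet> c)" if "b \<in> B1" "c \<in> B1" for b c
    using that diag by (simp add: B1_def)
  have inj: "inj_on h B1" and "orthonormal_basis E1 (J ` span B1)"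
    unfolding h_def E1_def by (rule orthonormal_basis_normalized_image[OF B1 J pos diag1]; assumption)+
  then have E1: "orthonormal_basis E1 (span E1)" by (simp add: orthonormal_basis_def)
  define K where "K = {z. \<forall>x\<in>span E1. z \<bullet> x = 0}"
  have "subspace K" by (auto simp: K_def subspace_def inner_add_left)
  then obtain E0 where E0: "orthonormal_basis E0 K" using orthonormal_basis_exists by blast
  have perp: "x \<bullet> y = 0" if "x \<in> span E1" "y \<in> K" for x y using that by (auto simp: K_def inner_commute)
  have all: "UNIV = {x + y | x y. x \<in> span E1 \<and> y \<in> K}"
  proof -
    have "\<exists>x y. v = x + y \<and> x \<in> span E1 \<and> y \<in> K" for v
    proof -
      obtain y where y: "y \<in> span E1" "\<And>z. z \<in> span E1 \<Longrightarrow> (v - y) \<bullet> z = 0"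
        using orth_decompose[OF subspace_span] by blast
      then show ?thesis by (intro exI[of _ y] exI[of _ "v - y"]) (auto simp: K_def)
    qed
    then show ?thesis by blast
  qed
  note E = orthonormal_basis_Un[OF E1 E0 perp all]
  have adj1: "adjoint J (h b) = sqrt (\<mu> b) *\<^sub>R b" if b: "b \<in> B1" for b
  proof (rule vector_eq_ldot[THEN iffD1], rule allI)
    fix w
    have "w \<bullet> adjoint J (h b) = J w \<bullet> J b / sqrt (\<mu> b)"
      using adj[of "h b" w] by (simp add: h_def inner_commute divide_inverse mult_ac)
    also have "\<dots> = sqrt (\<mu> b) * (w \<bullet> b)"
      using orthonormal_basis_diag[OF B J diag, of b w] b pos[OF b]
      by (auto simp: B1_def field_simps)
    finally show "w \<bullet> adjoint J (h b) = w \<bullet> (sqrt (\<mu> b) *\<^sub>R b)" by simp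
  qed
  have adj0: "adjoint J e = 0" if "e \<in> K" for e
  proof (rule vector_eq_ldot[THEN iffD1], rule allI)
    fix w
    \<comment> \<open>The complement of E1 is orthogonal to the whole range of J: each J b is zero
      or a multiple of a vector of E1.\<close>
    have "e \<bullet> J b = 0" if "b \<in> B" for b
    proof (cases "\<mu> b = 0")
      case True
      then have "J b = 0" using diag[OF that that] by simp
      then show ?thesis by simp
    next
      case False
      then have "h b \<in> span E1" using that by (auto simp: E1_def B1_def intro!: span_base)
      then have "e \<bullet> h b = 0" using \<open>e \<in> K\<close> by (auto simp: K_def)
      then show ?thesis using False \<mu>[OF that] by (simp add: h_def)
    qed
    then have "e \<bullet> J w = 0"
      using orthonormal_basis_linear_expand[OF B UNIV_I J, of w] by (simp add: inner_sum_right)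
    then show "w \<bullet> adjoint J e = w \<bullet> 0" using adj[of e w] by (simp add: inner_commute)
  qed
  define \<kappa> where "\<kappa> = (\<lambda>e. adjoint J e \<bullet> adjoint J e)"
  have \<kappa>1: "\<kappa> (h b) = \<mu> b" if "b \<in> B1" for b
    using adj1[OF that] pos[OF that] that orthonormal_basis_inner[OF B, of b b] by (simp add: \<kappa>_def B1_def)
  have \<kappa>0: "\<kappa> e = 0" if "e \<in> E0" for e
    using adj0 orthonormal_basis_mem[OF E0 that] by (simp add: \<kappa>_def)
  show ?thesis
  proof
    show "orthonormal_basis (E1 \<union> E0) UNIV" by (rule E)
    fix e e' assume e: "e \<in> E1 \<union> E0" "e' \<in> E1 \<union> E0"
    show "adjoint J e \<bullet> adjoint J e' = \<kappa> e * (e \<bullet> e')"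
    proof (cases "e = e'")
      case True
      then show ?thesis using orthonormal_basis_inner[OF E(1) e] by (simp add: \<kappa>_def)
    next
      case False
      have "adjoint J e \<bullet> adjoint J e' = 0"
      proof (cases "e \<in> E0 \<or> e' \<in> E0")
        case True
        then show ?thesis using adj0 orthonormal_basis_mem[OF E0] by fastforce
      next
        case False
        then obtain b c where bc: "b \<in> B1" "c \<in> B1" "e = h b" "e' = h c" using e by (auto simp: E1_def)
        then have "b \<noteq> c" using \<open>e \<noteq> e'\<close> by blast
        then show ?thesis using bc adj1 orthonormal_basis_inner[OF B, of b c] by (simp add: B1_def)
      qed
      then show ?thesis using orthonormal_basis_inner[OF E(1) e] False by simp
    qed
  next
    have "finite E1" "finite E0" using orthonormal_basis_finite E1 E0 by blast+
    then have "(\<Prod>e\<in>E1 \<union> E0. 1 + \<kappa> e) = (\<Prod>e\<in>E1. 1 + \<kappa> e) * (\<Prod>e\<in>E0. 1 + \<kappa> e)"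
      using E(2) by (simp add: prod.union_disjoint)
    also have "\<dots> = (\<Prod>b\<in>B1. 1 + \<mu> b)" using \<kappa>0 \<kappa>1 by (simp add: E1_def prod.reindex[OF inj])
    also have "\<dots> = (\<Prod>b\<in>B. 1 + \<mu> b)"
      using fin by (intro prod.mono_neutral_left) (auto simp: B1_def)
    finally show "(\<Prod>e\<in>E1 \<union> E0. 1 + \<kappa> e) = (\<Prod>b\<in>B. 1 + \<mu> b)" .
  qed
qed

text \<open>Orthogonality of (a, z) to every (w, J w) means that a + J^T z is orthogonal to every
  w.\<close>

lemma orthogonal_graph_eq:
  fixes J :: "'v::euclidean_space \<Rightarrow> 'w::euclidean_space"
  assumes "linear J"
  shows "{\<nu>. \<forall>w. \<nu> \<bullet> (w, J w) = 0} = range (\<lambda>z. (- adjoint J z, z))"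
proof -
  have adj: "adjoint J z \<bullet> w = z \<bullet> J w" for z w by (rule adjoint_clauses(2)[OF assms])
  have "(\<forall>w. (a, z) \<bullet> (w, J w) = 0) \<longleftrightarrow> a = - adjoint J z" for a z
  proof
    assume "\<forall>w. (a, z) \<bullet> (w, J w) = 0"
    then have "(a + adjoint J z) \<bullet> (a + adjoint J z) = 0" by (simp add: inner_add_left[of a] adj)
    then show "a = - adjoint J z" by (simp add: eq_neg_iff_add_eq_0)
  qed (simp add: adj)
  then show ?thesis by (auto simp: image_iff adj)
qed

lemma graph_normal_dim:
  fixes J :: "'v::euclidean_space \<Rightarrow> 'w::euclidean_space"
  assumes "linear J"
  shows "subspace {\<nu>. \<forall>w. \<nu> \<bullet> (w, J w) = 0}" "dim {\<nu>. \<forall>w. \<nu> \<bullet> (w, J w) = 0} = DIM('w)"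
proof -
  have lin: "linear (\<lambda>z. (- adjoint J z, z))"
    using adjoint_linear[OF assms] by (auto intro!: linearI simp: linear_add linear_cmul)
  show "subspace {\<nu>. \<forall>w. \<nu> \<bullet> (w, J w) = 0}"
    unfolding orthogonal_graph_eq[OF assms] using lin by (simp add: linear_subspace_image)
  show "dim {\<nu>. \<forall>w. \<nu> \<bullet> (w, J w) = 0} = DIM('w)"
    unfolding orthogonal_graph_eq[OF assms] using lin
    by (subst dim_image_eq) (auto simp: inj_on_def)
qed

text \<open>Because of the THE over all pairs of frames, the determinant is computed for arbitrary
  frames, and frames must be shown to exist. The orthogonal space is the graph of - J^T, so the
  stretching factors are those of J^T, whose product is the same as for J.\<close>

lemma graph_acute_angle:
  fixes J :: "'v::euclidean_space \<Rightarrow> real^'b::finite"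
  assumes B: "orthonormal_basis B UNIV" and J: "linear J"
    and diag: "\<And>b c. b \<in> B \<Longrightarrow> c \<in> B \<Longrightarrow> J b \<bullet> J c = \<mu> b * (b \<bullet> c)"
    and \<mu>: "\<And>b. b \<in> B \<Longrightarrow> 0 \<le> \<mu> b"
  shows "acute_angle TYPE('b) {\<nu>. \<forall>w. \<nu> \<bullet> (w, J w) = 0} {(x, y). x = 0} = arccos (1 / (\<Prod>b\<in>B. sqrt (1 + \<mu> b)))"
proof -
  let ?N = "{\<nu>. \<forall>w. \<nu> \<bullet> (w, J w) = 0}" and ?Q = "{(x, y). x = 0} :: ('v \<times> (real^'b)) set"
  let ?c = "1 / (\<Prod>b\<in>B. sqrt (1 + \<mu> b))"
  note N = orthogonal_graph_eq[OF J]
  obtain E \<kappa> where E: "orthonormal_basis E UNIV"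
    and \<kappa>: "\<And>e e'. e \<in> E \<Longrightarrow> e' \<in> E \<Longrightarrow> adjoint J e \<bullet> adjoint J e' = \<kappa> e * (e \<bullet> e')"
    and prod: "(\<Prod>e\<in>E. 1 + \<kappa> e) = (\<Prod>b\<in>B. 1 + \<mu> b)"
    using adjoint_orthonormal_basis[OF B J diag \<mu>] by metis
  obtain \<eta> :: "'b \<Rightarrow> real^'b" where \<eta>: "orthonormal_frame \<eta> UNIV" "bij_betw \<eta> UNIV E"
    using orthonormal_basis_imp_frame[OF E, where 'i = 'b] by auto
  let ?G = "\<lambda>z. (- adjoint J z, z)"
  have lin: "linear ?G"
    using adjoint_linear[OF J] by (auto intro!: linearI simp: linear_add linear_cmul)
  have G: "?G (\<eta> i) \<bullet> ?G (\<eta> j) = (1 + \<kappa> (\<eta> i)) * (\<eta> i \<bullet> \<eta> j)" for i j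
    using \<kappa>[of "\<eta> i" "\<eta> j"] bij_betwE[OF \<eta>(2)] by (simp add: algebra_simps)
  have pr: "(\<Prod>i\<in>UNIV. 1 + \<kappa> (\<eta> i)) = (\<Prod>b\<in>B. 1 + \<mu> b)"
    using prod.reindex_bij_betw[OF \<eta>(2), of "\<lambda>e. 1 + \<kappa> e"] prod by simp
  have ppos: "0 < (\<Prod>b\<in>B. 1 + \<mu> b)" using \<mu> by (intro prod_pos) (auto simp: add_pos_nonneg)
  have sq: "(\<Prod>b\<in>B. sqrt (1 + \<mu> b))\<^sup>2 = (\<Prod>b\<in>B. 1 + \<mu> b)"
    using \<mu> by (simp add: prod_power_distrib)
  \<comment> \<open>The frame vectors are \<open>(- J\<^sup>T z\<^sub>i, z\<^sub>i)\<close>; computing their Gram determinant, which is 1, from that of the \<open>z\<^sub>i\<close>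
    gives \<open>1 = (\<Prod>b\<in>B. 1 + \<mu> b) det (z\<^sub>i \<bullet> y\<^sub>j)\<^sup>2\<close>.\<close>
  have val: "\<bar>det (\<chi> i j. \<nu> i \<bullet> \<epsilon> j :: real^'b^'b)\<bar> = ?c"
    if \<nu>: "orthonormal_frame \<nu> ?N" and \<epsilon>: "orthonormal_frame \<epsilon> ?Q" for \<nu> \<epsilon> :: "'b \<Rightarrow> 'v \<times> (real^'b)"
  proof -
    define z where "z = (\<lambda>i. snd (\<nu> i))"
    define y where "y = (\<lambda>i. snd (\<epsilon> i))"
    have "\<nu> i \<in> ?N" for i
      by (rule orthonormal_basis_mem[OF orthonormal_frame_basis(1)[OF \<nu>] rangeI])
    then have nz: "\<nu> i = ?G (z i)" for i unfolding N z_def by (auto simp: image_iff prod_eq_iff)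
    have "\<epsilon> i \<in> ?Q" for i
      by (rule orthonormal_basis_mem[OF orthonormal_frame_basis(1)[OF \<epsilon>] rangeI])
    then have ey: "\<epsilon> i = (0, y i)" for i by (simp add: y_def case_prod_beta prod_eq_iff)
    have yf: "orthonormal_frame y UNIV"
    proof -
      have yy: "y i \<bullet> y j = (if i = j then 1 else 0)" for i j
        using \<epsilon> unfolding orthonormal_frame_def ey by simp
      have "span (range \<epsilon>) = ?Q" using \<epsilon> by (simp add: orthonormal_frame_def)
      then have "snd ` span (range \<epsilon>) = snd ` ?Q" by simp
      moreover have "snd ` span (range \<epsilon>) = span (snd ` range \<epsilon>)"
        by (rule linear_span_image[symmetric]) (rule linear_snd)
      moreover have "snd ` ?Q = UNIV" by force
      moreover have "snd ` range \<epsilon> = range y" by (simp add: y_def image_image)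
      ultimately show ?thesis using yy by (simp add: orthonormal_frame_def)
    qed
    have "det (\<chi> i j. ?G (z i) \<bullet> ?G (z j) :: real^'b^'b) = (\<Prod>b\<in>B. 1 + \<mu> b) * (det (\<chi> i j. z i \<bullet> \<eta> j :: real^'b^'b))\<^sup>2"
      using det_gram[OF \<eta>(1) lin UNIV_I G] pr by simp
    also have "(\<chi> i j. ?G (z i) \<bullet> ?G (z j) :: real^'b^'b) = mat 1"
      using \<nu> unfolding orthonormal_frame_def nz by (simp add: mat_def)
    \<comment> \<open>The frames \<eta> and y span the same space, so either squared determinant is
      the Gram determinant of the z_i.\<close>
    also have "(det (\<chi> i j. z i \<bullet> \<eta> j :: real^'b^'b))\<^sup>2 = (det (\<chi> i j. z i \<bullet> y j :: real^'b^'b))\<^sup>2"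
      using det_gram[OF \<eta>(1) linear_ident UNIV_I, of "\<lambda>_. 1" z] det_gram[OF yf linear_ident UNIV_I, of "\<lambda>_. 1" z] by simp
    also have "(\<chi> i j. z i \<bullet> y j :: real^'b^'b) = (\<chi> i j. \<nu> i \<bullet> \<epsilon> j)"
      by (simp add: nz ey)
    finally have "(\<Prod>b\<in>B. 1 + \<mu> b) * (det (\<chi> i j. \<nu> i \<bullet> \<epsilon> j :: real^'b^'b))\<^sup>2 = 1" by simp
    then have "(det (\<chi> i j. \<nu> i \<bullet> \<epsilon> j :: real^'b^'b))\<^sup>2 = ?c\<^sup>2"
      using ppos sq by (simp add: power_divide field_simps)
    then have "\<bar>det (\<chi> i j. \<nu> i \<bullet> \<epsilon> j :: real^'b^'b)\<bar> = \<bar>?c\<bar>"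
      by (simp only: power2_eq_iff abs_eq_iff)
    moreover have "0 \<le> ?c" using \<mu> by (auto intro!: prod_nonneg)
    ultimately show ?thesis by simp
  qed
  have "subspace ?N" and dN: "dim ?N = CARD('b)" using graph_normal_dim[OF J] by simp_all
  then obtain E\<^sub>N where "orthonormal_basis E\<^sub>N ?N" using orthonormal_basis_exists by blast
  then obtain \<nu> :: "'b \<Rightarrow> 'v \<times> (real^'b)" where \<nu>: "orthonormal_frame \<nu> ?N"
    using orthonormal_basis_imp_frame[OF _ dN] by blast
  have "?Q = range (\<lambda>z. (0, z))" by auto
  moreover have "linear (\<lambda>z::real^'b. (0::'v, z))" by (auto intro!: linearI)
  ultimately have "subspace ?Q" and dQ: "dim ?Q = CARD('b)"
    by (simp_all add: linear_subspace_image dim_image_eq inj_on_def)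
  then obtain E\<^sub>Q where "orthonormal_basis E\<^sub>Q ?Q" using orthonormal_basis_exists by blast
  then obtain \<epsilon> :: "'b \<Rightarrow> 'v \<times> (real^'b)" where \<epsilon>: "orthonormal_frame \<epsilon> ?Q"
    using orthonormal_basis_imp_frame[OF _ dQ] by blast
  have "(THE c. \<exists>\<nu> \<epsilon>. orthonormal_frame \<nu> ?N \<and> orthonormal_frame \<epsilon> ?Q \<and>
                        c = \<bar>det (\<chi> i j. \<nu> i \<bullet> \<epsilon> j :: real^'b^'b)\<bar>) = ?c"
  proof (rule the_equality)
    show "\<exists>\<nu> \<epsilon>. orthonormal_frame \<nu> ?N \<and> orthonormal_frame \<epsilon> ?Q \<and>
            ?c = \<bar>det (\<chi> i j. \<nu> i \<bullet> \<epsilon> j :: real^'b^'b)\<bar>"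
      using \<nu> \<epsilon> val[OF \<nu> \<epsilon>] by (intro exI[of _ \<nu>] exI[of _ \<epsilon>]) simp
  qed (use val in fastforce)
  then show ?thesis by (simp add: acute_angle_def)
qed

section \<open>Curves and second fundamental forms of graphs\<close>

lemma smooth_curve_derivative:
  assumes "smooth_on I \<gamma>" "t \<in> I"
  shows "(\<gamma> has_vector_derivative vector_derivative \<gamma> (at t)) (at t)"
  using smooth_on_has_derivative[OF assms] differentiableI vector_derivative_works differentiable_at_withinI
  by blast

lemma frechet_derivative_real:
  assumes "smooth_on I \<gamma>" "t \<in> I"
  shows "frechet_derivative \<gamma> (at t) 1 = vector_derivative \<gamma> (at t)"
proof -
  have "(\<gamma> has_derivative (\<lambda>x. x *\<^sub>R vector_derivative \<gamma> (at t))) (at t)"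
    using smooth_curve_derivative[OF assms] by (simp add: has_vector_derivative_def)
  from frechet_derivative_at[OF this] show ?thesis by (metis scaleR_one)
qed

lemma smooth_on_vector_derivative:
  assumes "open I" "smooth_on I \<gamma>"
  shows "smooth_on I (\<lambda>t. vector_derivative \<gamma> (at t))"
  by (rule smooth_on_cong[OF assms(1) _ smooth_on_frechet_derivative[OF assms(2), of 1]])
    (rule frechet_derivative_real[OF assms(2)])

lemma curve_at_velocity:
  assumes "curve_at M q \<gamma>"
  shows "(\<gamma> has_vector_derivative velocity \<gamma>) (at 0)"
  using assms smooth_curve_derivative[of _ \<gamma> 0] by (force simp: curve_at_def velocity_def)

lemma tangent_spaceI:
  assumes "\<gamma> 0 = q" "open I" "0 \<in> I" "smooth_on I \<gamma>" "\<gamma> ` I \<subseteq> M"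
    "(\<gamma> has_vector_derivative v) (at 0)"
  shows "v \<in> tangent_space M q"
proof -
  obtain e where e: "e > 0" "ball 0 e \<subseteq> I" using assms openE by blast
  then have "{-e<..<e} \<subseteq> I" by (auto simp: subset_iff dist_real_def)
  then have "curve_at M q \<gamma>"
    using assms(1,4,5) e(1) unfolding curve_at_def by (blast intro: smooth_on_subset)
  moreover have "velocity \<gamma> = v"
    using assms(6) vector_derivative_at unfolding velocity_def by blast
  ultimately show ?thesis unfolding tangent_space_def by blast
qed

lemma smooth_on_chain_curve:
  assumes "smooth_on U G" "c t \<in> U" "(c has_vector_derivative v) (at t)"
  shows "((\<lambda>s. G (c s)) has_vector_derivative frechet_derivative G (at (c t)) v) (at t)"
proof -
  have D: "(G has_derivative frechet_derivative G (at (c t))) (at (c t))"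
    by (rule smooth_on_has_derivative[OF assms(1,2)])
  show ?thesis
    using has_derivative_compose[OF assms(3)[unfolded has_vector_derivative_def] D]
      linear_cmul[OF has_derivative_linear[OF D]]
    by (simp add: has_vector_derivative_def)
qed

lemma tangent_space_UNIV: "tangent_space UNIV (q::'v::euclidean_space) = UNIV"
proof -
  have "v \<in> tangent_space UNIV q" for v
    by (rule tangent_spaceI[of "\<lambda>t. q + t *\<^sub>R v" _ UNIV])
      (auto intro!: smooth_on_add smooth_on_scaleR smooth_on_const smooth_on_ident derivative_eq_intros)
  then show ?thesis by blast
qed

text \<open>|T|^2 is constant along the curve, and its derivative is twice the inner product. T is
  the identity for spheres and \<open>fst\<close> for a graph over a sphere.\<close>

lemma tangent_orthogonal_radius:
  assumes "curve_at M q \<gamma>" "\<And>q. q \<in> M \<Longrightarrow> T q \<bullet> T q = c" "bounded_linear T"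
  shows "T (velocity \<gamma>) \<bullet> T q = 0"
proof -
  obtain e where e: "e > 0" "\<gamma> ` {-e<..<e} \<subseteq> M" and q: "\<gamma> 0 = q"
    using assms(1) by (auto simp: curve_at_def)
  have d: "((\<lambda>t. T (\<gamma> t)) has_vector_derivative T (velocity \<gamma>)) (at 0)"
    by (rule bounded_linear.has_vector_derivative[OF assms(3) curve_at_velocity[OF assms(1)]])
  have "((\<lambda>t. T (\<gamma> t) \<bullet> T (\<gamma> t)) has_vector_derivative T q \<bullet> T (velocity \<gamma>) + T (velocity \<gamma>) \<bullet> T q) (at 0)"
    using bounded_bilinear.has_vector_derivative[OF bounded_bilinear_inner d d] q by simp
  moreover have "((\<lambda>t. T (\<gamma> t) \<bullet> T (\<gamma> t)) has_vector_derivative 0) (at 0)"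
  proof (rule has_vector_derivative_transform_within_open[of "\<lambda>t. c" _ _ "{-e<..<e}"])
    show "c = T (\<gamma> t) \<bullet> T (\<gamma> t)" if "t \<in> {-e<..<e}" for t using assms(2) e that by force
  qed (use e in auto)
  ultimately have "T q \<bullet> T (velocity \<gamma>) + T (velocity \<gamma>) \<bullet> T q = 0"
    using vector_derivative_unique_at by blast
  then show ?thesis by (simp add: inner_commute)
qed

text \<open>The line x + t v is projected radially to the sphere through x. The derivative of the
  scaling factor contributes a multiple of x to the velocity; this multiple is 0 because the
  velocity is tangent to the sphere.\<close>

lemma normalized_line:
  fixes x v :: "'v::euclidean_space"
  assumes "x \<noteq> 0" "v \<bullet> x = 0"
  obtains c where "c 0 = x" "smooth_on (UNIV :: real set) c" "\<And>t. norm (c t) = norm x"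
    "(c has_vector_derivative v) (at 0)"
proof -
  let ?l = "\<lambda>t. x + t *\<^sub>R v"
  have l: "?l t \<noteq> 0" for t
  proof
    assume "?l t = 0"
    then have "?l t \<bullet> x = 0" by simp
    then show False using assms by (simp add: inner_add_left)
  qed
  have sl: "smooth_on UNIV ?l"
    by (intro smooth_on_add smooth_on_scaleR smooth_on_const smooth_on_ident) auto
  define \<phi> where "\<phi> = (\<lambda>t. norm x * inverse (norm (?l t)))"
  have s\<phi>: "smooth_on UNIV \<phi>" unfolding \<phi>_def
    by (intro smooth_on_mult smooth_on_const
        smooth_on_compose[OF _ _ _ sl smooth_on_inverse_norm]) (use l in auto)
  define c where "c = (\<lambda>t. \<phi> t *\<^sub>R ?l t)"
  have sc: "smooth_on UNIV c" unfolding c_def by (intro smooth_on_scaleR sl s\<phi>) auto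
  have \<phi>0: "\<phi> 0 = 1" using assms by (simp add: \<phi>_def)
  have n: "norm (c t) = norm x" for t using l[of t] by (simp add: c_def \<phi>_def)
  obtain d where d: "(\<phi> has_vector_derivative d) (at 0)"
    using smooth_curve_derivative[OF s\<phi>, of 0] by blast
  have dl: "(?l has_vector_derivative v) (at 0)"
    by (auto intro!: derivative_eq_intros)
  have dc: "(c has_vector_derivative v + d *\<^sub>R x) (at 0)"
    unfolding c_def using bounded_bilinear.has_vector_derivative[OF bounded_bilinear_scaleR d dl] \<phi>0 by simp
  have "curve_at (sphere 0 (norm x)) x c"
    using n sc \<phi>0 unfolding curve_at_def
    by (auto simp: c_def intro!: exI[of _ 1] smooth_on_subset[OF sc[unfolded c_def]])
  moreover have "velocity c = v + d *\<^sub>R x"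
    using dc vector_derivative_at unfolding velocity_def by blast
  ultimately have "(v + d *\<^sub>R x) \<bullet> x = 0"
    using tangent_orthogonal_radius[of "sphere 0 (norm x)" x c "\<lambda>x. x" "norm x ^ 2"]
    by (auto simp: power2_norm_eq_inner[symmetric])
  then have "d = 0" using assms by (simp add: inner_add_left)
  then show ?thesis using that[of c] dc sc n \<phi>0 by (simp add: c_def)
qed

lemma tangent_space_sphere:
  fixes x :: "'v::euclidean_space"
  assumes "norm x = 1"
  shows "tangent_space (sphere 0 1) x = {v. v \<bullet> x = 0}"
proof
  show "tangent_space (sphere 0 1) x \<subseteq> {v. v \<bullet> x = 0}"
    using tangent_orthogonal_radius[of "sphere 0 1" x _ "\<lambda>x. x" 1]
    by (auto simp: tangent_space_def norm_eq_1)
  show "{v. v \<bullet> x = 0} \<subseteq> tangent_space (sphere 0 1) x"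
  proof
    fix v assume "v \<in> {v. v \<bullet> x = 0}"
    moreover have "x \<noteq> 0" using assms by auto
    ultimately obtain c where c: "c 0 = x" "smooth_on (UNIV :: real set) c" "\<And>t. norm (c t) = norm x"
      "(c has_vector_derivative v) (at 0)" using normalized_line[of x v] by blast
    then show "v \<in> tangent_space (sphere 0 1) x"
      using assms by (intro tangent_spaceI[of c _ UNIV]) auto
  qed
qed

text \<open>The derivative at \<open>y\<close> in direction \<open>w\<close> of \<open>z \<mapsto> DF(z) u\<close>; the expansion of \<open>u\<close> in coordinates makes
  linearity in \<open>u\<close> immediate, without assumptions on \<open>F\<close>.\<close>

definition hess :: "('v::euclidean_space \<Rightarrow> 'w::real_normed_vector) \<Rightarrow> 'v \<Rightarrow> 'v \<Rightarrow> 'v \<Rightarrow> 'w" where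
  "hess F y u w = (\<Sum>b\<in>Basis. (u \<bullet> b) *\<^sub>R frechet_derivative (\<lambda>z. frechet_derivative F (at z) b) (at y) w)"

lemma smooth_on_linear_derivative:
  "smooth_on U F \<Longrightarrow> y \<in> U \<Longrightarrow> linear (frechet_derivative F (at y))"
  using smooth_on_has_derivative has_derivative_linear by blast

lemma bilinear_hess:
  assumes "smooth_on U F" "y \<in> U"
  shows "bilinear (hess F y)"
proof -
  have "linear (frechet_derivative (\<lambda>z. frechet_derivative F (at z) b) (at y))" for b
    by (rule smooth_on_linear_derivative[OF smooth_on_frechet_derivative[OF assms(1)] assms(2)])
  then show ?thesis unfolding hess_def bilinear_def
    by (auto intro!: linearI simp: linear_add linear_cmul inner_add_left scaleR_add_left scaleR_add_right
        sum.distrib scaleR_sum_right mult_ac)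
qed

lemma derivative_in_Basis:
  fixes F :: "'v::euclidean_space \<Rightarrow> 'w::real_normed_vector"
  assumes "smooth_on U F" "y \<in> U"
  shows "frechet_derivative F (at y) u = (\<Sum>b\<in>Basis. (u \<bullet> b) *\<^sub>R frechet_derivative F (at y) b)"
proof -
  have "frechet_derivative F (at y) (\<Sum>b\<in>Basis. (u \<bullet> b) *\<^sub>R b) = (\<Sum>b\<in>Basis. (u \<bullet> b) *\<^sub>R frechet_derivative F (at y) b)"
    using smooth_on_linear_derivative[OF assms] by (simp add: linear_sum linear_cmul)
  then show ?thesis by (simp only: euclidean_representation)
qed

text \<open>Product rule for a derivative whose base point and direction both move. In coordinates
  the two motions separate: moving coefficients times derivatives in fixed directions.\<close>

lemma derivative_along_curve:
  fixes F :: "'v::euclidean_space \<Rightarrow> 'w::real_normed_vector"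
  assumes "open U" "smooth_on U F" "c t \<in> U"
    and c: "(c has_vector_derivative v) (at t)" and u: "(u has_vector_derivative a) (at t)"
  shows "((\<lambda>s. frechet_derivative F (at (c s)) (u s)) has_vector_derivative
    frechet_derivative F (at (c t)) a + hess F (c t) (u t) v) (at t)"
proof -
  let ?D = "\<lambda>b z. frechet_derivative F (at z) b"
  have "((\<lambda>s. ?D b (c s)) has_vector_derivative frechet_derivative (?D b) (at (c t)) v) (at t)" for b
    by (rule smooth_on_chain_curve[OF smooth_on_frechet_derivative[OF assms(2)] assms(3) c])
  moreover have "((\<lambda>s. u s \<bullet> b) has_vector_derivative a \<bullet> b) (at t)" for b
    using bounded_linear.has_vector_derivative[OF bounded_linear_inner_left u] .
  ultimately have "((\<lambda>s. (u s \<bullet> b) *\<^sub>R ?D b (c s)) has_vector_derivative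
      (u t \<bullet> b) *\<^sub>R frechet_derivative (?D b) (at (c t)) v + (a \<bullet> b) *\<^sub>R ?D b (c t)) (at t)" for b
    using bounded_bilinear.has_vector_derivative[OF bounded_bilinear_scaleR] by blast
  then have "((\<lambda>s. \<Sum>b\<in>Basis. (u s \<bullet> b) *\<^sub>R ?D b (c s)) has_vector_derivative
      (\<Sum>b\<in>Basis. (u t \<bullet> b) *\<^sub>R frechet_derivative (?D b) (at (c t)) v + (a \<bullet> b) *\<^sub>R ?D b (c t))) (at t)"
    by (intro has_vector_derivative_sum)
  moreover have "(\<Sum>b\<in>Basis. (u t \<bullet> b) *\<^sub>R frechet_derivative (?D b) (at (c t)) v + (a \<bullet> b) *\<^sub>R ?D b (c t))
      = frechet_derivative F (at (c t)) a + hess F (c t) (u t) v"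
    unfolding derivative_in_Basis[OF assms(2,3), of a] by (simp add: hess_def sum.distrib add.commute)
  ultimately have "((\<lambda>s. \<Sum>b\<in>Basis. (u s \<bullet> b) *\<^sub>R ?D b (c s)) has_vector_derivative
      frechet_derivative F (at (c t)) a + hess F (c t) (u t) v) (at t)" by simp
  \<comment> \<open>The coordinate formula for DF is known only on U, where the curve stays for
    nearby times.\<close>
  moreover have "\<forall>\<^sub>F s in at t. c s \<in> U"
    using has_vector_derivative_continuous[OF c] assms(1,3)
    by (auto simp: isCont_def topological_tendstoD)
  then have "\<forall>\<^sub>F s in at t. (\<Sum>b\<in>Basis. (u s \<bullet> b) *\<^sub>R ?D b (c s)) = frechet_derivative F (at (c s)) (u s)"
    by (rule eventually_mono) (use derivative_in_Basis[OF assms(2)] in metis)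
  ultimately show ?thesis
    unfolding has_vector_derivative_def
    by (rule has_derivative_transform_eventually) (auto simp: derivative_in_Basis[OF assms(2,3), of "u t"])
qed

text \<open>Near time 0 the curve is (c, F c) with c its projection, and this is differentiated
  twice. M over U only has to lie in the graph, so the part of a graph over a sphere is covered
  too.\<close>

lemma curve_in_graph:
  fixes F :: "'v::euclidean_space \<Rightarrow> 'w::euclidean_space"
  assumes U: "open U" "smooth_on U F" and y: "y \<in> U"
    and graph: "\<And>y z. (y, z) \<in> M \<Longrightarrow> y \<in> U \<Longrightarrow> z = F y"
    and \<gamma>: "curve_at M (y, F y) \<gamma>"
  defines "v \<equiv> fst (velocity \<gamma>)" and "D \<equiv> frechet_derivative F (at y)"
  shows "velocity \<gamma> = (v, D v)"
    and "\<exists>a. acceleration \<gamma> = (a, D a) + (0, hess F y v v)"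
proof -
  obtain e where e: "e > 0" "smooth_on {-e<..<e} \<gamma>" "\<gamma> ` {-e<..<e} \<subseteq> M" and \<gamma>0: "\<gamma> 0 = (y, F y)"
    using \<gamma> by (auto simp: curve_at_def)
  define c where "c = (\<lambda>t. fst (\<gamma> t))"
  \<comment> \<open>Times are restricted to those whose projection stays in U; off U nothing is
    known about F or M.\<close>
  define I where "I = c -` U \<inter> {-e<..<e}"
  have "continuous_on {-e<..<e} c" unfolding c_def
    by (intro continuous_on_fst smooth_on_continuous e)
  then have I: "open I" "0 \<in> I" "I \<subseteq> {-e<..<e}"
    using U(1) e(1) y \<gamma>0 continuous_on_open_vimage[of "{-e<..<e}" c] by (auto simp: I_def c_def)
  have s\<gamma>: "smooth_on I \<gamma>" using smooth_on_subset[OF e(2) I(3)] .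
  have sc: "smooth_on I c" unfolding c_def
    by (rule smooth_on_linear[OF bounded_linear_fst I(1) s\<gamma>])
  have cU: "c t \<in> U" if "t \<in> I" for t using that by (auto simp: I_def)
  have eq: "\<gamma> t = (c t, F (c t))" if "t \<in> I" for t
  proof -
    have "\<gamma> t \<in> M" using that I(3) e(3) by blast
    then show ?thesis using graph[of "c t" "snd (\<gamma> t)"] cU[OF that] by (simp add: c_def prod_eq_iff)
  qed
  let ?c' = "\<lambda>t. vector_derivative c (at t)"
  have dc: "(c has_vector_derivative ?c' t) (at t)" if "t \<in> I" for t
    by (rule smooth_curve_derivative[OF sc that])
  have d\<gamma>: "(\<gamma> has_vector_derivative (?c' t, frechet_derivative F (at (c t)) (?c' t))) (at t)" if t: "t \<in> I" for t
  proof -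
    have "((\<lambda>t. F (c t)) has_vector_derivative frechet_derivative F (at (c t)) (?c' t)) (at t)"
      by (rule smooth_on_chain_curve[OF U(2) cU[OF t] dc[OF t]])
    from has_vector_derivative_Pair[OF dc[OF t] this] show ?thesis
      by (rule has_vector_derivative_transform_within_open[OF _ I(1) t]) (simp add: eq)
  qed
  have vd: "vector_derivative \<gamma> (at t) = (?c' t, frechet_derivative F (at (c t)) (?c' t))" if "t \<in> I" for t
    using vector_derivative_at[OF d\<gamma>[OF that]] .
  have c0: "c 0 = y" by (simp add: c_def \<gamma>0)
  have v: "?c' 0 = v" using vd[OF I(2)] by (simp add: v_def velocity_def)
  show "velocity \<gamma> = (v, D v)" using vd[OF I(2)] v by (simp add: velocity_def c0 D_def)
  obtain a where a: "(?c' has_vector_derivative a) (at 0)"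
    using smooth_curve_derivative[OF smooth_on_vector_derivative[OF I(1) sc] I(2)] by blast
  have "((\<lambda>s. frechet_derivative F (at (c s)) (?c' s)) has_vector_derivative D a + hess F y v v) (at 0)"
    using derivative_along_curve[OF U cU[OF I(2)] dc[OF I(2)] a] by (simp add: c0 v D_def)
  from has_vector_derivative_Pair[OF a this]
  have "((\<lambda>t. vector_derivative \<gamma> (at t)) has_vector_derivative (a, D a + hess F y v v)) (at 0)"
    by (rule has_vector_derivative_transform_within_open[OF _ I(1) I(2)]) (simp add: vd)
  then have "acceleration \<gamma> = (a, D a) + (0, hess F y v v)"
    unfolding acceleration_def by (simp add: vector_derivative_at)
  then show "\<exists>a. acceleration \<gamma> = (a, D a) + (0, hess F y v v)" by blast
qed

lemma graph_curve_tangent: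
  fixes F :: "'v::euclidean_space \<Rightarrow> 'w::euclidean_space"
  assumes U: "open U" "smooth_on U F" and I: "open I" "(0::real) \<in> I" and c: "c ` I \<subseteq> U" "smooth_on I c"
    and M: "\<And>t. t \<in> I \<Longrightarrow> (c t, F (c t)) \<in> M" and d: "(c has_vector_derivative w) (at 0)"
  shows "(w, frechet_derivative F (at (c 0)) w) \<in> tangent_space M (c 0, F (c 0))"
proof (rule tangent_spaceI[where \<gamma> = "\<lambda>t. (c t, F (c t))" and I = I])
  show "smooth_on I (\<lambda>t. (c t, F (c t)))"
    by (intro smooth_on_Pair I c smooth_on_compose[OF _ U(1) c(1) c(2) U(2)])
  have "((\<lambda>t. F (c t)) has_vector_derivative frechet_derivative F (at (c 0)) w) (at 0)"
    by (rule smooth_on_chain_curve[OF U(2) _ d]) (use c I in blast)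
  then show "((\<lambda>t. (c t, F (c t))) has_vector_derivative (w, frechet_derivative F (at (c 0)) w)) (at 0)"
    by (rule has_vector_derivative_Pair[OF d])
qed (use I M in auto)

text \<open>Straight lines in the base lift to curves in M, which requires M to contain the full
  graph over U. Over the rest of the base M is arbitrary, so a cone may include its apex.\<close>

lemma graph_tangent_space:
  fixes F :: "'v::euclidean_space \<Rightarrow> 'w::euclidean_space"
  assumes U: "open U" "smooth_on U F" and y: "y \<in> U"
    and graph: "\<And>y z. y \<in> U \<Longrightarrow> (y, z) \<in> M \<longleftrightarrow> z = F y"
  shows "tangent_space M (y, F y) = range (\<lambda>w. (w, frechet_derivative F (at y) w))"
proof
  show "tangent_space M (y, F y) \<subseteq> range (\<lambda>w. (w, frechet_derivative F (at y) w))"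
  proof
    fix v assume "v \<in> tangent_space M (y, F y)"
    then obtain \<gamma> where \<gamma>: "curve_at M (y, F y) \<gamma>" "v = velocity \<gamma>"
      by (auto simp: tangent_space_def)
    have "\<And>y z. (y, z) \<in> M \<Longrightarrow> y \<in> U \<Longrightarrow> z = F y" using graph by blast
    from curve_in_graph(1)[OF U y this \<gamma>(1)]
    show "v \<in> range (\<lambda>w. (w, frechet_derivative F (at y) w))" unfolding \<gamma>(2) by (rule range_eqI)
  qed
  have "(w, frechet_derivative F (at y) w) \<in> tangent_space M (y, F y)" for w
  proof -
    let ?c = "\<lambda>t. y + t *\<^sub>R w"
    let ?I = "?c -` U"
    have "open ?I" by (intro open_vimage U continuous_intros)
    moreover have "smooth_on ?I ?c"
      by (intro smooth_on_add smooth_on_scaleR smooth_on_const smooth_on_ident \<open>open ?I\<close>)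
    moreover have "(?c has_vector_derivative w) (at 0)"
      by (auto intro!: derivative_eq_intros)
    moreover have "0 \<in> ?I" using y by simp
    ultimately show ?thesis
      using graph_curve_tangent[OF U, of ?I ?c M w] graph by simp
  qed
  then show "range (\<lambda>w. (w, frechet_derivative F (at y) w)) \<subseteq> tangent_space M (y, F y)" by blast
qed

text \<open>Whatever curve \<open>SOME\<close> picks, it enters only through (a, DF a), which is
  orthogonal to the normal space and drops out of the projection. The normal space is a hypothesis,
  so that one lemma serves a submanifold of the sphere and one of the whole space.\<close>

lemma graph_second_fundamental_form:
  fixes F :: "'v::euclidean_space \<Rightarrow> 'w::euclidean_space"
  assumes U: "open U" "smooth_on U F" and y: "y \<in> U"
    and graph: "\<And>y z. (y, z) \<in> M \<Longrightarrow> y \<in> U \<Longrightarrow> z = F y"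
    and N: "normal_plane M S (y, F y) = {\<nu>. \<forall>w. \<nu> \<bullet> (w, frechet_derivative F (at y) w) = 0}"
    and v: "v \<in> tangent_space M (y, F y)"
  shows "second_fundamental_form M S (y, F y) v = orth_proj (normal_plane M S (y, F y)) (0, hess F y (fst v) (fst v))"
proof -
  let ?D = "frechet_derivative F (at y)" and ?N = "normal_plane M S (y, F y)"
  define \<gamma> where "\<gamma> = (SOME \<gamma>. curve_at M (y, F y) \<gamma> \<and> velocity \<gamma> = v)"
  have "\<exists>\<gamma>. curve_at M (y, F y) \<gamma> \<and> velocity \<gamma> = v" using v by (auto simp: tangent_space_def)
  from someI_ex[OF this] have \<gamma>: "curve_at M (y, F y) \<gamma>" "velocity \<gamma> = v" by (auto simp: \<gamma>_def)
  have sub: "subspace ?N"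
    unfolding N by (rule graph_normal_dim[OF smooth_on_linear_derivative[OF U(2) y]])
  obtain a where a: "acceleration \<gamma> = (a, ?D a) + (0, hess F y (fst v) (fst v))"
    using curve_in_graph(2)[OF U y graph \<gamma>(1)] \<gamma>(2) by auto
  have "(a, ?D a) \<bullet> z = 0" if "z \<in> ?N" for z
    using that unfolding N by (metis (mono_tags, lifting) inner_commute mem_Collect_eq)
  then have "((a, ?D a) + (0, hess F y (fst v) (fst v)) - orth_proj ?N (0, hess F y (fst v) (fst v))) \<bullet> z = 0"
    if "z \<in> ?N" for z
    unfolding inner_diff_left inner_add_left orth_proj_inner[OF sub that] using that by simp
  then have "orth_proj ?N (acceleration \<gamma>) = orth_proj ?N (0, hess F y (fst v) (fst v))"
    unfolding a by (intro orth_proj_unique sub orth_proj_mem)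
  then show ?thesis unfolding second_fundamental_form_def \<gamma>_def .
qed

lemma linear_orth_proj:
  fixes P :: "'v::euclidean_space set"
  assumes "subspace P" shows "linear (orth_proj P)"
proof (rule linearI)
  note o = orth_proj_mem[OF assms] orth_proj_inner[OF assms]
  show "orth_proj P (x + y) = orth_proj P x + orth_proj P y" for x y
    by (rule orth_proj_unique[OF assms]) (use o assms in \<open>auto simp: inner_diff_left inner_add_left subspace_add\<close>)
  show "orth_proj P (c *\<^sub>R x) = c *\<^sub>R orth_proj P x" for c x
    by (rule orth_proj_unique[OF assms]) (use o assms in \<open>auto simp: inner_diff_left subspace_scale\<close>)
qed

text \<open>The shear (y, z) -> (y, z - F y) is a single slice chart for the whole graph.\<close>

lemma graph_smooth_submanifold:
  fixes F :: "'v::euclidean_space \<Rightarrow> 'w::euclidean_space"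
  assumes U: "open U" "smooth_on U F"
  shows "smooth_submanifold DIM('v) ((\<lambda>y. (y, F y)) ` U)"
  unfolding smooth_submanifold_def
proof
  fix q assume q: "q \<in> (\<lambda>y. (y, F y)) ` U"
  let ?V = "U \<times> (UNIV :: 'w set)" and ?L = "range (\<lambda>w::'v. (w, 0::'w))"
  let ?\<psi> = "\<lambda>q::'v \<times> 'w. (fst q, snd q - F (fst q))" and ?\<psi>' = "\<lambda>q::'v \<times> 'w. (fst q, snd q + F (fst q))"
  have V: "open ?V" using U by (simp add: open_Times)
  have fst: "smooth_on ?V (fst :: 'v \<times> 'w \<Rightarrow> 'v)" and snd: "smooth_on ?V (snd :: 'v \<times> 'w \<Rightarrow> 'w)"
    using smooth_on_linear[OF bounded_linear_fst V smooth_on_ident[OF V]]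
      smooth_on_linear[OF bounded_linear_snd V smooth_on_ident[OF V]] by auto
  have F: "smooth_on ?V (\<lambda>q. F (fst q))" by (rule smooth_on_compose[OF V U(1) _ fst U(2)]) auto
  have s: "smooth_on ?V ?\<psi>" "smooth_on ?V ?\<psi>'"
    by (intro smooth_on_Pair smooth_on_diff smooth_on_add V fst snd F)+
  have "homeomorphism ?V ?V ?\<psi> ?\<psi>'"
    using smooth_on_continuous[OF s(1)] smooth_on_continuous[OF s(2)]
    by (intro homeomorphismI) auto
  moreover have lin: "linear (\<lambda>w::'v. (w, 0::'w))" by (auto intro!: linearI)
  then have "subspace ?L" "dim ?L = DIM('v)"
    by (simp_all add: linear_subspace_image dim_image_eq inj_on_def)
  moreover have "?\<psi> ` ((\<lambda>y. (y, F y)) ` U \<inter> ?V) = ?L \<inter> ?V" by force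
  moreover have "q \<in> ?V" using q by auto
  ultimately show "\<exists>U' V \<psi> \<psi>' L. open U' \<and> q \<in> U' \<and> open V \<and> homeomorphism U' V \<psi> \<psi>' \<and>
      smooth_on U' \<psi> \<and> smooth_on V \<psi>' \<and> subspace (L :: ('v \<times> 'w) set) \<and> dim L = DIM('v) \<and>
      \<psi> ` ((\<lambda>y. (y, F y)) ` U \<inter> U') = L \<inter> V"
    using V s by blast
qed

section \<open>Graphs of homogeneous maps\<close>

text \<open>Since |(y, F y)|^2 = (1 + \<tau>^2) |y|^2, the equation for r places the points over |y|
  = r on the unit sphere. For Lawson-Osserman maps \<tau> = tan \<theta> and r = cos
  \<theta>.\<close>

locale conical_graph =
  fixes F :: "'v::euclidean_space \<Rightarrow> 'w::euclidean_space" and \<tau> r :: real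
  assumes smooth: "smooth_on (- {0}) F"
    and homogeneous: "t > 0 \<Longrightarrow> F (t *\<^sub>R y) = t *\<^sub>R F y"
    and norm_F: "norm (F y) = \<tau> * norm y"
    and r: "r > 0" "r\<^sup>2 * (1 + \<tau>\<^sup>2) = 1"
begin

abbreviation "D y \<equiv> frechet_derivative F (at y)"
abbreviation "graph_tangent y \<equiv> range (\<lambda>w. (w, D y w))"
abbreviation "graph_normal y \<equiv> {\<nu>. \<forall>w. \<nu> \<bullet> (w, D y w) = 0}"
abbreviation "slice \<equiv> (\<lambda>y. (y, F y)) ` sphere 0 r"
abbreviation "punctured_graph \<equiv> (\<lambda>y. (y, F y)) ` (- {0})"

lemma linear_D: "y \<noteq> 0 \<Longrightarrow> linear (D y)"
  using smooth_on_linear_derivative[OF smooth] by simp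

text \<open>Chain rule for G (t z). Used with c = t for F and with c = 1 for its derivative, which
  has degree 0.\<close>

lemma derivative_of_homogeneous:
  fixes G :: "'v \<Rightarrow> 'w"
  assumes G: "smooth_on (- {0}) G" and hom: "\<And>z. z \<noteq> 0 \<Longrightarrow> G (t *\<^sub>R z) = c *\<^sub>R G z"
    and "t > 0" "y \<noteq> 0"
  shows "t *\<^sub>R frechet_derivative G (at (t *\<^sub>R y)) w = c *\<^sub>R frechet_derivative G (at y) w"
proof -
  have 1: "(G has_derivative frechet_derivative G (at (t *\<^sub>R y))) (at (t *\<^sub>R y))"
    using smooth_on_has_derivative[OF G] assms by simp
  have s: "((\<lambda>z. t *\<^sub>R z) has_derivative (\<lambda>w. t *\<^sub>R w)) (at y)"
    by (auto intro!: derivative_eq_intros)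
  have 2: "((\<lambda>z. G (t *\<^sub>R z)) has_derivative (\<lambda>w. frechet_derivative G (at (t *\<^sub>R y)) (t *\<^sub>R w))) (at y)"
    by (rule has_derivative_compose[OF s 1])
  have "((\<lambda>z. c *\<^sub>R G z) has_derivative (\<lambda>w. c *\<^sub>R frechet_derivative G (at y) w)) (at y)"
    using smooth_on_has_derivative[OF G] assms by (auto intro!: derivative_eq_intros)
  then have "((\<lambda>z. G (t *\<^sub>R z)) has_derivative (\<lambda>w. c *\<^sub>R frechet_derivative G (at y) w)) (at y)"
    by (rule has_derivative_transform_within_open[where s = "- {0}"]) (use assms in auto)
  from fun_cong[OF has_derivative_unique[OF 2 this], of w] show ?thesis
    using linear_cmul[OF has_derivative_linear[OF 1]] by simp
qed

lemma D_scale: "t > 0 \<Longrightarrow> y \<noteq> 0 \<Longrightarrow> D (t *\<^sub>R y) = D y"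
  using derivative_of_homogeneous[OF smooth, where t = t and c = t and y = y] homogeneous
  by (intro ext) simp

text \<open>Euler's relation: the radial derivative is read off from the behaviour on the ray. It
  gives DF y = F y for F of degree 1, and D^2F(u, y) = 0 because DF is constant on rays.\<close>

lemma radial_derivative:
  fixes G :: "'v \<Rightarrow> 'w"
  assumes G: "smooth_on (- {0}) G" and y: "y \<noteq> 0"
    and h: "(h has_vector_derivative d) (at 1)" "\<And>t. t > 0 \<Longrightarrow> G (t *\<^sub>R y) = h t"
  shows "frechet_derivative G (at y) y = d"
proof -
  have "((\<lambda>t. t *\<^sub>R y) has_vector_derivative y) (at 1)"
    by (auto intro!: derivative_eq_intros)
  from smooth_on_chain_curve[OF G _ this]
  have "((\<lambda>t. G (t *\<^sub>R y)) has_vector_derivative frechet_derivative G (at y) y) (at 1)"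
    using y by simp
  moreover have "((\<lambda>t. G (t *\<^sub>R y)) has_vector_derivative d) (at 1)"
    by (rule has_vector_derivative_transform_within_open[OF h(1), of "{0<..}"]) (auto simp: h(2))
  ultimately show ?thesis by (rule vector_derivative_unique_at)
qed

lemma D_self: "y \<noteq> 0 \<Longrightarrow> D y y = F y"
  by (rule radial_derivative[OF smooth, of y "\<lambda>t. t *\<^sub>R F y"])
    (auto simp: homogeneous intro!: derivative_eq_intros)

lemma smooth_D: "smooth_on (- {0}) (\<lambda>z. D z b)"
  by (rule smooth_on_frechet_derivative[OF smooth])

lemma hess_scale:
  assumes "t > 0" "y \<noteq> 0"
  shows "hess F (t *\<^sub>R y) u w = (1 / t) *\<^sub>R hess F y u w"
proof -
  have "frechet_derivative (\<lambda>z. D z b) (at (t *\<^sub>R y)) w = (1 / t) *\<^sub>R frechet_derivative (\<lambda>z. D z b) (at y) w" for b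
  proof -
    have "frechet_derivative (\<lambda>z. D z b) (at y) w = t *\<^sub>R frechet_derivative (\<lambda>z. D z b) (at (t *\<^sub>R y)) w"
      using derivative_of_homogeneous[OF smooth_D[of b], where t = t and c = 1 and y = y and w = w] D_scale assms by simp
    then show ?thesis using \<open>t > 0\<close> by simp
  qed
  then show ?thesis by (simp add: hess_def scaleR_sum_right mult.commute)
qed

lemma hess_self:
  assumes "y \<noteq> 0"
  shows "hess F y u y = 0"
proof -
  have "frechet_derivative (\<lambda>z. D z b) (at y) y = 0" for b
    by (rule radial_derivative[OF smooth_D assms, of "\<lambda>t. D y b"]) (use D_scale assms in auto)
  then show ?thesis by (simp add: hess_def)
qed

lemma F_inner_D:
  assumes "y \<noteq> 0"
  shows "F y \<bullet> D y w = \<tau>\<^sup>2 * (y \<bullet> w)"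
proof -
  have D: "(F has_derivative D y) (at y)" using smooth_on_has_derivative[OF smooth] assms by simp
  have 1: "((\<lambda>z. F z \<bullet> F z) has_derivative (\<lambda>w. F y \<bullet> D y w + D y w \<bullet> F y)) (at y)"
    by (rule has_derivative_inner[OF D D])
  have eq: "(\<lambda>z. F z \<bullet> F z) = (\<lambda>z. \<tau>\<^sup>2 * (z \<bullet> z))"
    by (simp add: norm_F power_mult_distrib flip: power2_norm_eq_inner)
  have 2: "((\<lambda>z. \<tau>\<^sup>2 * (z \<bullet> z)) has_derivative (\<lambda>w. \<tau>\<^sup>2 * (y \<bullet> w + w \<bullet> y))) (at y)"
    by (auto intro!: derivative_eq_intros)
  have "F y \<bullet> D y w + D y w \<bullet> F y = \<tau>\<^sup>2 * (y \<bullet> w + w \<bullet> y)"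
    by (rule fun_cong[OF has_derivative_unique[OF 1[unfolded eq] 2]])
  then show ?thesis by (simp add: inner_commute)
qed

text \<open>\<open>F_inner_D\<close> is differentiated once more, along the line y + t w.\<close>

lemma F_inner_hess:
  assumes "y \<noteq> 0"
  shows "F y \<bullet> hess F y w w = \<tau>\<^sup>2 * (w \<bullet> w) - D y w \<bullet> D y w"
proof -
  let ?c = "\<lambda>t. y + t *\<^sub>R w"
  have c: "(?c has_vector_derivative w) (at 0)" by (auto intro!: derivative_eq_intros)
  have 1: "((\<lambda>t. F (?c t)) has_vector_derivative D y w) (at 0)"
    using smooth_on_chain_curve[OF smooth _ c] assms by simp
  have 2: "((\<lambda>t. D (?c t) w) has_vector_derivative hess F y w w) (at 0)"
    using derivative_along_curve[OF _ smooth _ c, of "\<lambda>t. w" 0] assms linear_0[OF linear_D[OF assms]]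
    by (simp add: open_Compl)
  have 3: "((\<lambda>t. F (?c t) \<bullet> D (?c t) w) has_vector_derivative F y \<bullet> hess F y w w + D y w \<bullet> D y w) (at 0)"
    using bounded_bilinear.has_vector_derivative[OF bounded_bilinear_inner 1 2] by simp
  have 4: "((\<lambda>t. \<tau>\<^sup>2 * (?c t \<bullet> w)) has_vector_derivative \<tau>\<^sup>2 * (w \<bullet> w)) (at 0)"
    by (auto intro!: derivative_eq_intros simp: has_vector_derivative_def inner_add_left)
  have "open (?c -` (- {0}))" by (intro open_vimage continuous_intros)
  then have "((\<lambda>t. \<tau>\<^sup>2 * (?c t \<bullet> w)) has_vector_derivative F y \<bullet> hess F y w w + D y w \<bullet> D y w) (at 0)"
    by (rule has_vector_derivative_transform_within_open[OF 3]) (use assms F_inner_D in auto)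
  from vector_derivative_unique_at[OF this 4] show ?thesis by simp
qed

section \<open>The part of the graph in the unit sphere\<close>

lemma slice_norm:
  assumes "norm y = r"
  shows "norm (y, F y) = 1" "y \<noteq> 0"
proof -
  show "y \<noteq> 0" using assms r by auto
  have "(norm (y, F y))\<^sup>2 = 1" using r(2) assms by (simp add: norm_Pair norm_F power_mult_distrib algebra_simps)
  then show "norm (y, F y) = 1" by (metis norm_ge_zero one_power2 power2_eq_imp_eq zero_le_one)
qed

lemma slice_tangent_space:
  assumes y: "norm y = r"
  shows "tangent_space slice (y, F y) = (\<lambda>w. (w, D y w)) ` {w. w \<bullet> y = 0}"
proof
  note y0 = slice_norm(2)[OF y]
  show "tangent_space slice (y, F y) \<subseteq> (\<lambda>w. (w, D y w)) ` {w. w \<bullet> y = 0}"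
  proof
    fix v assume "v \<in> tangent_space slice (y, F y)"
    then obtain \<gamma> where \<gamma>: "curve_at slice (y, F y) \<gamma>" "v = velocity \<gamma>"
      by (auto simp: tangent_space_def)
    have "velocity \<gamma> = (fst (velocity \<gamma>), D y (fst (velocity \<gamma>)))"
      by (rule curve_in_graph(1)[OF _ smooth _ _ \<gamma>(1)]) (use y0 in auto)
    moreover have "fst (velocity \<gamma>) \<bullet> fst (y, F y) = 0"
      by (rule tangent_orthogonal_radius[OF \<gamma>(1) _ bounded_linear_fst, where c = "r\<^sup>2"])
        (auto simp: power2_norm_eq_inner[symmetric])
    ultimately show "v \<in> (\<lambda>w. (w, D y w)) ` {w. w \<bullet> y = 0}" unfolding \<gamma>(2) by auto
  qed
  show "(\<lambda>w. (w, D y w)) ` {w. w \<bullet> y = 0} \<subseteq> tangent_space slice (y, F y)"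
  proof safe
    fix w assume "w \<bullet> y = 0"
    then obtain c where c: "c 0 = y" "smooth_on (UNIV :: real set) c" "\<And>t. norm (c t) = norm y"
      "(c has_vector_derivative w) (at 0)" using normalized_line[of y w] y0 by blast
    have "c t \<noteq> 0" for t using c(3)[of t] y0 by auto
    then have "(w, frechet_derivative F (at (c 0)) w) \<in> tangent_space slice (c 0, F (c 0))"
      using c y by (intro graph_curve_tangent[OF _ smooth, of UNIV]) auto
    then show "(w, D y w) \<in> tangent_space slice (y, F y)" by (simp add: c(1))
  qed
qed

text \<open>Tangency to the unit sphere at (y, F y) is orthogonality to (y, F y) = (y, DF y), the
  only tangent direction of the graph that the slice lacks. Splitting off the radial part of w gives
  one inclusion, taking w = y the other.\<close>

lemma slice_normal_plane:
  assumes y: "norm y = r"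
  shows "normal_plane slice (sphere 0 1) (y, F y) = graph_normal y"
proof -
  note y0 = slice_norm(2)[OF y]
  have "\<nu> \<bullet> (w, D y w) = 0"
    if "\<nu> \<bullet> (y, F y) = 0" "\<And>w. w \<bullet> y = 0 \<Longrightarrow> \<nu> \<bullet> (w, D y w) = 0" for \<nu> w
  proof -
    define c where "c = (w \<bullet> y) / (y \<bullet> y)"
    have "(w - c *\<^sub>R y) \<bullet> y = 0" using y0 by (simp add: c_def inner_diff_left)
    then have "\<nu> \<bullet> (w - c *\<^sub>R y, D y (w - c *\<^sub>R y)) = 0" by (rule that(2))
    moreover have "(w - c *\<^sub>R y, D y (w - c *\<^sub>R y)) = (w, D y w) - c *\<^sub>R (y, F y)"
      using linear_D[OF y0] by (simp add: linear_diff linear_cmul D_self[OF y0])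
    ultimately have "\<nu> \<bullet> ((w, D y w) - c *\<^sub>R (y, F y)) = 0" by (simp only:)
    then show ?thesis unfolding inner_diff_right inner_scaleR_right that(1) by simp
  qed
  moreover have "\<nu> \<bullet> (y, F y) = 0" if "\<forall>w. \<nu> \<bullet> (w, D y w) = 0" for \<nu>
    using that[rule_format, of y] by (simp add: D_self[OF y0])
  ultimately show ?thesis
    unfolding normal_plane_def slice_tangent_space[OF y] tangent_space_sphere[OF slice_norm(1)[OF y]]
    by blast
qed

section \<open>The cone without its apex, and its mean curvature\<close>

lemma cone_tangent_space:
  assumes "y \<noteq> 0" "\<And>y z. y \<noteq> 0 \<Longrightarrow> (y, z) \<in> C \<longleftrightarrow> z = F y"
  shows "tangent_space C (y, F y) = graph_tangent y"
  by (rule graph_tangent_space[OF _ smooth]) (use assms in auto)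

lemma cone_normal_plane:
  assumes "y \<noteq> 0"
  shows "normal_plane punctured_graph UNIV (y, F y) = graph_normal y"
proof -
  have "tangent_space punctured_graph (y, F y) = graph_tangent y"
    by (rule cone_tangent_space[OF assms]) auto
  then show ?thesis by (auto simp: normal_plane_def tangent_space_UNIV)
qed

text \<open>The second fundamental form in polarized form. \<open>second_fundamental_form\<close>
  has diagonal values only, each through a chosen curve, whereas comparing traces over different
  bases needs a bilinear map. The same expression serves slice and cone.\<close>

definition mean_curvature_term :: "'v \<Rightarrow> 'v \<times> 'w \<Rightarrow> 'v \<times> 'w \<Rightarrow> 'v \<times> 'w" where
  "mean_curvature_term y u v = orth_proj (graph_normal y) (0, hess F y (fst u) (fst v))"

lemma bilinear_mean_curvature_term:
  assumes "y \<noteq> 0"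
  shows "bilinear (mean_curvature_term y)"
proof -
  have "linear (orth_proj (graph_normal y))"
    by (rule linear_orth_proj[OF graph_normal_dim(1)[OF linear_D[OF assms]]])
  moreover have "linear (\<lambda>z. (0::'v, z::'w))" by (auto intro!: linearI)
  ultimately have L: "linear (\<lambda>z. orth_proj (graph_normal y) (0, z))"
    using linear_compose[of "\<lambda>z. (0, z)" "orth_proj (graph_normal y)"] by (simp add: comp_def)
  have "bilinear (hess F y)" using bilinear_hess[OF smooth] assms by simp
  then have "linear (hess F y u)" "linear (\<lambda>u. hess F y u v)" for u v by (auto simp: bilinear_def)
  moreover have "linear (\<lambda>v::'v \<times> 'w. orth_proj (graph_normal y) (0, g (fst v)))" if "linear g" for g
    using linear_compose[OF linear_compose[OF linear_fst that] L] by (simp add: comp_def)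
  ultimately show ?thesis unfolding bilinear_def mean_curvature_term_def by blast
qed

lemma slice_second_fundamental_form:
  assumes y: "norm y = r" and v: "v \<in> tangent_space slice (y, F y)"
  shows "second_fundamental_form slice (sphere 0 1) (y, F y) v = mean_curvature_term y v v"
proof -
  have "second_fundamental_form slice (sphere 0 1) (y, F y) v
    = orth_proj (normal_plane slice (sphere 0 1) (y, F y)) (0, hess F y (fst v) (fst v))"
    by (rule graph_second_fundamental_form[OF _ smooth _ _ slice_normal_plane[OF y] v])
      (use slice_norm(2)[OF y] in auto)
  then show ?thesis by (simp only: mean_curvature_term_def slice_normal_plane[OF y])
qed

lemma slice_mean_curvature:
  assumes min: "minimal_submanifold n slice (sphere 0 1)" and y: "norm y = r"
    and E: "orthonormal_basis E ((\<lambda>w. (w, D y w)) ` {w. w \<bullet> y = 0})"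
  shows "(\<Sum>e\<in>E. mean_curvature_term y e e) = 0"
proof -
  have "(\<Sum>e\<in>E. second_fundamental_form slice (sphere 0 1) (y, F y) e) = 0"
    using min E y unfolding minimal_submanifold_def slice_tangent_space[OF y, symmetric]
    by (metis (mono_tags, lifting) imageI mem_sphere_0)
  moreover have "second_fundamental_form slice (sphere 0 1) (y, F y) e = mean_curvature_term y e e" if "e \<in> E" for e
    using orthonormal_basis_mem[OF E that] slice_tangent_space[OF y]
    by (intro slice_second_fundamental_form[OF y]) simp
  ultimately show ?thesis by simp
qed

lemma slice_subspace:
  assumes "y \<noteq> 0"
  shows "subspace ((\<lambda>w. (w, D y w)) ` {w. w \<bullet> y = 0})"
proof (rule linear_subspace_image)
  show "linear (\<lambda>w. (w, D y w))"
    using linear_D[OF assms] by (auto intro!: linearI simp: linear_add linear_cmul)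
  show "subspace {w. w \<bullet> y = 0}" by (auto simp: subspace_def inner_add_left)
qed

text \<open>The trace is independent of the basis, so E is exchanged for the unit vector (y, F y)
  together with a basis of the tangent space of the slice, to which it is orthogonal by
  \<open>F_inner_D\<close>.\<close>

lemma cone_mean_curvature:
  assumes min: "minimal_submanifold n slice (sphere 0 1)" and y: "norm y = r"
    and E: "orthonormal_basis E (graph_tangent y)"
  shows "(\<Sum>e\<in>E. mean_curvature_term y e e) = 0"
proof -
  note y0 = slice_norm(2)[OF y] and q1 = slice_norm(1)[OF y]
  let ?T = "(\<lambda>w. (w, D y w)) ` {w. w \<bullet> y = 0}" and ?q = "(y, F y)"
  obtain E' where E': "orthonormal_basis E' ?T"
    using orthonormal_basis_exists[OF slice_subspace[OF y0]] by blast
  have q: "orthonormal_basis {?q} (span {?q})" using q1 by (simp add: orthonormal_basis_def)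
  have perp: "u \<bullet> v = 0" if "u \<in> span {?q}" "v \<in> ?T" for u v
  proof -
    obtain c w where "u = c *\<^sub>R ?q" "v = (w, D y w)" "w \<bullet> y = 0"
      using \<open>u \<in> span {?q}\<close> \<open>v \<in> ?T\<close> by (auto simp: span_singleton)
    then show ?thesis using F_inner_D[OF y0, of w] by (simp add: inner_commute)
  qed
  have sum: "graph_tangent y = {u + v | u v. u \<in> span {?q} \<and> v \<in> ?T}"
  proof -
    note L = linear_D[OF y0]
    have "\<exists>u v. (w, D y w) = u + v \<and> u \<in> span {?q} \<and> v \<in> ?T" for w
    proof -
      define c where "c = (w \<bullet> y) / (y \<bullet> y)"
      have "(w - c *\<^sub>R y) \<bullet> y = 0" using y0 by (simp add: c_def inner_diff_left)
      moreover have "(w, D y w) = c *\<^sub>R ?q + (w - c *\<^sub>R y, D y (w - c *\<^sub>R y))"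
        using L by (simp add: linear_diff linear_cmul D_self[OF y0])
      ultimately show ?thesis by (fastforce simp: span_singleton)
    qed
    moreover have "c *\<^sub>R ?q + (w, D y w) \<in> graph_tangent y" for c w
    proof -
      have "c *\<^sub>R ?q + (w, D y w) = (c *\<^sub>R y + w, D y (c *\<^sub>R y + w))"
        using L by (simp add: linear_add linear_cmul D_self[OF y0])
      then show ?thesis by (rule range_eqI)
    qed
    ultimately show ?thesis by (auto simp: span_singleton)
  qed
  note U = orthonormal_basis_Un[OF q E' perp sum]
  have "(\<Sum>e\<in>E. mean_curvature_term y e e) = (\<Sum>e\<in>{?q} \<union> E'. mean_curvature_term y e e)"
    by (rule trace_orthonormal_basis[OF E U(1) bilinear_mean_curvature_term[OF y0]])
  also have "\<dots> = mean_curvature_term y ?q ?q + (\<Sum>e\<in>E'. mean_curvature_term y e e)"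
    using U(2) orthonormal_basis_finite[OF E'] by simp
  also have "mean_curvature_term y ?q ?q = 0"
    unfolding mean_curvature_term_def using hess_self[OF y0, of y]
      linear_0[OF linear_orth_proj[OF graph_normal_dim(1)[OF linear_D[OF y0]]]]
    by (simp add: zero_prod_def)
  also have "(\<Sum>e\<in>E'. mean_curvature_term y e e) = 0"
    by (rule slice_mean_curvature[OF min y E'])
  finally show ?thesis by simp
qed

lemma minimal_cone:
  assumes min: "minimal_submanifold n slice (sphere 0 1)"
  shows "minimal_submanifold DIM('v) punctured_graph UNIV"
  unfolding minimal_submanifold_def
proof (intro conjI ballI allI impI)
  show "smooth_submanifold DIM('v) punctured_graph"
    by (rule graph_smooth_submanifold[OF _ smooth]) auto
next
  fix q E assume q: "q \<in> punctured_graph" and E: "orthonormal_basis E (tangent_space punctured_graph q)"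
  then obtain y where y: "y \<noteq> 0" "q = (y, F y)" by auto
  have T: "tangent_space punctured_graph (y, F y) = graph_tangent y"
    by (rule cone_tangent_space[OF y(1)]) auto
  \<comment> \<open>y' is the point of the same ray with |y'| = r, where minimality of the slice
    applies. DF is the same at both points, so E is a basis of the tangent space there as
    well.\<close>
  define t where "t = norm y / r"
  define y' where "y' = y /\<^sub>R t"
  have t: "t > 0" using y r by (simp add: t_def)
  have y': "norm y' = r" "y = t *\<^sub>R y'" "y' \<noteq> 0" using y r by (auto simp: y'_def t_def)
  have D: "D y = D y'" using D_scale[OF t y'(3)] y'(2) by simp
  have "second_fundamental_form punctured_graph UNIV q e = (1 / t) *\<^sub>R mean_curvature_term y' e e"
    if "e \<in> E" for e
  proof -
    have e: "e \<in> tangent_space punctured_graph (y, F y)"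
      using orthonormal_basis_mem[OF E that] y by simp
    have "second_fundamental_form punctured_graph UNIV (y, F y) e
      = orth_proj (normal_plane punctured_graph UNIV (y, F y)) (0, hess F y (fst e) (fst e))"
      by (rule graph_second_fundamental_form[OF _ smooth _ _ cone_normal_plane[OF y(1)] e]) (use y in auto)
    also have "\<dots> = orth_proj (graph_normal y') ((1 / t) *\<^sub>R (0, hess F y' (fst e) (fst e)))"
      using hess_scale[OF t y'(3)] by (simp add: cone_normal_plane[OF y(1)] D y'(2)[symmetric])
    also have "\<dots> = (1 / t) *\<^sub>R mean_curvature_term y' e e"
      unfolding mean_curvature_term_def
      by (rule linear_cmul[OF linear_orth_proj[OF graph_normal_dim(1)[OF linear_D[OF y'(3)]]]])
    finally show ?thesis using y by simp
  qed
  then have "(\<Sum>e\<in>E. second_fundamental_form punctured_graph UNIV q e)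
      = (1 / t) *\<^sub>R (\<Sum>e\<in>E. mean_curvature_term y' e e)"
    by (simp add: scaleR_sum_right)
  also have "(\<Sum>e\<in>E. mean_curvature_term y' e e) = 0"
    using E by (intro cone_mean_curvature[OF min y'(1)]) (simp add: y(2) T D)
  finally show "(\<Sum>e\<in>E. second_fundamental_form punctured_graph UNIV q e) = 0" by simp
qed simp

end

section \<open>Lawson-Osserman maps\<close>

lemma spherical_harmonic_extension:
  fixes f :: "'v::euclidean_space \<Rightarrow> 'w::euclidean_space"
  assumes "\<And>b. b \<in> Basis \<Longrightarrow> spherical_harmonic k (\<lambda>x. f x \<bullet> b)"
  obtains P where "smooth_on UNIV P" "\<And>c x. P (c *\<^sub>R x) = c ^ k *\<^sub>R P x"
    "\<And>b x. b \<in> Basis \<Longrightarrow> laplacian (\<lambda>y. P y \<bullet> b) x = 0" "\<And>x. norm x = 1 \<Longrightarrow> f x = P x"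
proof -
  have "\<forall>b\<in>Basis. \<exists>q. real_polynomial_function q \<and> (\<forall>c x. q (c *\<^sub>R x) = c ^ k * q x) \<and>
      (\<forall>x. laplacian q x = 0) \<and> (\<forall>x\<in>sphere 0 1. f x \<bullet> b = q x)"
    using assms unfolding spherical_harmonic_def by blast
  from bchoice[OF this] obtain q where q0: "\<forall>b\<in>Basis. real_polynomial_function (q b) \<and>
      (\<forall>c x. q b (c *\<^sub>R x) = c ^ k * q b x) \<and>
      (\<forall>x. laplacian (q b) x = 0) \<and> (\<forall>x\<in>sphere 0 1. f x \<bullet> b = q b x)" by blast
  have q: "real_polynomial_function (q b)" "q b (c *\<^sub>R x) = c ^ k * q b x" "laplacian (q b) x = 0"
    "norm x = 1 \<Longrightarrow> f x \<bullet> b = q b x" if "b \<in> Basis" for b c x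
    using bspec[OF q0 that] by auto
  define P where "P = (\<lambda>y. \<Sum>b\<in>Basis. q b y *\<^sub>R b)"
  have Pb: "P y \<bullet> b = q b y" if "b \<in> Basis" for y b
    using that by (simp add: P_def)
  show ?thesis
  proof
    show "smooth_on UNIV P" unfolding P_def
      by (intro smooth_on_sum smooth_on_scaleR smooth_on_const smooth_on_real_polynomial_function q) auto
    show "P (c *\<^sub>R x) = c ^ k *\<^sub>R P x" for c x
      by (simp add: P_def q(2) scaleR_sum_right)
    show "laplacian (\<lambda>y. P y \<bullet> b) x = 0" if "b \<in> Basis" for b x
      using q(3)[OF that] by (simp add: Pb[OF that])
    show "f x = P x" if "norm x = 1" for x
      by (rule euclidean_eqI) (simp add: Pb q(4) that)
  qed
qed

lemma orthonormal_basis_Basis: "orthonormal_basis Basis (UNIV :: 'v::euclidean_space set)"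
  by (auto simp: orthonormal_basis_def pairwise_def orthogonal_def inner_not_same_Basis)

text \<open>P is the homogeneous harmonic extension of f and s its nonzero singular value. The
  values of s and \<theta> are not prescribed; they follow from harmonicity and minimality.\<close>

locale lawson_osserman =
  fixes f P :: "'v::euclidean_space \<Rightarrow> 'w::euclidean_space" and n p k :: nat and s \<theta> :: real
  assumes dim: "DIM('v) = n + 1"
    and f_unit: "norm x = 1 \<Longrightarrow> norm (f x) = 1"
    and mult: "norm x = 1 \<Longrightarrow> \<sigma> > 0 \<Longrightarrow> sphere_singular_mult f x \<sigma> = (if \<sigma> = s then p else 0)"
    and s: "s > 0" and p: "p \<ge> 1" and k: "k \<ge> 2"
    and P_smooth: "smooth_on UNIV P" and P_homogeneous: "P (c *\<^sub>R x) = c ^ k *\<^sub>R P x"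
    and P_harmonic: "b \<in> Basis \<Longrightarrow> laplacian (\<lambda>y. P y \<bullet> b) x = 0"
    and f_P: "norm x = 1 \<Longrightarrow> f x = P x"
    and \<theta>: "0 < \<theta>" "\<theta> < pi / 2"
    and minimal: "minimal_submanifold n (LO_sphere f \<theta>) (sphere 0 1)"
begin

lemma trig: "cos \<theta> > 0" "sin \<theta> > 0" "tan \<theta> > 0" "tan \<theta> * cos \<theta> = sin \<theta>"
  "(cos \<theta>)\<^sup>2 * (1 + (tan \<theta>)\<^sup>2) = 1"
proof -
  show c: "cos \<theta> > 0" using \<theta> by (intro cos_gt_zero) auto
  show "sin \<theta> > 0" using \<theta> by (intro sin_gt_zero) auto
  show "tan \<theta> > 0" using \<theta> by (intro tan_gt_zero) auto
  show "tan \<theta> * cos \<theta> = sin \<theta>" using c by (simp add: tan_def)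
  show "(cos \<theta>)\<^sup>2 * (1 + (tan \<theta>)\<^sup>2) = 1"
    using c by (simp add: tan_def power_divide field_simps)
qed

text \<open>The extension of degree 0, which is what \<open>sphere_differential\<close>
  differentiates. Off the origin it equals |y|^(-k) P y and is therefore smooth.\<close>

definition radial_f :: "'v \<Rightarrow> 'w" where
  "radial_f y = f (y /\<^sub>R norm y)"

lemma radial_f_P: "y \<noteq> 0 \<Longrightarrow> radial_f y = inverse (norm y) ^ k *\<^sub>R P y"
  unfolding radial_f_def by (subst f_P) (auto simp: P_homogeneous)

lemma smooth_radial_f: "smooth_on (- {0}) radial_f"
proof -
  have "smooth_on (- {0}) (\<lambda>y. inverse (norm y) ^ k *\<^sub>R P y)"
    by (intro smooth_on_scaleR smooth_on_power smooth_on_inverse_norm smooth_on_subset[OF P_smooth]) auto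
  then show ?thesis by (rule smooth_on_cong[rotated 2]) (auto simp: radial_f_P)
qed

lemma radial_f_scale:
  assumes "t > 0" shows "radial_f (t *\<^sub>R y) = radial_f y"
proof -
  have eq: "inverse t * inverse (norm y) * t = inverse (norm y)" using assms by (simp add: field_simps)
  show ?thesis using assms by (simp add: radial_f_def eq)
qed

lemma norm_radial_f: "y \<noteq> 0 \<Longrightarrow> norm (radial_f y) = 1"
  unfolding radial_f_def by (rule f_unit) simp

lemma LO_fun_radial: "LO_fun f \<theta> y = (tan \<theta> * norm y) *\<^sub>R radial_f y"
  by (simp add: LO_fun_def radial_f_def)

lemma smooth_LO_fun: "smooth_on (- {0}) (LO_fun f \<theta>)"
proof -
  \<comment> \<open>Here |y| is rewritten as |y|^2 times 1/|y|, a polynomial times a function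
    already known to be smooth off the origin.\<close>
  have "smooth_on (- {0}) (\<lambda>y. (tan \<theta> * ((y \<bullet> y) * inverse (norm y))) *\<^sub>R radial_f y)"
    by (intro smooth_on_scaleR smooth_on_mult smooth_on_inner smooth_on_const smooth_on_ident
        smooth_on_inverse_norm smooth_radial_f) auto
  then show ?thesis
    by (rule smooth_on_cong[rotated 2])
      (auto simp: LO_fun_radial power2_norm_eq_inner[symmetric] power2_eq_square)
qed

sublocale conical_graph "LO_fun f \<theta>" "tan \<theta>" "cos \<theta>"
proof
  show "LO_fun f \<theta> (t *\<^sub>R y) = t *\<^sub>R LO_fun f \<theta> y" if "t > 0" for t y
    using that by (simp add: LO_fun_radial radial_f_scale)
  show "norm (LO_fun f \<theta> y) = tan \<theta> * norm y" for y
    using trig(3) norm_radial_f[of y] by (cases "y = 0") (auto simp: LO_fun_radial abs_mult)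
qed (use smooth_LO_fun trig in auto)

lemma LO_sphere_slice: "LO_sphere f \<theta> = slice"
proof -
  have eq: "(cos \<theta> *\<^sub>R x, LO_fun f \<theta> (cos \<theta> *\<^sub>R x)) = (cos \<theta> *\<^sub>R x, sin \<theta> *\<^sub>R f x)" if "norm x = 1" for x
    using trig that by (simp add: LO_fun_radial radial_f_scale) (simp add: radial_f_def)
  have "sphere (0::'v) (cos \<theta>) = (\<lambda>x. cos \<theta> *\<^sub>R x) ` sphere 0 1"
    using trig(1) by (simp add: sphere_scale)
  then have "slice = (\<lambda>x. (cos \<theta> *\<^sub>R x, LO_fun f \<theta> (cos \<theta> *\<^sub>R x))) ` sphere 0 1"
    by (simp add: image_image)
  also have "\<dots> = LO_sphere f \<theta>" unfolding LO_sphere_def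
    by (intro image_cong refl) (use eq in auto)
  finally show ?thesis by simp
qed

text \<open>Along a curve in the unit sphere \<open>radial_f\<close>, P and F / tan \<theta>
  coincide, so their tangential derivatives do too.\<close>

lemma derivative_tangential:
  assumes x: "norm x = 1" and w: "w \<bullet> x = 0"
  shows "sphere_differential f x w = frechet_derivative P (at x) w"
    and "D x w = tan \<theta> *\<^sub>R frechet_derivative P (at x) w"
proof -
  have x0: "x \<noteq> 0" using x by auto
  obtain c where c: "c 0 = x" "smooth_on (UNIV :: real set) c" "\<And>t. norm (c t) = norm x"
    "(c has_vector_derivative w) (at 0)" using normalized_line[OF x0 w] by blast
  have n: "norm (c t) = 1" for t using c(3) x by simp
  then have n0: "c t \<noteq> 0" for t by (metis norm_zero zero_neq_one)
  have e: "radial_f (c t) = P (c t)" "LO_fun f \<theta> (c t) = tan \<theta> *\<^sub>R P (c t)" for t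
    using radial_f_P[OF n0, of t] n by (auto simp: LO_fun_radial)
  have d: "((\<lambda>t. P (c t)) has_vector_derivative frechet_derivative P (at x) w) (at 0)"
    using smooth_on_chain_curve[OF P_smooth _ c(4)] c(1) by simp
  have d1: "((\<lambda>t. radial_f (c t)) has_vector_derivative frechet_derivative radial_f (at x) w) (at 0)"
    using smooth_on_chain_curve[OF smooth_radial_f _ c(4)] c(1) x0 by simp
  have "frechet_derivative radial_f (at x) w = frechet_derivative P (at x) w"
    using vector_derivative_unique_at[OF d1[unfolded e] d] .
  then show "sphere_differential f x w = frechet_derivative P (at x) w"
    by (simp add: sphere_differential_def radial_f_def[abs_def])
  have d2: "((\<lambda>t. LO_fun f \<theta> (c t)) has_vector_derivative D x w) (at 0)"
    using smooth_on_chain_curve[OF smooth_LO_fun _ c(4)] c(1) x0 by simp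
  have "((\<lambda>t. tan \<theta> *\<^sub>R P (c t)) has_vector_derivative tan \<theta> *\<^sub>R frechet_derivative P (at x) w) (at 0)"
    using bounded_linear.has_vector_derivative[OF bounded_linear_scaleR_right d] .
  from vector_derivative_unique_at[OF d2[unfolded e] this]
  show "D x w = tan \<theta> *\<^sub>R frechet_derivative P (at x) w" .
qed

lemma linear_DP: "linear (frechet_derivative P (at x))"
  by (rule smooth_on_linear_derivative[OF P_smooth UNIV_I])

lemma linear_sphere_differential:
  assumes "norm x = 1" shows "linear (sphere_differential f x)"
proof -
  have "x \<noteq> 0" using assms by auto
  then show ?thesis
    using smooth_on_linear_derivative[OF smooth_radial_f, of x]
    by (simp add: sphere_differential_def radial_f_def[abs_def])
qed

text \<open>A carries the singular value s, B the kernel, and x the radial direction; the size of B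
  comes from counting dimensions. The derivative of P stands in for the differential of f, with
  which it agrees on tangent vectors.\<close>

lemma singular_basis:
  assumes x: "norm x = 1"
  obtains A B where "orthonormal_basis (A \<union> B) {v. v \<bullet> x = 0}" "A \<inter> B = {}" "card A = p" "p + card B = n"
    "orthonormal_basis (insert x (A \<union> B)) UNIV" "x \<notin> A \<union> B"
    "\<And>b c. b \<in> A \<union> B \<Longrightarrow> c \<in> A \<union> B \<Longrightarrow>
      frechet_derivative P (at x) b \<bullet> frechet_derivative P (at x) c = (if b \<in> A then s\<^sup>2 else 0) * (b \<bullet> c)"
proof -
  let ?T = "{v. v \<bullet> x = 0}"
  have T: "subspace ?T" by (auto simp: subspace_def inner_add_left)
  obtain A B where AB: "orthonormal_basis (A \<union> B) ?T" "A \<inter> B = {}" "card A = p"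
    and a: "\<And>a w. a \<in> A \<Longrightarrow> w \<in> ?T \<Longrightarrow>
      sphere_differential f x a \<bullet> sphere_differential f x w = s\<^sup>2 * (a \<bullet> w)"
    and b: "\<And>b. b \<in> B \<Longrightarrow> sphere_differential f x b = 0"
  proof (rule singular_value_decomposition[OF T linear_sphere_differential[OF x] s])
    show "singular_value_mult ?T (sphere_differential f x) \<sigma> = (if \<sigma> = s then p else 0)" if "\<sigma> > 0" for \<sigma>
      using mult[OF x that] by (simp add: sphere_singular_mult_def tangent_space_sphere[OF x])
  qed blast
  have fin: "finite A" "finite B" using orthonormal_basis_finite[OF AB(1)] by auto
  have q: "orthonormal_basis {x} (span {x})" using x by (simp add: orthonormal_basis_def)
  have perp: "u \<bullet> v = 0" if "u \<in> span {x}" "v \<in> ?T" for u v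
    using that by (auto simp: span_singleton inner_commute)
  have sum: "UNIV = {u + v | u v. u \<in> span {x} \<and> v \<in> ?T}"
  proof -
    have "\<exists>u v. w = u + v \<and> u \<in> span {x} \<and> v \<in> ?T" for w
      using x by (intro exI[of _ "(w \<bullet> x) *\<^sub>R x"] exI[of _ "w - (w \<bullet> x) *\<^sub>R x"])
        (auto simp: span_singleton inner_diff_left norm_eq_1)
    then show ?thesis by blast
  qed
  note U = orthonormal_basis_Un[OF q AB(1) perp sum]
  have mem: "v \<in> ?T" if "v \<in> A \<union> B" for v using orthonormal_basis_mem[OF AB(1) that] .
  show ?thesis
  proof
    show "orthonormal_basis (A \<union> B) ?T" "A \<inter> B = {}" "card A = p" by fact+
    show "orthonormal_basis (insert x (A \<union> B)) UNIV" "x \<notin> A \<union> B" using U by auto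
    then have "card (insert x (A \<union> B)) = n + 1" using orthonormal_basis_card dim by fastforce
    then show "p + card B = n"
      using \<open>x \<notin> A \<union> B\<close> fin AB by (simp add: card_Un_disjoint)
    fix b c assume bc: "b \<in> A \<union> B" "c \<in> A \<union> B"
    have "sphere_differential f x b \<bullet> sphere_differential f x c = (if b \<in> A then s\<^sup>2 else 0) * (b \<bullet> c)"
      using a[of b c] b[of b] mem bc by auto
    then show "frechet_derivative P (at x) b \<bullet> frechet_derivative P (at x) c = (if b \<in> A then s\<^sup>2 else 0) * (b \<bullet> c)"
      using derivative_tangential(1)[OF x] mem bc by auto
  qed
qed

section \<open>Energy of the harmonic extension\<close>

lemma P_inner_self: "P y \<bullet> P y = (y \<bullet> y) ^ k"
proof (cases "y = 0")
  case True
  then show ?thesis using P_homogeneous[of 0 0] k by (simp add: power_0_left)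
next
  case False
  define u where "u = y /\<^sub>R norm y"
  have u: "norm u = 1" "y = norm y *\<^sub>R u" using False by (auto simp: u_def)
  have "norm (P y) = norm (norm y ^ k *\<^sub>R P u)"
    by (subst u(2)) (simp only: P_homogeneous)
  also have "\<dots> = norm y ^ k" using f_P[OF u(1)] f_unit[OF u(1)] by (simp add: power_abs)
  finally show ?thesis by (simp add: power_mult[symmetric] mult.commute flip: power2_norm_eq_inner)
qed

lemma P_inner_DP: "P y \<bullet> frechet_derivative P (at y) w = real k * (y \<bullet> y) ^ (k - 1) * (y \<bullet> w)"
proof -
  have D: "(P has_derivative frechet_derivative P (at y)) (at y)"
    using smooth_on_has_derivative[OF P_smooth] by simp
  have 1: "((\<lambda>z. P z \<bullet> P z) has_derivative (\<lambda>w. P y \<bullet> frechet_derivative P (at y) w + frechet_derivative P (at y) w \<bullet> P y)) (at y)"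
    by (rule has_derivative_inner[OF D D])
  have eq: "(\<lambda>z. P z \<bullet> P z) = (\<lambda>z. (z \<bullet> z) ^ k)" by (simp add: P_inner_self)
  have 2: "((\<lambda>z. (z \<bullet> z) ^ k) has_derivative (\<lambda>w. of_nat k * (y \<bullet> w + w \<bullet> y) * (y \<bullet> y) ^ (k - 1))) (at y)"
    by (rule has_derivative_power) (auto intro!: derivative_eq_intros)
  have "P y \<bullet> frechet_derivative P (at y) w + frechet_derivative P (at y) w \<bullet> P y
      = of_nat k * (y \<bullet> w + w \<bullet> y) * (y \<bullet> y) ^ (k - 1)"
    by (rule fun_cong[OF has_derivative_unique[OF 1[unfolded eq] 2]])
  then show ?thesis by (simp add: inner_commute)
qed

lemma hess_P_trace: "(\<Sum>b\<in>Basis. hess P x b b) = 0"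
proof (rule euclidean_eqI)
  fix e :: 'w assume e: "e \<in> Basis"
  have d: "frechet_derivative (\<lambda>z. G z \<bullet> e) (at y) w = frechet_derivative G (at y) w \<bullet> e"
    if "smooth_on UNIV G" for G :: "'v \<Rightarrow> 'w" and y w
  proof -
    have "((\<lambda>z. G z \<bullet> e) has_derivative (\<lambda>w. frechet_derivative G (at y) w \<bullet> e)) (at y)"
      by (rule bounded_linear.has_derivative[OF bounded_linear_inner_left smooth_on_has_derivative[OF that UNIV_I]])
    from frechet_derivative_at[OF this] show ?thesis by (simp add: fun_eq_iff)
  qed
  have h: "hess P x b b = frechet_derivative (\<lambda>z. frechet_derivative P (at z) b) (at x) b" if "b \<in> Basis" for b
    using that by (simp add: hess_def inner_Basis if_distrib[where f = "\<lambda>x. x *\<^sub>R _"] cong: if_cong)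
  have "(\<Sum>b\<in>Basis. hess P x b b) \<bullet> e = (\<Sum>b\<in>Basis. frechet_derivative (\<lambda>z. frechet_derivative P (at z) b) (at x) b \<bullet> e)"
    using h by (simp add: inner_sum_left)
  also have "\<dots> = laplacian (\<lambda>y. P y \<bullet> e) x"
    unfolding laplacian_def d[OF P_smooth] d[OF smooth_on_frechet_derivative[OF P_smooth]] ..
  also have "\<dots> = 0" by (rule P_harmonic[OF e])
  finally show "(\<Sum>b\<in>Basis. hess P x b b) \<bullet> e = 0 \<bullet> e" by simp
qed

text \<open>The Laplacian of the identity \<open>|P|\<^sup>2 = |x|\<^sup>2\<^sup>k\<close>, where the second derivatives of \<open>P\<close> drop out by harmonicity.\<close>

lemma P_energy:
  assumes x: "norm x = 1"
  shows "(\<Sum>b\<in>Basis. frechet_derivative P (at x) b \<bullet> frechet_derivative P (at x) b)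
    = real k * (2 * real k + real n - 1)"
proof -
  let ?D = "frechet_derivative P (at x)"
  have xx: "x \<bullet> x = 1" using x by (simp add: norm_eq_1)
  have "?D b \<bullet> ?D b = real k * (2 * (real k - 1) * ((x \<bullet> b) * (x \<bullet> b)) + 1) - P x \<bullet> hess P x b b" if b: "b \<in> Basis" for b
  proof -
    let ?c = "\<lambda>t. x + t *\<^sub>R b"
    have c: "(?c has_vector_derivative b) (at 0)" by (auto intro!: derivative_eq_intros)
    have 1: "((\<lambda>t. P (?c t)) has_vector_derivative ?D b) (at 0)"
      using smooth_on_chain_curve[OF P_smooth UNIV_I c] by simp
    have 2: "((\<lambda>t. frechet_derivative P (at (?c t)) b) has_vector_derivative hess P x b b) (at 0)"
      using derivative_along_curve[OF open_UNIV P_smooth UNIV_I c, of "\<lambda>t. b" 0] linear_0[OF linear_DP] by simp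
    have 3: "((\<lambda>t. P (?c t) \<bullet> frechet_derivative P (at (?c t)) b) has_vector_derivative P x \<bullet> hess P x b b + ?D b \<bullet> ?D b) (at 0)"
      using bounded_bilinear.has_vector_derivative[OF bounded_bilinear_inner 1 2] by simp
    have 4: "((\<lambda>t. real k * (?c t \<bullet> ?c t) ^ (k - 1) * (?c t \<bullet> b)) has_real_derivative
        real k * (2 * (real k - 1) * ((x \<bullet> b) * (x \<bullet> b)) + 1)) (at 0)"
    proof -
      have exp: "(?c t \<bullet> ?c t) = 1 + 2 * t * (x \<bullet> b) + t\<^sup>2" "?c t \<bullet> b = x \<bullet> b + t" for t
        using xx b by (auto simp: inner_add_left inner_add_right inner_commute power2_eq_square algebra_simps)
      show ?thesis unfolding exp
        using k by (auto intro!: derivative_eq_intros simp: of_nat_diff algebra_simps)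
    qed
    show ?thesis
      using vector_derivative_unique_at[OF 3[unfolded P_inner_DP] 4[unfolded has_real_derivative_iff_has_vector_derivative]]
      by simp
  qed
  then have "(\<Sum>b\<in>Basis. ?D b \<bullet> ?D b)
      = (\<Sum>b\<in>Basis. real k * (2 * (real k - 1) * ((x \<bullet> b) * (x \<bullet> b)) + 1)) - P x \<bullet> (\<Sum>b\<in>Basis. hess P x b b)"
    by (simp add: sum_subtractf inner_sum_right)
  also have "\<dots> = real k * (2 * (real k - 1) * (\<Sum>b\<in>Basis. (x \<bullet> b) * (x \<bullet> b)) + real (DIM('v)))"
    by (simp add: hess_P_trace sum.distrib sum_distrib_left[symmetric])
  also have "(\<Sum>b\<in>Basis. (x \<bullet> b) * (x \<bullet> b)) = 1" using xx euclidean_inner[of x x] by simp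
  finally show ?thesis by (simp add: dim algebra_simps)
qed

lemma DP_self: "frechet_derivative P (at x) x = real k *\<^sub>R P x"
proof -
  have c: "((\<lambda>t. t *\<^sub>R x) has_vector_derivative x) (at 1)"
    by (auto intro!: derivative_eq_intros)
  have 1: "((\<lambda>t. P (t *\<^sub>R x)) has_vector_derivative frechet_derivative P (at x) x) (at 1)"
    using smooth_on_chain_curve[OF P_smooth UNIV_I c] by simp
  have "((\<lambda>t. t ^ k) has_real_derivative real k) (at 1)"
    by (auto intro!: derivative_eq_intros)
  then have 2: "((\<lambda>t. t ^ k *\<^sub>R P x) has_vector_derivative real k *\<^sub>R P x) (at 1)"
    by (intro bounded_linear.has_vector_derivative[OF bounded_linear_scaleR_left])
      (simp add: has_real_derivative_iff_has_vector_derivative)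
  show ?thesis using vector_derivative_unique_at[OF 1[unfolded P_homogeneous] 2] .
qed

text \<open>The total energy k (2k + n - 1) of P at a unit vector is evaluated in the basis x, A, B:
  the radial direction takes k^2 by Euler's relation, A takes p s^2, and B nothing.\<close>

lemma energy: "real p * s\<^sup>2 = real k * (real k + real n - 1)"
proof -
  obtain x :: 'v where x: "norm x = 1" by (metis vector_choose_size zero_le_one)
  obtain A B where AB: "orthonormal_basis (A \<union> B) {v. v \<bullet> x = 0}" "A \<inter> B = {}" "card A = p" "p + card B = n"
    "orthonormal_basis (insert x (A \<union> B)) UNIV" "x \<notin> A \<union> B"
    and diag: "\<And>b c. b \<in> A \<union> B \<Longrightarrow> c \<in> A \<union> B \<Longrightarrow>
      frechet_derivative P (at x) b \<bullet> frechet_derivative P (at x) c = (if b \<in> A then s\<^sup>2 else 0) * (b \<bullet> c)"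
    using singular_basis[OF x] by metis
  let ?D = "frechet_derivative P (at x)"
  have fin: "finite A" "finite B" using orthonormal_basis_finite[OF AB(1)] by auto
  have "bilinear (\<lambda>u v. ?D u \<bullet> ?D v)" using linear_DP unfolding bilinear_def
    by (auto intro!: linearI simp: linear_add linear_cmul inner_add_left inner_add_right)
  from trace_orthonormal_basis[OF orthonormal_basis_Basis AB(5) this] P_energy[OF x]
  have "real k * (2 * real k + real n - 1) = (\<Sum>b\<in>insert x (A \<union> B). ?D b \<bullet> ?D b)" by simp
  also have "\<dots> = ?D x \<bullet> ?D x + ((\<Sum>b\<in>A. ?D b \<bullet> ?D b) + (\<Sum>b\<in>B. ?D b \<bullet> ?D b))"
    using AB(2,6) fin by (simp add: sum.union_disjoint)
  also have "(\<Sum>b\<in>A. ?D b \<bullet> ?D b) = (\<Sum>b\<in>A. s\<^sup>2)"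
    using diag orthonormal_basis_inner[OF AB(1)] by (intro sum.cong) auto
  also have "(\<Sum>b\<in>B. ?D b \<bullet> ?D b) = (\<Sum>b\<in>B. 0)"
    using diag AB(2) by (intro sum.cong) auto
  also have "?D x \<bullet> ?D x = (real k)\<^sup>2"
    using x by (simp add: DP_self P_inner_self norm_eq_1 power2_eq_square)
  finally show ?thesis using AB(3) by (simp add: algebra_simps power2_eq_square)
qed

end

text \<open>Read m = n, q = p, M = k (k + n - 1), S = s^2, T = tan^2 \<theta>. Since q S = M, the
  curvature equation says M - q = (m - q) (1 + T S), and the closed forms follow.\<close>

lemma secant_algebra:
  fixes M m q T S :: real
  assumes S: "q * S = M" and eq: "q * (S - 1) = (m - q) * (1 + T * S)"
    and "0 \<le> T" "0 \<le> S" "0 < m" "0 < M" "q < M"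
  shows "q < m" "M * (1 + T) = m * (1 + T * S)" "1 / (1 + T * S) = (m - q) / (M - q)"
    "1 / (1 + T) = (1 - q / m) / (1 - q / M)"
proof -
  have pos: "0 < 1 + T * S" "0 < 1 + T" using assms by (simp_all add: add_pos_nonneg)
  have "M - q = q * (S - 1)" using S by (simp add: right_diff_distrib)
  then have Mq: "M - q = (m - q) * (1 + T * S)" using eq by simp
  have "0 < (m - q) * (1 + T * S)" using Mq \<open>q < M\<close> by linarith
  then show qm: "q < m" using pos(1) by (simp add: zero_less_mult_iff)
  have qTS: "q * (T * S) = M * T" unfolding S[symmetric] by simp
  have "M - q = m + m * (T * S) - q - q * (T * S)" unfolding Mq by (simp add: algebra_simps)
  then show MT: "M * (1 + T) = m * (1 + T * S)"
    unfolding qTS distrib_left mult_1_right by linarith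
  show "1 / (1 + T * S) = (m - q) / (M - q)"
    unfolding Mq using pos qm by simp
  have "M * (m - q) * (1 + T) = M * (1 + T) * (m - q)" by simp
  also have "\<dots> = m * (M - q)" unfolding MT Mq by simp
  finally have "M * (m - q) * (1 + T) = m * (M - q)" .
  then have "1 / (1 + T) = (M * (m - q)) / (m * (M - q))"
    using pos assms by (simp add: frac_eq_eq)
  also have "\<dots> = ((m - q) / m) / ((M - q) / M)" using assms by simp
  also have "\<dots> = (1 - q / m) / (1 - q / M)" using assms by (simp add: diff_divide_distrib)
  finally show "1 / (1 + T) = (1 - q / m) / (1 - q / M)" .
qed

section \<open>Determination of \<theta> and of the singular values of DF\<close>

context lawson_osserman
begin

abbreviation "N \<equiv> real k * (real k + real n - 1)"

lemma p_le_n: "p \<le> n"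
proof -
  obtain x :: 'v where x: "norm x = 1" by (metis vector_choose_size zero_le_one)
  show ?thesis by (rule singular_basis[OF x]) simp
qed

lemma N_gt_n: "real n < N"
proof -
  have "real n < 2 * (real n + 1)" by simp
  also have "\<dots> \<le> N" using k by (intro mult_mono) auto
  finally show ?thesis .
qed

text \<open>By homogeneity DF depends only on the direction of y. The radial vector joins the
  diagonalization because F y . DF w = tan^2 \<theta> (y . w): it has squared singular value tan^2
  \<theta>, and its image is orthogonal to those of the other basis vectors.\<close>

lemma jacobian_basis:
  assumes y: "y \<noteq> 0"
  obtains x A B where "orthonormal_basis (insert x (A \<union> B)) UNIV" "x \<notin> A \<union> B" "A \<inter> B = {}" "card A = p" "p + card B = n"
    "orthonormal_basis (A \<union> B) {w. w \<bullet> y = 0}"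
    "\<And>b c. b \<in> insert x (A \<union> B) \<Longrightarrow> c \<in> insert x (A \<union> B) \<Longrightarrow>
      D y b \<bullet> D y c = (if b = x then (tan \<theta>)\<^sup>2 else if b \<in> A then (tan \<theta>)\<^sup>2 * s\<^sup>2 else 0) * (b \<bullet> c)"
proof -
  define x where "x = y /\<^sub>R norm y"
  have x: "norm x = 1" "x \<noteq> 0" "y = norm y *\<^sub>R x" using y by (auto simp: x_def)
  have "D (norm y *\<^sub>R x) = D x" using D_scale y x(2) by simp
  then have Dy: "D y = D x" by (simp only: x(3)[symmetric])
  obtain A B where AB: "orthonormal_basis (A \<union> B) {v. v \<bullet> x = 0}" "A \<inter> B = {}" "card A = p" "p + card B = n"
    "orthonormal_basis (insert x (A \<union> B)) UNIV" "x \<notin> A \<union> B"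
    and diag: "\<And>b c. b \<in> A \<union> B \<Longrightarrow> c \<in> A \<union> B \<Longrightarrow>
      frechet_derivative P (at x) b \<bullet> frechet_derivative P (at x) c = (if b \<in> A then s\<^sup>2 else 0) * (b \<bullet> c)"
    using singular_basis[OF x(1)] by metis
  have perp: "b \<bullet> x = 0" if "b \<in> A \<union> B" for b using orthonormal_basis_mem[OF AB(1) that] by simp
  have radial: "D x x \<bullet> D x w = (tan \<theta>)\<^sup>2 * (x \<bullet> w)" for w
    using F_inner_D[OF x(2), of w] D_self[OF x(2)] by simp
  have "D y b \<bullet> D y c = (if b = x then (tan \<theta>)\<^sup>2 else if b \<in> A then (tan \<theta>)\<^sup>2 * s\<^sup>2 else 0) * (b \<bullet> c)"
    if bc: "b \<in> insert x (A \<union> B)" "c \<in> insert x (A \<union> B)" for b c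
  proof -
    consider "b = x" | "b \<noteq> x" "b \<in> A \<union> B" "c = x" | "b \<noteq> x" "b \<in> A \<union> B" "c \<in> A \<union> B" using bc by blast
    then show ?thesis
    proof cases
      case 1
      then show ?thesis using radial[of c] by (simp add: Dy)
    next
      case 2
      then show ?thesis using radial[of b] perp[of b] by (simp add: Dy inner_commute)
    next
      case 3
      then show ?thesis using diag[of b c] perp
        by (simp add: Dy derivative_tangential(2)[OF x(1)] power2_eq_square)
    qed
  qed
  moreover have "{v. v \<bullet> x = 0} = {w. w \<bullet> y = 0}" using y by (simp add: x_def)
  ultimately show ?thesis using that[of x A B] AB by simp
qed

text \<open>The component of the mean curvature vector along the normal vector \<open>(tan\<^sup>2\<theta> y, - F y)\<close>. It is
  explicit because \<open>F \<bullet> D\<^sup>2F\<close> can be read off from \<open>|F|\<^sup>2 = tan\<^sup>2\<theta> |y|\<^sup>2\<close>.\<close>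

lemma p_equation: "real p * (s\<^sup>2 - 1) = (real n - real p) * (1 + (tan \<theta>)\<^sup>2 * s\<^sup>2)"
proof -
  let ?t = "(tan \<theta>)\<^sup>2"
  obtain y :: 'v where y: "norm y = cos \<theta>" by (metis vector_choose_size less_imp_le trig(1))
  have y0: "y \<noteq> 0" using slice_norm(2)[OF y] .
  obtain x A B where AB: "x \<notin> A \<union> B" "A \<inter> B = {}" "card A = p" "p + card B = n"
    "orthonormal_basis (A \<union> B) {w. w \<bullet> y = 0}"
    and diag: "\<And>b c. b \<in> insert x (A \<union> B) \<Longrightarrow> c \<in> insert x (A \<union> B) \<Longrightarrow>
      D y b \<bullet> D y c = (if b = x then ?t else if b \<in> A then ?t * s\<^sup>2 else 0) * (b \<bullet> c)"
    using jacobian_basis[OF y0] by metis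
  have fin: "finite A" "finite B" using orthonormal_basis_finite[OF AB(5)] by auto
  define \<mu> where "\<mu> = (\<lambda>b. if b \<in> A then ?t * s\<^sup>2 else 0)"
  have \<mu>: "\<mu> b \<ge> 0" for b by (simp add: \<mu>_def)
  have DD: "D y b \<bullet> D y c = \<mu> b * (b \<bullet> c)" if "b \<in> A \<union> B" "c \<in> A \<union> B" for b c
  proof -
    have "b \<noteq> x" using that AB(1) by blast
    then show ?thesis using diag[of b c] that by (simp add: \<mu>_def)
  qed
  let ?G = "\<lambda>w. (w, D y w)"
  have lin: "linear ?G" using linear_D[OF y0] by (auto intro!: linearI simp: linear_add linear_cmul)
  have pos: "1 + \<mu> b > 0" for b using \<mu>[of b] by simp
  have G: "?G b \<bullet> ?G c = (1 + \<mu> b) * (b \<bullet> c)" if "b \<in> A \<union> B" "c \<in> A \<union> B" for b c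
    using DD[OF that] by (simp add: algebra_simps)
  define h where "h = (\<lambda>b. ?G b /\<^sub>R sqrt (1 + \<mu> b))"
  have E: "orthonormal_basis (h ` (A \<union> B)) (?G ` {w. w \<bullet> y = 0})" "inj_on h (A \<union> B)"
    unfolding h_def by (rule orthonormal_basis_normalized_image[OF AB(5) lin pos G]; assumption)+
  define \<nu> where "\<nu> = (?t *\<^sub>R y, - LO_fun f \<theta> y)"
  have \<nu>N: "\<nu> \<in> graph_normal y" using F_inner_D[OF y0] by (simp add: \<nu>_def)
  \<comment> \<open>Paired with \<nu>, the term for the unit vector h b is |DF w|^2 - tan^2 \<theta>
    |w|^2 with w = b / sqrt (1 + \<mu> b).\<close>
  have curv: "mean_curvature_term y (h b) (h b) \<bullet> \<nu> = (\<mu> b - ?t) / (1 + \<mu> b)" if b: "b \<in> A \<union> B" for b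
  proof -
    let ?w = "b /\<^sub>R sqrt (1 + \<mu> b)"
    have sq: "inverse (sqrt (1 + \<mu> b)) * inverse (sqrt (1 + \<mu> b)) = 1 / (1 + \<mu> b)"
      using pos[of b] by (simp add: divide_inverse flip: inverse_mult_distrib)
    have bb: "b \<bullet> b = 1" using orthonormal_basis_inner[OF AB(5) b b] by simp
    have "mean_curvature_term y (h b) (h b) \<bullet> \<nu> = (0, hess (LO_fun f \<theta>) y ?w ?w) \<bullet> \<nu>"
      unfolding mean_curvature_term_def orth_proj_inner[OF graph_normal_dim(1)[OF linear_D[OF y0]] \<nu>N]
      by (simp add: h_def)
    also have "\<dots> = - (LO_fun f \<theta> y \<bullet> hess (LO_fun f \<theta>) y ?w ?w)"
      by (simp add: \<nu>_def inner_commute)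
    also have "\<dots> = D y ?w \<bullet> D y ?w - ?t * (?w \<bullet> ?w)" by (simp only: F_inner_hess[OF y0] minus_diff_eq)
    also have "D y ?w = inverse (sqrt (1 + \<mu> b)) *\<^sub>R D y b" using linear_D[OF y0] by (simp add: linear_cmul)
    also have "(inverse (sqrt (1 + \<mu> b)) *\<^sub>R D y b) \<bullet> (inverse (sqrt (1 + \<mu> b)) *\<^sub>R D y b) - ?t * (?w \<bullet> ?w)
      = (inverse (sqrt (1 + \<mu> b)) * inverse (sqrt (1 + \<mu> b))) * (D y b \<bullet> D y b - ?t * (b \<bullet> b))"
      by (simp add: algebra_simps)
    also have "\<dots> = (\<mu> b - ?t) / (1 + \<mu> b)" unfolding sq DD[OF b b] bb by simp
    finally show ?thesis .
  qed
  \<comment> \<open>Each of the p vectors of A contributes tan^2 \<theta> (s^2 - 1) / (1 + tan^2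
    \<theta> s^2), each of the n - p vectors of B contributes - tan^2 \<theta>, and minimality makes
    the sum vanish.\<close>
  have "0 = (\<Sum>e\<in>h ` (A \<union> B). mean_curvature_term y e e) \<bullet> \<nu>"
    using slice_mean_curvature[OF minimal[unfolded LO_sphere_slice] y E(1)] by simp
  also have "\<dots> = (\<Sum>b\<in>A \<union> B. mean_curvature_term y (h b) (h b) \<bullet> \<nu>)"
    by (simp add: inner_sum_left sum.reindex[OF E(2)])
  also have "\<dots> = (\<Sum>b\<in>A \<union> B. (\<mu> b - ?t) / (1 + \<mu> b))" using curv by simp
  also have "\<dots> = (\<Sum>b\<in>A. (\<mu> b - ?t) / (1 + \<mu> b)) + (\<Sum>b\<in>B. (\<mu> b - ?t) / (1 + \<mu> b))"
    using fin AB(2) by (simp add: sum.union_disjoint)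
  also have "(\<Sum>b\<in>A. (\<mu> b - ?t) / (1 + \<mu> b)) = real p * ((?t * s\<^sup>2 - ?t) / (1 + ?t * s\<^sup>2))"
    using AB(3) by (simp add: \<mu>_def)
  also have "(\<Sum>b\<in>B. (\<mu> b - ?t) / (1 + \<mu> b)) = (\<Sum>b\<in>B. - ?t)"
    using AB(2) by (intro sum.cong) (auto simp: \<mu>_def)
  also have "\<dots> = - ?t * (real n - real p)" using AB(4) by (simp flip: AB(4))
  finally have "real p * ((?t * s\<^sup>2 - ?t) / (1 + ?t * s\<^sup>2)) = ?t * (real n - real p)" by simp
  moreover have "1 + ?t * s\<^sup>2 > 0" by (simp add: add_pos_nonneg)
  ultimately have "?t * (real p * (s\<^sup>2 - 1)) = ?t * ((real n - real p) * (1 + ?t * s\<^sup>2))"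
    by (simp add: field_simps)
  moreover have "?t \<noteq> 0" using trig(3) by simp
  ultimately show ?thesis using mult_left_cancel by blast
qed

lemma N_gt_p: "real p < N"
  using N_gt_n p_le_n by simp

text \<open>For p = n the right side of \<open>p_equation\<close> would vanish, while its left side
  is N - p > 0. So the differential of f has a kernel, and the equation determines tan^2
  \<theta>.\<close>

lemma p_less_n: "p < n"
  and secant_tangential: "1 / (1 + (tan \<theta>)\<^sup>2 * s\<^sup>2) = (real n - real p) / (N - real p)"
  and secant_radial: "1 / (1 + (tan \<theta>)\<^sup>2) = (1 - real p / real n) / (1 - real p / N)"
  and N_secant: "N * (1 + (tan \<theta>)\<^sup>2) = real n * (1 + (tan \<theta>)\<^sup>2 * s\<^sup>2)"
proof -
  have "0 < real n" using p p_le_n by simp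
  moreover from this have "0 < N" using N_gt_n by simp
  ultimately show "p < n"
    "1 / (1 + (tan \<theta>)\<^sup>2 * s\<^sup>2) = (real n - real p) / (N - real p)"
    "1 / (1 + (tan \<theta>)\<^sup>2) = (1 - real p / real n) / (1 - real p / N)"
    "N * (1 + (tan \<theta>)\<^sup>2) = real n * (1 + (tan \<theta>)\<^sup>2 * s\<^sup>2)"
    using secant_algebra[OF energy p_equation _ _ _ _ N_gt_p] by simp_all
qed

lemma volume_factors:
  "(cos \<theta>)\<^sup>2 = (1 - real p / real n) / (1 - real p / N)"
  "(cos \<theta>)\<^sup>2 + (sin \<theta>)\<^sup>2 * s\<^sup>2 = N / real n"
proof -
  have pos: "1 + (tan \<theta>)\<^sup>2 > 0" by (simp add: add_pos_nonneg)
  have c: "(cos \<theta>)\<^sup>2 = 1 / (1 + (tan \<theta>)\<^sup>2)"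
    using trig(5) pos by (simp add: nonzero_eq_divide_eq)
  then show "(cos \<theta>)\<^sup>2 = (1 - real p / real n) / (1 - real p / N)" using secant_radial by simp
  have "N / real n = (1 + (tan \<theta>)\<^sup>2 * s\<^sup>2) / (1 + (tan \<theta>)\<^sup>2)"
    using N_secant pos p_less_n by (simp add: frac_eq_eq mult.commute)
  also have "\<dots> = (cos \<theta>)\<^sup>2 + (tan \<theta> * cos \<theta>)\<^sup>2 * s\<^sup>2"
    unfolding power_mult_distrib c using pos by (simp add: add_divide_distrib)
  finally show "(cos \<theta>)\<^sup>2 + (sin \<theta>)\<^sup>2 * s\<^sup>2 = N / real n" by (simp only: trig(4))
qed

text \<open>Angles and slope depend only on the multiset of squared singular values of DF, so the
  basis is kept abstract and only this multiset is recorded.\<close>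

lemma jacobian_product:
  assumes y: "y \<noteq> 0"
  obtains E \<mu> where "orthonormal_basis E UNIV" "\<And>b. 0 \<le> \<mu> b"
    "\<And>b c. b \<in> E \<Longrightarrow> c \<in> E \<Longrightarrow> D y b \<bullet> D y c = \<mu> b * (b \<bullet> c)"
    "image_mset \<mu> (mset_set E) = replicate_mset p ((tan \<theta>)\<^sup>2 * s\<^sup>2) + {# (tan \<theta>)\<^sup>2 #} + replicate_mset (n - p) 0"
proof -
  let ?t = "(tan \<theta>)\<^sup>2"
  obtain x A B where AB: "orthonormal_basis (insert x (A \<union> B)) UNIV" "x \<notin> A \<union> B" "A \<inter> B = {}" "card A = p" "p + card B = n"
    and diag: "\<And>b c. b \<in> insert x (A \<union> B) \<Longrightarrow> c \<in> insert x (A \<union> B) \<Longrightarrow>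
      D y b \<bullet> D y c = (if b = x then ?t else if b \<in> A then ?t * s\<^sup>2 else 0) * (b \<bullet> c)"
    using jacobian_basis[OF y] by metis
  let ?\<mu> = "\<lambda>b. if b = x then ?t else if b \<in> A then ?t * s\<^sup>2 else 0"
  have fin: "finite A" "finite B" using orthonormal_basis_finite[OF AB(1)] by auto
  have "image_mset ?\<mu> (mset_set A) = image_mset (\<lambda>_. ?t * s\<^sup>2) (mset_set A)"
    using AB(2) fin by (intro image_mset_cong) auto
  moreover have "image_mset ?\<mu> (mset_set B) = image_mset (\<lambda>_. 0) (mset_set B)"
    using AB(2,3) fin by (intro image_mset_cong) auto
  moreover have "mset_set (insert x (A \<union> B)) = {#x#} + (mset_set A + mset_set B)"
    using AB(2,3) fin by (simp add: mset_set_Union)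
  moreover have "card B = n - p" using AB(5) by simp
  ultimately have "image_mset ?\<mu> (mset_set (insert x (A \<union> B))) = replicate_mset p (?t * s\<^sup>2) + {# ?t #} + replicate_mset (n - p) 0"
    using AB(4) by (simp add: image_mset_const_eq)
  then show ?thesis using that[of "insert x (A \<union> B)" ?\<mu>] AB(1) diag by auto
qed

end

section \<open>Volume\<close>

lemma continuous_gram_jacobian:
  fixes \<phi> :: "real^'n::finite \<Rightarrow> 'v::euclidean_space"
  assumes "smooth_on U \<phi>"
  shows "continuous_on U (gram_jacobian \<phi>)"
proof -
  have "continuous_on U (\<lambda>u. frechet_derivative \<phi> (at u) e)" for e
    by (rule smooth_on_continuous[OF smooth_on_frechet_derivative[OF assms]])
  then show ?thesis unfolding gram_jacobian_def[abs_def] det_def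
    by (auto intro!: continuous_intros)
qed

text \<open>Every admissible finite family on M is pushed to M' patch by patch, each volume being
  multiplied by c. This bounds one supremum by the other; equality comes from using a map together
  with its inverse.\<close>

lemma submanifold_volume_scale:
  fixes M :: "'v::euclidean_space set" and M' :: "'w::euclidean_space set" and X :: "'v \<Rightarrow> 'w"
  assumes inj: "inj_on X M" and "c \<ge> 0"
    and par: "\<And>U \<phi>. local_parametrization M U (\<phi> :: real^'n::finite \<Rightarrow> 'v) \<Longrightarrow> local_parametrization M' U (\<lambda>u. X (\<phi> u))"
    and gram: "\<And>U \<phi> u. local_parametrization M U (\<phi> :: real^'n \<Rightarrow> 'v) \<Longrightarrow> u \<in> U \<Longrightarrow>
      gram_jacobian (\<lambda>u. X (\<phi> u)) u = c * gram_jacobian \<phi> u"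
  shows "ennreal c * submanifold_volume TYPE('n) M \<le> submanifold_volume TYPE('n) M'"
proof -
  define vol :: "(real^'n) set \<times> (real^'n \<Rightarrow> 'v) \<times> (real^'n) set \<Rightarrow> ennreal"
    where "vol = (\<lambda>(U, \<phi>, B). \<integral>\<^sup>+ u \<in> B. ennreal (gram_jacobian \<phi> u) \<partial>lborel)"
  define vol' :: "(real^'n) set \<times> (real^'n \<Rightarrow> 'w) \<times> (real^'n) set \<Rightarrow> ennreal"
    where "vol' = (\<lambda>(U, \<phi>, B). \<integral>\<^sup>+ u \<in> B. ennreal (gram_jacobian \<phi> u) \<partial>lborel)"
  define h :: "(real^'n) set \<times> (real^'n \<Rightarrow> 'v) \<times> (real^'n) set \<Rightarrow> (real^'n) set \<times> (real^'n \<Rightarrow> 'w) \<times> (real^'n) set"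
    where "h = (\<lambda>(U, \<phi>, B). (U, (\<lambda>u. X (\<phi> u)), B))"
  define \<C> :: "((real^'n) set \<times> (real^'n \<Rightarrow> 'v) \<times> (real^'n) set) set set"
    where "\<C> = {C. finite C \<and> (\<forall>(U, \<phi>, B)\<in>C. local_parametrization M U \<phi> \<and> B \<in> sets borel \<and> B \<subseteq> U) \<and>
         disjoint_family_on (\<lambda>(U, \<phi>, B). \<phi> ` B) C}"
  define \<C>' :: "((real^'n) set \<times> (real^'n \<Rightarrow> 'w) \<times> (real^'n) set) set set"
    where "\<C>' = {C. finite C \<and> (\<forall>(U, \<phi>, B)\<in>C. local_parametrization M' U \<phi> \<and> B \<in> sets borel \<and> B \<subseteq> U) \<and>
         disjoint_family_on (\<lambda>(U, \<phi>, B). \<phi> ` B) C}"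
  have V: "submanifold_volume TYPE('n) M = (SUP C\<in>\<C>. \<Sum>t\<in>C. vol t)"
    and V': "submanifold_volume TYPE('n) M' = (SUP C\<in>\<C>'. \<Sum>t\<in>C. vol' t)"
    unfolding submanifold_volume_def \<C>_def \<C>'_def vol_def vol'_def by simp_all
  have vol: "ennreal c * vol t = vol' (h t)" if t: "t \<in> C" "C \<in> \<C>" for t C
  proof -
    obtain U \<phi> B where t': "t = (U, \<phi>, B)" by (cases t)
    have loc: "local_parametrization M U \<phi>" and B: "B \<in> sets borel" "B \<subseteq> U"
      using t unfolding \<C>_def t' by auto
    \<comment> \<open>Continuity of the Jacobian is known on U only, so measurability on the whole
      space is obtained after multiplication by the indicator of the Borel set B.\<close>
    have "continuous_on B (gram_jacobian \<phi>)"
      using loc B(2) by (auto simp: local_parametrization_def intro: continuous_on_subset continuous_gram_jacobian)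
    then have "(\<lambda>u. indicator B u *\<^sub>R gram_jacobian \<phi> u) \<in> borel_measurable borel"
      using B(1) by (intro borel_measurable_continuous_on_indicator)
    then have meas: "(\<lambda>u. ennreal (gram_jacobian \<phi> u) * indicator B u) \<in> borel_measurable lborel"
    proof -
      have "(\<lambda>u. ennreal (gram_jacobian \<phi> u) * indicator B u) = (\<lambda>u. ennreal (indicator B u *\<^sub>R gram_jacobian \<phi> u))"
        by (auto simp: indicator_def)
      then show ?thesis using \<open>(\<lambda>u. indicator B u *\<^sub>R gram_jacobian \<phi> u) \<in> borel_measurable borel\<close> by simp
    qed
    have "ennreal c * vol t = (\<integral>\<^sup>+ u. ennreal c * (ennreal (gram_jacobian \<phi> u) * indicator B u) \<partial>lborel)"
      unfolding vol_def t' by (simp add: nn_integral_cmult[OF meas])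
    also have "\<dots> = (\<integral>\<^sup>+ u. ennreal (gram_jacobian (\<lambda>u. X (\<phi> u)) u) * indicator B u \<partial>lborel)"
    proof (intro nn_integral_cong)
      fix u
      show "ennreal c * (ennreal (gram_jacobian \<phi> u) * indicator B u)
        = ennreal (gram_jacobian (\<lambda>u. X (\<phi> u)) u) * indicator B u"
        using gram[OF loc, of u] B(2) \<open>c \<ge> 0\<close> by (auto simp: indicator_def ennreal_mult')
    qed
    also have "\<dots> = vol' (h t)" by (simp add: vol'_def h_def t')
    finally show ?thesis .
  qed
  have sub: "\<phi> ` B \<subseteq> M" if "(U, \<phi>, B) \<in> C" "C \<in> \<C>" for U \<phi> B C
  proof -
    have "local_parametrization M U \<phi>" "B \<subseteq> U" using that by (auto simp: \<C>_def)
    then show ?thesis unfolding local_parametrization_def by blast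
  qed
  have disj: "\<phi> ` B \<inter> \<phi>' ` B' = {}"
    if "(U, \<phi>, B) \<in> C" "(U', \<phi>', B') \<in> C" "C \<in> \<C>" "(U, \<phi>, B) \<noteq> (U', \<phi>', B')" for U \<phi> B U' \<phi>' B' C
  proof -
    have "disjoint_family_on (\<lambda>(U, \<phi>, B). \<phi> ` B) C" using that(3) by (simp add: \<C>_def)
    from disjoint_family_onD[OF this that(1,2,4)] show ?thesis by simp
  qed
  have hC: "h ` C \<in> \<C>'" if C: "C \<in> \<C>" for C
  proof -
    have "disjoint_family_on (\<lambda>(U, \<phi>, B). \<phi> ` B) (h ` C)"
      unfolding disjoint_family_on_def
    proof (intro ballI impI)
      fix a b assume "a \<in> h ` C" "b \<in> h ` C" and ne: "a \<noteq> b"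
      obtain U \<phi> B where a': "(U, \<phi>, B) \<in> C" "a = h (U, \<phi>, B)"
        using \<open>a \<in> h ` C\<close> by (elim imageE) (metis prod_cases3)
      obtain U' \<phi>' B' where b': "(U', \<phi>', B') \<in> C" "b = h (U', \<phi>', B')"
        using \<open>b \<in> h ` C\<close> by (elim imageE) (metis prod_cases3)
      note ab = a' b'
      have "(U, \<phi>, B) \<noteq> (U', \<phi>', B')" using ne ab(2,4) by metis
      from disj[OF ab(1,3) C this] have "\<phi> ` B \<inter> \<phi>' ` B' = {}" .
      then have "X ` (\<phi> ` B) \<inter> X ` (\<phi>' ` B') = {}"
        using inj_on_image_Int[OF inj sub[OF ab(1) C] sub[OF ab(3) C]] by simp
      then show "(case a of (U, \<phi>, B) \<Rightarrow> \<phi> ` B) \<inter> (case b of (U, \<phi>, B) \<Rightarrow> \<phi> ` B) = {}"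
        by (simp add: ab(2,4) h_def image_image)
    qed
    then show ?thesis using C par by (auto simp: \<C>_def \<C>'_def h_def)
  qed
  have "ennreal c * submanifold_volume TYPE('n) M = (SUP C\<in>\<C>. ennreal c * (\<Sum>t\<in>C. vol t))"
    unfolding V by (rule SUP_mult_left_ennreal)
  also have "\<dots> \<le> (SUP C\<in>\<C>'. \<Sum>t\<in>C. vol' t)"
  proof (rule SUP_least)
    fix C assume C: "C \<in> \<C>"
    have fin: "finite C" using C by (simp add: \<C>_def)
    have "ennreal c * (\<Sum>t\<in>C. vol t) = (\<Sum>t\<in>C. vol' (h t))"
      using vol[OF _ C] by (simp add: sum_distrib_left)
    also have "\<dots> = (\<Sum>t\<in>h ` C. vol' t)"
      \<comment> \<open>Distinct patches collide under \<open>h\<close> only if the parametrizations agree on \<open>B\<close>; by disjointness \<open>B\<close> is then empty.\<close>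
    proof (rule sum.reindex_nontrivial[OF fin, unfolded comp_def, symmetric])
      fix a b assume a: "a \<in> C" and b: "b \<in> C" and "a \<noteq> b" "h a = h b"
      obtain U \<phi> B where a': "a = (U, \<phi>, B)" by (cases a)
      obtain U' \<phi>' B' where b': "b = (U', \<phi>', B')" by (cases b)
      have eq: "B' = B" "\<And>u. X (\<phi> u) = X (\<phi>' u)" using \<open>h a = h b\<close> by (auto simp: h_def a' b' fun_eq_iff)
      have "\<phi> u = \<phi>' u" if "u \<in> B" for u
        using inj_onD[OF inj eq(2)[of u]] sub[OF a[unfolded a'] C] sub[OF b[unfolded b'] C] that eq(1) by blast
      then have "B = {}" using disj[OF a[unfolded a'] b[unfolded b'] C] \<open>a \<noteq> b\<close> eq(1) unfolding a' b' by blast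
      then show "vol' (h a) = 0" by (simp add: vol'_def h_def a')
    qed
    also have "\<dots> \<le> (SUP C\<in>\<C>'. \<Sum>t\<in>C. vol' t)" by (rule SUP_upper[OF hC[OF C]])
    finally show "ennreal c * (\<Sum>t\<in>C. vol t) \<le> (SUP C\<in>\<C>'. \<Sum>t\<in>C. vol' t)" .
  qed
  finally show ?thesis unfolding V' .
qed

section \<open>Volume of the Lawson-Osserman sphere\<close>

context lawson_osserman
begin

definition volume_factor :: real where
  "volume_factor = sqrt (((cos \<theta>)\<^sup>2 + (sin \<theta>)\<^sup>2 * s\<^sup>2) ^ p * ((cos \<theta>)\<^sup>2) ^ (n - p))"

lemma volume_factor_pos: "volume_factor > 0"
  using trig(1) by (simp add: volume_factor_def add_pos_nonneg)

text \<open>\<psi> has to equal the composite on U only, so the lemma works in both directions: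
  \<phi> given and \<psi> the composite, or \<psi> given and \<phi> its rescaled first
  component.\<close>

lemma gram_LO_sphere:
  fixes \<phi> :: "real^'n::finite \<Rightarrow> 'v" and \<psi> :: "real^'n \<Rightarrow> 'v \<times> 'w"
  assumes n: "CARD('n) = n" and U: "open U" "u \<in> U" and \<phi>: "smooth_on U \<phi>" "\<And>u. u \<in> U \<Longrightarrow> norm (\<phi> u) = 1"
    and \<psi>: "\<And>u. u \<in> U \<Longrightarrow> \<psi> u = (cos \<theta> *\<^sub>R \<phi> u, sin \<theta> *\<^sub>R f (\<phi> u))"
  shows "smooth_on U \<psi>"
    and "frechet_derivative \<psi> (at u) w = (cos \<theta> *\<^sub>R frechet_derivative \<phi> (at u) w,
      sin \<theta> *\<^sub>R frechet_derivative P (at (\<phi> u)) (frechet_derivative \<phi> (at u) w))"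
    and "gram_jacobian \<psi> u = volume_factor * gram_jacobian \<phi> u"
proof -
  let ?x = "\<phi> u" and ?D\<phi> = "frechet_derivative \<phi> (at u)"
  let ?G = "\<lambda>v. (cos \<theta> *\<^sub>R v, sin \<theta> *\<^sub>R frechet_derivative P (at ?x) v)"
  have \<psi>P: "\<psi> u = (cos \<theta> *\<^sub>R \<phi> u, sin \<theta> *\<^sub>R P (\<phi> u))" if "u \<in> U" for u
    using \<psi>[OF that] f_P[OF \<phi>(2)[OF that]] by simp
  have s: "smooth_on U (\<lambda>u. (cos \<theta> *\<^sub>R \<phi> u, sin \<theta> *\<^sub>R P (\<phi> u)))"
    by (intro smooth_on_Pair smooth_on_scaleR smooth_on_const U \<phi>(1) smooth_on_compose[OF U(1) open_UNIV _ \<phi>(1) P_smooth]) auto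
  show "smooth_on U \<psi>" by (rule smooth_on_cong[OF U(1) _ s]) (simp add: \<psi>P)
  have d\<phi>: "(\<phi> has_derivative ?D\<phi>) (at u)" by (rule smooth_on_has_derivative[OF \<phi>(1) U(2)])
  have "((\<lambda>u. P (\<phi> u)) has_derivative (\<lambda>w. frechet_derivative P (at ?x) (?D\<phi> w))) (at u)"
    by (rule has_derivative_compose[OF d\<phi> smooth_on_has_derivative[OF P_smooth UNIV_I]])
  then have "((\<lambda>u. (cos \<theta> *\<^sub>R \<phi> u, sin \<theta> *\<^sub>R P (\<phi> u))) has_derivative (\<lambda>w. ?G (?D\<phi> w))) (at u)"
    by (intro has_derivative_Pair has_derivative_scaleR_right d\<phi>)
  then have "(\<psi> has_derivative (\<lambda>w. ?G (?D\<phi> w))) (at u)"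
    by (rule has_derivative_transform_within_open[OF _ U]) (simp add: \<psi>P)
  from frechet_derivative_at[OF this]
  have D\<psi>: "frechet_derivative \<psi> (at u) w = ?G (?D\<phi> w)" for w by (metis (no_types, lifting))
  then show "frechet_derivative \<psi> (at u) w = ?G (?D\<phi> w)" .
  have tan: "?D\<phi> w \<bullet> ?x = 0" for w
  proof -
    have 1: "((\<lambda>u. \<phi> u \<bullet> \<phi> u) has_derivative (\<lambda>w. \<phi> u \<bullet> ?D\<phi> w + ?D\<phi> w \<bullet> \<phi> u)) (at u)"
      by (rule has_derivative_inner[OF d\<phi> d\<phi>])
    have 2: "((\<lambda>u. \<phi> u \<bullet> \<phi> u) has_derivative (\<lambda>w. 0)) (at u)"
      by (rule has_derivative_transform_within_open[OF _ U, of "\<lambda>u. 1"])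
        (use \<phi>(2) in \<open>auto simp: norm_eq_1\<close>)
    have "\<phi> u \<bullet> ?D\<phi> w + ?D\<phi> w \<bullet> \<phi> u = 0" by (rule fun_cong[OF has_derivative_unique[OF 1 2]])
    then show ?thesis by (simp add: inner_commute)
  qed
  have x: "norm ?x = 1" using \<phi>(2) U by simp
  obtain A B where AB: "orthonormal_basis (A \<union> B) {v. v \<bullet> ?x = 0}" "A \<inter> B = {}" "card A = p" "p + card B = n"
    and diag: "\<And>b c. b \<in> A \<union> B \<Longrightarrow> c \<in> A \<union> B \<Longrightarrow>
      frechet_derivative P (at ?x) b \<bullet> frechet_derivative P (at ?x) c = (if b \<in> A then s\<^sup>2 else 0) * (b \<bullet> c)"
    using singular_basis[OF x] by metis
  have fin: "finite A" "finite B" using orthonormal_basis_finite[OF AB(1)] by auto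
  have "dim {v. v \<bullet> ?x = 0} = CARD('n)"
    using orthonormal_basis_card[OF AB(1)] AB(2-4) fin n by (simp add: card_Un_disjoint)
  then obtain \<eta> :: "'n \<Rightarrow> 'v" where \<eta>: "orthonormal_frame \<eta> {v. v \<bullet> ?x = 0}" "bij_betw \<eta> UNIV (A \<union> B)"
    using orthonormal_basis_imp_frame[OF AB(1)] by metis
  define \<kappa> where "\<kappa> = (\<lambda>b. (cos \<theta>)\<^sup>2 + (sin \<theta>)\<^sup>2 * (if b \<in> A then s\<^sup>2 else 0))"
  have lin: "linear ?G" using linear_DP by (auto intro!: linearI simp: linear_add linear_cmul scaleR_add_right)
  have G: "?G (\<eta> i) \<bullet> ?G (\<eta> j) = \<kappa> (\<eta> i) * (\<eta> i \<bullet> \<eta> j)" for i j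
    using diag[of "\<eta> i" "\<eta> j"] bij_betwE[OF \<eta>(2)] by (simp add: \<kappa>_def power2_eq_square algebra_simps)
  let ?a = "\<lambda>i::'n. ?D\<phi> (axis i 1)"
  have a: "?a i \<in> {v. v \<bullet> ?x = 0}" for i using tan by simp
  have "(\<Prod>i\<in>UNIV. \<kappa> (\<eta> i)) = (\<Prod>b\<in>A \<union> B. \<kappa> b)" by (rule prod.reindex_bij_betw[OF \<eta>(2)])
  also have "\<dots> = (\<Prod>b\<in>A. \<kappa> b) * (\<Prod>b\<in>B. \<kappa> b)" using fin AB(2) by (simp add: prod.union_disjoint)
  also have "(\<Prod>b\<in>A. \<kappa> b) = ((cos \<theta>)\<^sup>2 + (sin \<theta>)\<^sup>2 * s\<^sup>2) ^ p" using AB(3) by (simp add: \<kappa>_def)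
  also have "(\<Prod>b\<in>B. \<kappa> b) = (\<Prod>b\<in>B. (cos \<theta>)\<^sup>2)" using AB(2) by (intro prod.cong) (auto simp: \<kappa>_def)
  also have "\<dots> = ((cos \<theta>)\<^sup>2) ^ (n - p)" by (simp flip: AB(4))
  \<comment> \<open>\<open>det_gram\<close> is applied to ?G and to the identity with the same
    vectors; the common factor is the squared determinant of their coefficients.\<close>
  finally have "det (\<chi> i j. ?G (?a i) \<bullet> ?G (?a j) :: real^'n^'n)
      = ((cos \<theta>)\<^sup>2 + (sin \<theta>)\<^sup>2 * s\<^sup>2) ^ p * ((cos \<theta>)\<^sup>2) ^ (n - p) * det (\<chi> i j. ?a i \<bullet> ?a j :: real^'n^'n)"
    using det_gram[OF \<eta>(1) lin a G] det_gram[OF \<eta>(1) linear_ident a, of "\<lambda>_. 1"] by simp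
  then show "gram_jacobian \<psi> u = volume_factor * gram_jacobian \<phi> u"
    unfolding gram_jacobian_def D\<psi> volume_factor_def by (simp add: real_sqrt_mult)
qed

lemma LO_sphere_volume:
  assumes n: "CARD('n::finite) = n"
  shows "submanifold_volume TYPE('n) (LO_sphere f \<theta>) = ennreal volume_factor * submanifold_volume TYPE('n) (sphere (0::'v) 1)"
proof -
  let ?M = "LO_sphere f \<theta>" and ?S = "sphere (0::'v) 1"
  \<comment> \<open>The inverse of ?X is the restriction of a linear map, so composing a
    parametrization with it is smooth at once.\<close>
  let ?X = "\<lambda>x. (cos \<theta> *\<^sub>R x, sin \<theta> *\<^sub>R f x)" and ?Y = "\<lambda>q::'v \<times> 'w. (1 / cos \<theta>) *\<^sub>R fst q"
  have YX: "?Y (?X x) = x" for x using trig(1) by simp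
  have XY: "?X (?Y q) = q" and YS: "?Y q \<in> ?S" if "q \<in> ?M" for q
    using that trig(1) by (auto simp: LO_sphere_def)
  have injX: "inj_on ?X ?S" by (rule inj_on_inverseI[where g = ?Y]) (rule YX)
  have injY: "inj_on ?Y ?M" by (rule inj_on_inverseI[where g = ?X]) (rule XY)
  have X: "local_parametrization ?M U (\<lambda>u. ?X (\<phi> u))" "u \<in> U \<Longrightarrow> gram_jacobian (\<lambda>u. ?X (\<phi> u)) u = volume_factor * gram_jacobian \<phi> u"
    if loc: "local_parametrization ?S U \<phi>" for U u and \<phi> :: "real^'n \<Rightarrow> 'v"
  proof -
    have U: "open U" "smooth_on U \<phi>" "\<And>u. u \<in> U \<Longrightarrow> norm (\<phi> u) = 1" "inj_on \<phi> U" "\<And>u. u \<in> U \<Longrightarrow> inj (frechet_derivative \<phi> (at u))"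
      using loc by (auto simp: local_parametrization_def)
    note g = gram_LO_sphere[OF n U(1) _ U(2,3) refl]
    show "u \<in> U \<Longrightarrow> gram_jacobian (\<lambda>u. ?X (\<phi> u)) u = volume_factor * gram_jacobian \<phi> u" by (rule g(3))
    show "local_parametrization ?M U (\<lambda>u. ?X (\<phi> u))"
      unfolding local_parametrization_def
    proof (intro conjI ballI)
      \<comment> \<open>The facts of \<open>gram_LO_sphere\<close> are stated at a point of U, so
        the empty domain is treated apart.\<close>
      show "smooth_on U (\<lambda>u. ?X (\<phi> u))"
      proof (cases "U = {}")
        case True
        then show ?thesis using smooth_on_subset[OF smooth_on_const[OF open_UNIV]] smooth_on_cong[OF U(1)] by blast
      next
        case False
        then show ?thesis using g(1) by blast
      qed
      show "inj_on (\<lambda>u. ?X (\<phi> u)) U" using U(4) trig(1) by (auto simp: inj_on_def)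
      show "(\<lambda>u. ?X (\<phi> u)) ` U \<subseteq> ?M" using U(3) by (auto simp: LO_sphere_def)
      show "inj (frechet_derivative (\<lambda>u. ?X (\<phi> u)) (at u))" if "u \<in> U" for u
        using U(5)[OF that] trig(1) by (auto simp: inj_on_def g(2)[OF that])
    qed (rule U(1))
  qed
  have Y: "local_parametrization ?S U (\<lambda>u. ?Y (\<psi> u))" "u \<in> U \<Longrightarrow> gram_jacobian (\<lambda>u. ?Y (\<psi> u)) u = (1 / volume_factor) * gram_jacobian \<psi> u"
    if loc: "local_parametrization ?M U \<psi>" for U u and \<psi> :: "real^'n \<Rightarrow> 'v \<times> 'w"
  proof -
    have U: "open U" "smooth_on U \<psi>" "\<And>u. u \<in> U \<Longrightarrow> \<psi> u \<in> ?M" "inj_on \<psi> U" "\<And>u. u \<in> U \<Longrightarrow> inj (frechet_derivative \<psi> (at u))"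
      using loc by (auto simp: local_parametrization_def)
    have s: "smooth_on U (\<lambda>u. ?Y (\<psi> u))"
      by (intro smooth_on_scaleR smooth_on_const smooth_on_linear[OF bounded_linear_fst] U)
    have S: "norm (?Y (\<psi> u)) = 1" if "u \<in> U" for u
      using YS[OF U(3)[OF that]] by (simp only: mem_sphere_0)
    have eq: "\<psi> u = ?X (?Y (\<psi> u))" if "u \<in> U" for u
      by (rule XY[OF U(3)[OF that], symmetric])
    note g = gram_LO_sphere[OF n U(1) _ s S eq]
    show "u \<in> U \<Longrightarrow> gram_jacobian (\<lambda>u. ?Y (\<psi> u)) u = (1 / volume_factor) * gram_jacobian \<psi> u"
      using g(3) volume_factor_pos by simp
    show "local_parametrization ?S U (\<lambda>u. ?Y (\<psi> u))"
      unfolding local_parametrization_def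
    proof (intro conjI ballI)
      show "inj_on (\<lambda>u. ?Y (\<psi> u)) U"
        by (intro inj_onI) (use inj_onD[OF U(4) inj_onD[OF injY]] U(3) in blast)
      show "(\<lambda>u. ?Y (\<psi> u)) ` U \<subseteq> ?S" using YS U(3) by blast
      show "inj (frechet_derivative (\<lambda>u. ?Y (\<psi> u)) (at u))" if u: "u \<in> U" for u
      proof (rule injI)
        fix v w assume "frechet_derivative (\<lambda>u. ?Y (\<psi> u)) (at u) v = frechet_derivative (\<lambda>u. ?Y (\<psi> u)) (at u) w"
        then have "frechet_derivative \<psi> (at u) v = frechet_derivative \<psi> (at u) w"
          by (simp add: g(2) u)
        then show "v = w" using U(5)[OF u] by (simp add: inj_eq)
      qed
    qed (use U s in auto)
  qed
  have le1: "ennreal volume_factor * submanifold_volume TYPE('n) ?S \<le> submanifold_volume TYPE('n) ?M"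
    by (rule submanifold_volume_scale[OF injX less_imp_le[OF volume_factor_pos] X])
  have le2: "ennreal (1 / volume_factor) * submanifold_volume TYPE('n) ?M \<le> submanifold_volume TYPE('n) ?S"
    by (rule submanifold_volume_scale[OF injY _ Y]) (use volume_factor_pos in auto)
  have "submanifold_volume TYPE('n) ?M = ennreal volume_factor * (ennreal (1 / volume_factor) * submanifold_volume TYPE('n) ?M)"
  proof -
    have "ennreal volume_factor * ennreal (1 / volume_factor) = 1"
      using volume_factor_pos by (subst ennreal_mult[symmetric]) auto
    then show ?thesis by (simp add: mult.assoc[symmetric])
  qed
  also have "\<dots> \<le> ennreal volume_factor * submanifold_volume TYPE('n) ?S"
    using le2 by (rule mult_left_mono) simp
  finally show ?thesis using le1 by (rule antisym)
qed

end

lemma powr_half_nat: "0 < x \<Longrightarrow> x powr (real j / 2) = sqrt x ^ j"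
proof -
  assume x: "0 < x"
  have "x powr (real j / 2) = (x powr (1 / 2)) powr real j" by (simp add: powr_powr)
  also have "\<dots> = sqrt x ^ j" using x by (simp add: powr_half_sqrt powr_realpow)
  finally show ?thesis .
qed

section \<open>Closed forms for the angles, and the cone as a graph\<close>

context lawson_osserman
begin

abbreviation "cos_radial \<equiv> sqrt ((1 - real p / real n) / (1 - real p / N))"
abbreviation "cos_tangential \<equiv> sqrt ((real n - real p) / (N - real p))"

lemma cos_radial: "1 / sqrt (1 + (tan \<theta>)\<^sup>2) = cos_radial"
  and cos_tangential: "1 / sqrt (1 + (tan \<theta>)\<^sup>2 * s\<^sup>2) = cos_tangential"
  unfolding secant_radial[symmetric] secant_tangential[symmetric] by (simp_all add: real_sqrt_divide)

lemma cos_bounds: "0 < cos_radial" "cos_radial < 1" "0 < cos_tangential" "cos_tangential \<le> 1"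
proof -
  show "0 < cos_radial" "cos_radial < 1"
    unfolding cos_radial[symmetric] using trig(3) by (simp_all add: add_pos_nonneg)
  show "0 < cos_tangential" "cos_tangential \<le> 1"
    unfolding cos_tangential[symmetric] by (simp_all add: add_pos_nonneg)
qed

text \<open>The argument of arccos lies strictly between 0 and 1: the radial factor is already below
  1 because tan \<theta> > 0, and the tangential factors do not exceed 1.\<close>

lemma cos_alpha:
  "cos (alpha_angle n p k) = cos_radial * ((real n - real p) / (N - real p)) powr (real p / 2)"
  "cos (alpha_angle n p k) = cos_radial * cos_tangential ^ p"
  "0 < alpha_angle n p k" "alpha_angle n p k < pi / 2"
proof -
  have pos: "0 < (real n - real p) / (N - real p)" using p_less_n N_gt_p by simp
  define c where "c = cos_radial * cos_tangential ^ p"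
  have al: "alpha_angle n p k = arccos c"
    by (simp add: alpha_angle_def powr_half_nat[OF pos] c_def)
  have "0 < c" unfolding c_def using cos_bounds by simp
  have "c \<le> cos_radial * 1" unfolding c_def
    using cos_bounds by (intro mult_left_mono power_le_one) (auto intro: less_imp_le)
  then have "c < 1" using cos_bounds(2) by linarith
  show "cos (alpha_angle n p k) = cos_radial * cos_tangential ^ p"
    unfolding al using \<open>0 < c\<close> \<open>c < 1\<close> by (subst cos_arccos) (auto simp: c_def)
  then show "cos (alpha_angle n p k) = cos_radial * ((real n - real p) / (N - real p)) powr (real p / 2)"
    by (simp only: powr_half_nat[OF pos])
  show "0 < alpha_angle n p k"
    unfolding al using arccos_less_arccos[of c 1] \<open>0 < c\<close> \<open>c < 1\<close> by simp
  show "alpha_angle n p k < pi / 2"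
    unfolding al using arccos_less_arccos[of 0 c] \<open>0 < c\<close> \<open>c < 1\<close> by simp
qed

text \<open>The product of the secants of the Jordan angles. It is the slope and also, through the
  graph of -(DF)^T, the reciprocal of the cosine between normal plane and Q_0.\<close>

lemma jacobian_prod_sqrt:
  assumes "image_mset \<mu> (mset_set E) = replicate_mset p ((tan \<theta>)\<^sup>2 * s\<^sup>2) + {# (tan \<theta>)\<^sup>2 #} + replicate_mset (n - p) 0"
  shows "(\<Prod>b\<in>E. sqrt (1 + \<mu> b)) = 1 / cos (alpha_angle n p k)"
proof -
  have "(\<Prod>b\<in>E. sqrt (1 + \<mu> b)) = prod_mset (image_mset (\<lambda>m. sqrt (1 + m)) (image_mset \<mu> (mset_set E)))"
    by (simp add: prod_unfold_prod_mset image_mset.compositionality comp_def)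
  also have "\<dots> = sqrt (1 + (tan \<theta>)\<^sup>2 * s\<^sup>2) ^ p * sqrt (1 + (tan \<theta>)\<^sup>2)"
    unfolding assms by (simp add: mult.commute)
  also have "\<dots> = 1 / (cos_radial * cos_tangential ^ p)"
    unfolding cos_radial[symmetric] cos_tangential[symmetric] by (simp add: power_divide)
  finally show ?thesis by (simp only: cos_alpha(2))
qed

text \<open>Rescaling y to the radius cos \<theta> exhibits each graph point as a nonnegative
  multiple of a point of the slice.\<close>

lemma LO_cone_graph: "LO_cone f \<theta> = range (\<lambda>y. (y, LO_fun f \<theta> y))"
proof -
  have F0: "LO_fun f \<theta> 0 = 0" by (simp add: LO_fun_def)
  have graph: "q \<in> range (\<lambda>y. (y, LO_fun f \<theta> y)) \<longleftrightarrow> (\<exists>c y. 0 \<le> c \<and> norm y = cos \<theta> \<and> q = c *\<^sub>R (y, LO_fun f \<theta> y))" for q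
  proof
    assume "q \<in> range (\<lambda>y. (y, LO_fun f \<theta> y))"
    then obtain y where y: "q = (y, LO_fun f \<theta> y)" by blast
    show "\<exists>c y. 0 \<le> c \<and> norm y = cos \<theta> \<and> q = c *\<^sub>R (y, LO_fun f \<theta> y)"
    proof (cases "y = 0")
      case True
      \<comment> \<open>The apex is 0 times a point of the slice, so some such point has to be
        produced.\<close>
      obtain z :: 'v where "norm z = cos \<theta>" by (metis vector_choose_size less_imp_le trig(1))
      then show ?thesis using True y F0 by (intro exI[of _ 0] exI[of _ z]) auto
    next
      case False
      define t where "t = norm y / cos \<theta>"
      have t: "t > 0" using False trig(1) by (simp add: t_def)
      have "norm (y /\<^sub>R t) = cos \<theta>" using False trig(1) by (simp add: t_def)
      moreover have "q = t *\<^sub>R (y /\<^sub>R t, LO_fun f \<theta> (y /\<^sub>R t))"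
        using homogeneous[OF t, of "y /\<^sub>R t"] t y by simp
      ultimately show ?thesis using t less_imp_le by blast
    qed
  next
    assume "\<exists>c y. 0 \<le> c \<and> norm y = cos \<theta> \<and> q = c *\<^sub>R (y, LO_fun f \<theta> y)"
    then obtain c y where c: "0 \<le> c" "q = c *\<^sub>R (y, LO_fun f \<theta> y)" by blast
    have "LO_fun f \<theta> (c *\<^sub>R y) = c *\<^sub>R LO_fun f \<theta> y"
      using c(1) homogeneous[of c y] F0 by (cases "c = 0") auto
    then show "q \<in> range (\<lambda>y. (y, LO_fun f \<theta> y))" using c(2) by auto
  qed
  have cone: "LO_cone f \<theta> = {c *\<^sub>R x | c x. 0 \<le> c \<and> x \<in> slice}"
    unfolding LO_cone_def LO_sphere_slice by (rule cone_hull_expl)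
  have "q \<in> LO_cone f \<theta> \<longleftrightarrow> (\<exists>c y. 0 \<le> c \<and> norm y = cos \<theta> \<and> q = c *\<^sub>R (y, LO_fun f \<theta> y))" for q
  proof
    assume "q \<in> LO_cone f \<theta>"
    then obtain c y where "q = c *\<^sub>R (y, LO_fun f \<theta> y)" "0 \<le> c" "norm y = cos \<theta>"
      unfolding cone by (auto simp del: scaleR_Pair)
    then show "\<exists>c y. 0 \<le> c \<and> norm y = cos \<theta> \<and> q = c *\<^sub>R (y, LO_fun f \<theta> y)" by blast
  next
    assume "\<exists>c y. 0 \<le> c \<and> norm y = cos \<theta> \<and> q = c *\<^sub>R (y, LO_fun f \<theta> y)"
    then obtain c y where "q = c *\<^sub>R (y, LO_fun f \<theta> y)" "0 \<le> c" "(y, LO_fun f \<theta> y) \<in> slice"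
      by auto
    then show "q \<in> LO_cone f \<theta>" unfolding cone by blast
  qed
  then show ?thesis using graph by (intro set_eqI) (simp only:)
qed

lemma LO_cone_punctured: "LO_cone f \<theta> - {0} = punctured_graph"
  unfolding LO_cone_graph by (auto simp: LO_fun_def zero_prod_def)

lemma LO_cone_minimal: "minimal_submanifold (n + 1) (LO_cone f \<theta> - {0}) UNIV"
  using minimal_cone[OF minimal[unfolded LO_sphere_slice]] by (simp add: LO_cone_punctured dim)

lemma LO_cone_angles:
  assumes q: "q \<in> LO_cone f \<theta> - {0}"
  shows "jordan_angles (tangent_space (LO_cone f \<theta>) q) {(x, y). y = 0} =
      replicate_mset p (arccos cos_tangential) + {# arccos cos_radial #} + replicate_mset (n - p) 0"
    and "slope (tangent_space (LO_cone f \<theta>) q) {(x, y). y = 0} = 1 / cos (alpha_angle n p k)"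
proof -
  obtain y where y: "y \<noteq> 0" "q = (y, LO_fun f \<theta> y)" using q unfolding LO_cone_punctured by blast
  have T: "tangent_space (LO_cone f \<theta>) q = graph_tangent y"
    unfolding y(2) by (rule cone_tangent_space[OF y(1)]) (auto simp: LO_cone_graph)
  obtain E \<mu> where E: "orthonormal_basis E UNIV" and \<mu>: "\<And>b. 0 \<le> \<mu> b"
    and diag: "\<And>b c. b \<in> E \<Longrightarrow> c \<in> E \<Longrightarrow> D y b \<bullet> D y c = \<mu> b * (b \<bullet> c)"
    and im: "image_mset \<mu> (mset_set E) = replicate_mset p ((tan \<theta>)\<^sup>2 * s\<^sup>2) + {# (tan \<theta>)\<^sup>2 #} + replicate_mset (n - p) 0"
    using jacobian_product[OF y(1)] by metis
  have "jordan_angles (graph_tangent y) {(x, y). y = 0}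
      = image_mset (\<lambda>b. arccos (1 / sqrt (1 + \<mu> b))) (mset_set E)"
    by (rule graph_jordan_angles[OF E linear_D[OF y(1)] diag \<mu>])
  also have "\<dots> = image_mset (\<lambda>m. arccos (1 / sqrt (1 + m))) (image_mset \<mu> (mset_set E))"
    by (simp add: image_mset.compositionality comp_def)
  also have "\<dots> = replicate_mset p (arccos cos_tangential) + {# arccos cos_radial #} + replicate_mset (n - p) 0"
    unfolding im by (simp add: cos_radial cos_tangential)
  finally show "jordan_angles (tangent_space (LO_cone f \<theta>) q) {(x, y). y = 0} =
      replicate_mset p (arccos cos_tangential) + {# arccos cos_radial #} + replicate_mset (n - p) 0"
    unfolding T .
  have "slope (graph_tangent y) {(x, y). y = 0} = (\<Prod>b\<in>E. sqrt (1 + \<mu> b))"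
    by (rule graph_slope[OF E linear_D[OF y(1)] diag \<mu>])
  then show "slope (tangent_space (LO_cone f \<theta>) q) {(x, y). y = 0} = 1 / cos (alpha_angle n p k)"
    unfolding T jacobian_prod_sqrt[OF im] .
qed

lemma volume_factor_eq:
  "volume_factor = (N / real n) powr (real p / 2) *
    ((1 - real p / real n) / (1 - real p / N)) powr ((real n - real p) / 2)"
proof -
  have "0 < N / real n" "0 < (1 - real p / real n) / (1 - real p / N)"
    unfolding volume_factors[symmetric] using trig(1) by (simp_all add: add_pos_nonneg)
  moreover have "real n - real p = real (n - p)" using p_le_n by simp
  ultimately show ?thesis
    unfolding volume_factor_def volume_factors(2) unfolding volume_factors(1)
    by (simp only: powr_half_nat real_sqrt_mult real_sqrt_power)
qed

end

text \<open>The type \<open>'n\<close> supplies the index set of the coordinates in which volumes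
  are integrated. The subspace and dimension claims make \<open>acute_angle\<close>, which speaks of
  frames indexed by \<open>'b\<close>, meaningful for the normal planes.\<close>

theorem corollary2p9:
  fixes f :: "real^'a \<Rightarrow> real^'b" and n m p k :: nat and \<theta> :: real
    and Q\<^sub>0 Q\<^sub>0_perp :: "((real^'a) \<times> (real^'b)) set"
  assumes dims: "CARD('n::finite) = n" "CARD('a) = n + 1" "CARD('b) = m + 1"
    and type: "LOMSE_of_type n p k f"
    and \<theta>: "0 < \<theta>" "\<theta> < pi / 2" "minimal_submanifold n (LO_sphere f \<theta>) (sphere 0 1)"
    and Q\<^sub>0: "Q\<^sub>0 = {(x, y). x = 0}"
    and Q\<^sub>0_perp: "Q\<^sub>0_perp = {(x, y). y = 0}"
  shows
    "((\<forall>q\<in>LO_sphere f \<theta>.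
        subspace (normal_plane (LO_sphere f \<theta>) (sphere 0 1) q) \<and>
        dim (normal_plane (LO_sphere f \<theta>) (sphere 0 1) q) = m + 1 \<and>
        acute_angle TYPE('b) (normal_plane (LO_sphere f \<theta>) (sphere 0 1) q) Q\<^sub>0 = alpha_angle n p k)
      \<and> 0 < alpha_angle n p k \<and> alpha_angle n p k < pi / 2
      \<and> cos (alpha_angle n p k) =
          sqrt ((1 - real p / real n) / (1 - real p / (real k * (real k + real n - 1)))) *
          ((real n - real p) / (real k * (real k + real n - 1) - real p)) powr (real p / 2))
     \<and>
     submanifold_volume TYPE('n::finite) (LO_sphere f \<theta>) =
       ennreal ((real k * (real k + real n - 1) / real n) powr (real p / 2) *
         ((1 - real p / real n) / (1 - real p / (real k * (real k + real n - 1))))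
           powr ((real n - real p) / 2)) *
       submanifold_volume TYPE('n::finite) (sphere (0 :: real^'a) 1)
     \<and>
     (LO_cone f \<theta> = range (\<lambda>y. (y, LO_fun f \<theta> y))
      \<and> smooth_on (- {0}) (LO_fun f \<theta>)
      \<and> minimal_submanifold (n + 1) (LO_cone f \<theta> - {0}) UNIV
      \<and> (\<forall>q\<in>LO_cone f \<theta> - {0}.
          jordan_angles (tangent_space (LO_cone f \<theta>) q) Q\<^sub>0_perp =
            replicate_mset p
              (arccos (sqrt ((real n - real p) / (real k * (real k + real n - 1) - real p))))
            + {# arccos (sqrt ((1 - real p / real n)
                               / (1 - real p / (real k * (real k + real n - 1))))) #}
            + replicate_mset (n - p) 0
          \<and> slope (tangent_space (LO_cone f \<theta>) q) Q\<^sub>0_perp = 1 / cos (alpha_angle n p k)))"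
proof -
  have lomse: "LOMSE n f" and pk: "p \<ge> 1" "k \<ge> 2"
    and harm: "\<And>b. b \<in> Basis \<Longrightarrow> spherical_harmonic k (\<lambda>x. f x \<bullet> b)"
    using type by (auto simp: LOMSE_of_type_def)
  obtain s where s: "s > 0" "\<And>x \<sigma>. norm x = 1 \<Longrightarrow> \<sigma> > 0 \<Longrightarrow> sphere_singular_mult f x \<sigma> = (if \<sigma> = s then p else 0)"
    using type by (auto simp: LOMSE_of_type_def)
  obtain P where P: "smooth_on UNIV P" "\<And>c x. P (c *\<^sub>R x) = c ^ k *\<^sub>R P x"
    "\<And>b x. b \<in> Basis \<Longrightarrow> laplacian (\<lambda>y. P y \<bullet> b) x = 0" "\<And>x. norm x = 1 \<Longrightarrow> f x = P x"
    using spherical_harmonic_extension[OF harm] by blast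
  have "f ` sphere 0 1 \<subseteq> sphere 0 1" using lomse by (simp add: LOMSE_def LOM_def)
  then have unit: "norm (f x) = 1" if "norm x = 1" for x
    using that by (simp add: image_subset_iff)
  interpret lawson_osserman f P n p k s \<theta>
    by unfold_locales (use dims s P unit pk \<theta> in simp_all)
  have A: "subspace (normal_plane (LO_sphere f \<theta>) (sphere 0 1) q)"
    "dim (normal_plane (LO_sphere f \<theta>) (sphere 0 1) q) = m + 1"
    "acute_angle TYPE('b) (normal_plane (LO_sphere f \<theta>) (sphere 0 1) q) Q\<^sub>0 = alpha_angle n p k"
    if q: "q \<in> LO_sphere f \<theta>" for q
  proof -
    obtain y where y: "norm y = cos \<theta>" "q = (y, LO_fun f \<theta> y)"
      using q unfolding LO_sphere_slice by auto
    have y0: "y \<noteq> 0" using slice_norm(2)[OF y(1)] .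
    have N: "normal_plane (LO_sphere f \<theta>) (sphere 0 1) q = graph_normal y"
      unfolding LO_sphere_slice y(2) by (rule slice_normal_plane[OF y(1)])
    show "subspace (normal_plane (LO_sphere f \<theta>) (sphere 0 1) q)"
      "dim (normal_plane (LO_sphere f \<theta>) (sphere 0 1) q) = m + 1"
      unfolding N using graph_normal_dim[OF linear_D[OF y0]] dims by simp_all
    obtain E \<mu> where E: "orthonormal_basis E UNIV" and \<mu>: "\<And>b. 0 \<le> \<mu> b"
      and diag: "\<And>b c. b \<in> E \<Longrightarrow> c \<in> E \<Longrightarrow> D y b \<bullet> D y c = \<mu> b * (b \<bullet> c)"
      and im: "image_mset \<mu> (mset_set E) = replicate_mset p ((tan \<theta>)\<^sup>2 * s\<^sup>2) + {# (tan \<theta>)\<^sup>2 #} + replicate_mset (n - p) 0"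
      using jacobian_product[OF y0] by metis
    have "acute_angle TYPE('b) (graph_normal y) Q\<^sub>0 = arccos (1 / (\<Prod>b\<in>E. sqrt (1 + \<mu> b)))"
      unfolding Q\<^sub>0 by (rule graph_acute_angle[OF E linear_D[OF y0] diag \<mu>])
    also have "\<dots> = arccos (cos (alpha_angle n p k))" by (simp add: jacobian_prod_sqrt[OF im])
    also have "\<dots> = alpha_angle n p k"
      using cos_alpha(3,4) by (intro arccos_cos) auto
    finally show "acute_angle TYPE('b) (normal_plane (LO_sphere f \<theta>) (sphere 0 1) q) Q\<^sub>0 = alpha_angle n p k"
      unfolding N .
  qed
  show ?thesis
    using A cos_alpha(1,3,4) LO_sphere_volume[OF dims(1)] volume_factor_eq LO_cone_graph smooth_LO_fun
      LO_cone_minimal LO_cone_angles unfolding Q\<^sub>0_perp by simp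
qed

end
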